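(* Let $k\in\mathbb{Z}_{\ge 0}$ and $n\in\mathbb{Z}_{\ge 1}$. (a) If $\lambda\in\Lambda_{k,S_n}$, then $$\frac{1}{n!}\sum_{\sigma\in S_n}F(\sigma)^k\,\chi_\lambda(\sigma)\;=\;\dim(Z_{k,n}^\lambda)\;=\;m_{k,n}^\lambda\;=\;\sum_{t=|\lambda^\#|}^{n}\genfrac{\{}{\}}{0pt}{}{k}{t}\,f^{\lambda/[n-t]}.$$ (b) $$\dim(Z_{k,n})=\dim\big(Z_{2k,n}^{[n]}\big)=\frac{1}{n!}\sum_{\sigma\in S_n}F(\sigma)^{2k}=\sum_{t=0}^{n}\genfrac{\{}{\}}{0pt}{}{2k}{t}=B(2k,n).$$ Furthermore, $\dim(Z_{k,n})=B(2k,n)=B(2k)$ if $n\ge 2k$. (c) If $\mu\in\Lambda_{k+\frac12,S_{n-1}}$, then $$\dim\big(Z_{k+\frac12,n}^\mu\big)=\sum_{t=|\mu^\#|}^{n-1}\genfrac{\{}{\}}{0pt}{}{k+1}{t+1}\,f^{\mu/[n-1-t]}=\frac{1}{(n-1)!}\sum_{\tau\in S_{n-1}}\big(F(\tau)+1\big)^k\,\chi_\mu(\tau).$$ (d) $$\dim(Z_{k+\frac12,n})=\dim\big(Z_{2k+\frac12,n}^{[n-1]}\big)=\sum_{t=1}^{n}\genfrac{\{}{\}}{0pt}{}{2k+1}{t}=B(2k+1,n).$$ Furthermore, $\dim(Z_{k+\frac12,n})=B(2k+1,n)=B(2k+1)$ if $n\ge 2k+1$.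
   Context: $\mathbb{F}$ is a field of characteristic zero. For a partition $\lambda\vdash n$, $S_n^\lambda$ is the irreducible $S_n$-module over $\mathbb{F}$ indexed by $\lambda$ and $\chi_\lambda$ is its character; $S_n^{[n]}$ is the trivial module ($S_0$ is the trivial group). $M_n$ is the $n$-dimensional permutation module with basis $v_1,\dots,v_n$, $\sigma.v_i=v_{\sigma(i)}$, and $S_n$ acts diagonally on $M_n^{\otimes k}$, with $M_n^{\otimes 0}=\mathbb{F}$ the trivial module. $S_{n-1}$ is viewed as the subgroup of $S_n$ fixing $n$. $Z_{k,n}=\mathrm{End}_{S_n}(M_n^{\otimes k})$ and $Z_{k+\frac12,n}=\mathrm{End}_{S_{n-1}}(M_n^{\otimes k})$ (restricting the action on $M_n^{\otimes k}$ to $S_{n-1}$). $m_{k,n}^\lambda$ is the multiplicity of $S_n^\lambda$ in $M_n^{\otimes k}$, and $\Lambda_{k,S_n}$ is the set of $\lambda\vdash n$ with $m_{k,n}^\lambda\ge 1$. $\Lambda_{k+\frac12,S_{n-1}}$ is the set of $\mu\vdash n-1$ such that $S_{n-1}^\mu$ occurs in the restriction of $M_n^{\otimes k}$ to $S_{n-1}$. $Z_{k,n}^\lambda$ ($\lambda\in\Lambda_{k,S_n}$) is the irreducible $Z_{k,n}$-module indexed by $\lambda$ via Schur–Weyl duality, i.e. $\mathrm{Hom}_{S_n}(S_n^\lambda,M_n^{\otimes k})$; similarly $Z_{k+\frac12,n}^\mu$ is $\mathrm{Hom}_{S_{n-1}}(S_{n-1}^\mu,M_n^{\otimes k})$. When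 the indicated irreducible does not occur, these modules are $0$. $F(\sigma)$ is the number of fixed points of the permutation $\sigma$ (for $\tau\in S_{n-1}$, fixed points in $\{1,\dots,n-1\}$), and $0^0=1$. $\genfrac{\{}{\}}{0pt}{}{k}{t}$ is the Stirling number of the second kind, the number of set partitions of a $k$-element set into $t$ nonempty blocks (so $\genfrac{\{}{\}}{0pt}{}{0}{0}=1$). $B(\ell)$ is the Bell number, and $B(\ell,n)$ is the number of set partitions of an $\ell$-element set into at most $n$ blocks (equal to $1$ if $\ell=0$). For a partition $\lambda$, $\lambda^\#$ is obtained by removing one copy of the largest part, $|\lambda^\#|$ is the sum of its parts, and $f^{\lambda/\nu}$ is the number of standard tableaux of skew shape $\lambda/\nu$ (with $f^{\lambda/\lambda}=1$). Here $[m]$ denotes the one-part partition of $m$, with $[0]=\emptyset$. *)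

theory Defs
  imports
    Complex_Main
    "HOL-Library.Function_Algebras"
    "HOL-Library.Disjoint_Sets"
    "HOL-Combinatorics.Permutations"
    "HOL-Combinatorics.Stirling"
begin

section \<open>Function spaces as vector spaces\<close>

text \<open>
  All modules below are subspaces of spaces of functions \<open>'x \<Rightarrow> 'a\<close> over a field \<open>'a\<close>, where
  \<open>f\<close> stands for the formal linear combination of the \<open>x\<close> with coefficients \<open>f x\<close>.
  Spaces of linear maps between them are in turn subspaces of
  \<open>'v \<Rightarrow> 'x \<Rightarrow> 'a\<close>.
\<close>

definition fscale :: "'a::field \<Rightarrow> ('x \<Rightarrow> 'a) \<Rightarrow> 'x \<Rightarrow> 'a"
  where "fscale c f = (\<lambda>x. c * f x)"

definition hscale :: "'a::field \<Rightarrow> ('v \<Rightarrow> 'x \<Rightarrow> 'a) \<Rightarrow> 'v \<Rightarrow> 'x \<Rightarrow> 'a"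
  where "hscale c T = (\<lambda>v. fscale c (T v))"

global_interpretation fs: vector_space "fscale :: 'a::field \<Rightarrow> ('x \<Rightarrow> 'a) \<Rightarrow> 'x \<Rightarrow> 'a"
  by unfold_locales (auto simp: fscale_def fun_eq_iff algebra_simps)

global_interpretation hs: vector_space
  "hscale :: 'a::field \<Rightarrow> ('v \<Rightarrow> 'x \<Rightarrow> 'a) \<Rightarrow> 'v \<Rightarrow> 'x \<Rightarrow> 'a"
  by unfold_locales (auto simp: hscale_def fscale_def fun_eq_iff algebra_simps)

definition delta :: "'x \<Rightarrow> 'x \<Rightarrow> 'a::field"
  where "delta x = (\<lambda>y. if y = x then 1 else 0)"

text \<open>The trace of a linear operator on a finite-dimensional space \<open>V\<close> stable under it.\<close>

definition trace_on :: "('x \<Rightarrow> 'a::field) set \<Rightarrow> (('x \<Rightarrow> 'a) \<Rightarrow> 'x \<Rightarrow> 'a) \<Rightarrow> 'a"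
  where "trace_on V T =
    (let B = (SOME B. fs.independent B \<and> fs.span B = V)
     in \<Sum>b\<in>B. fs.representation B (T b) b)"


section \<open>Modules for groups of permutations\<close>

text \<open>
  A module is given by a set \<open>G\<close> of permutations, an action \<open>\<rho>\<close> and a subspace \<open>V\<close> on which
  \<open>G\<close> acts through \<open>\<rho>\<close>.  Restriction to a subgroup changes \<open>G\<close> only.
\<close>

definition Sym :: "nat \<Rightarrow> (nat \<Rightarrow> nat) set"
  where "Sym n = {\<sigma>. \<sigma> permutes {1..n}}"

text \<open>
  Since elements of \<^term>\<open>Sym m\<close> are functions on all of \<open>nat\<close> that are the identity
  outside \<open>{1..m}\<close>, \<^term>\<open>Sym (n - 1)\<close> is literally the subgroup of
  \<^term>\<open>Sym n\<close> fixing \<open>n\<close>, for \<open>n \<ge> 1\<close>.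
\<close>

type_synonym ('x, 'a) action = "(nat \<Rightarrow> nat) \<Rightarrow> ('x \<Rightarrow> 'a) \<Rightarrow> 'x \<Rightarrow> 'a"

text \<open>The linear extension of an action on the basis: \<open>\<sigma>\<close> sends \<open>delta x\<close> to \<open>delta (act \<sigma> x)\<close>.\<close>

definition perm_action :: "((nat \<Rightarrow> nat) \<Rightarrow> 'x \<Rightarrow> 'x) \<Rightarrow> ('x, 'a) action"
  where "perm_action act \<sigma> f = (\<lambda>x. f (act (inv \<sigma>) x))"

text \<open>
  Homomorphisms \<open>V \<rightarrow> W\<close> of \<open>G\<close>-modules.  Maps are taken to be \<open>0\<close> outside \<open>V\<close>, so that each
  homomorphism is represented by exactly one function.
\<close>

definition Hom_mod ::
  "(nat \<Rightarrow> nat) set \<Rightarrow> ('x, 'a::field) action \<Rightarrow> ('x \<Rightarrow> 'a) set \<Rightarrow>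
   ('y, 'a) action \<Rightarrow> ('y \<Rightarrow> 'a) set \<Rightarrow> (('x \<Rightarrow> 'a) \<Rightarrow> 'y \<Rightarrow> 'a) set"
  where "Hom_mod G \<rho> V \<tau> W = {T.
    (\<forall>v\<in>V. T v \<in> W) \<and>
    (\<forall>u\<in>V. \<forall>v\<in>V. T (u + v) = T u + T v) \<and>
    (\<forall>c. \<forall>v\<in>V. T (fscale c v) = fscale c (T v)) \<and>
    (\<forall>\<sigma>\<in>G. \<forall>v\<in>V. T (\<rho> \<sigma> v) = \<tau> \<sigma> (T v)) \<and>
    (\<forall>v. v \<notin> V \<longrightarrow> T v = 0)}"

definition iso_mod ::
  "(nat \<Rightarrow> nat) set \<Rightarrow> ('x, 'a::field) action \<Rightarrow> ('x \<Rightarrow> 'a) set \<Rightarrow>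
   ('y, 'a) action \<Rightarrow> ('y \<Rightarrow> 'a) set \<Rightarrow> bool"
  where "iso_mod G \<rho> V \<tau> W \<longleftrightarrow> (\<exists>T\<in>Hom_mod G \<rho> V \<tau> W. bij_betw T V W)"

definition is_module ::
  "(nat \<Rightarrow> nat) set \<Rightarrow> ('x, 'a::field) action \<Rightarrow> ('x \<Rightarrow> 'a) set \<Rightarrow> bool"
  where "is_module G \<rho> V \<longleftrightarrow> fs.subspace V \<and> (\<forall>\<sigma>\<in>G. \<forall>v\<in>V. \<rho> \<sigma> v \<in> V)"

definition irreducible_mod ::
  "(nat \<Rightarrow> nat) set \<Rightarrow> ('x, 'a::field) action \<Rightarrow> ('x \<Rightarrow> 'a) set \<Rightarrow> bool"
  where "irreducible_mod G \<rho> V \<longleftrightarrow> is_module G \<rho> V \<and> V \<noteq> {0} \<and>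
    (\<forall>U. U \<subseteq> V \<longrightarrow> is_module G \<rho> U \<longrightarrow> U = {0} \<or> U = V)"

text \<open>\<open>V\<close> is the internal direct sum of the members of \<open>D\<close>, all of which are irreducible submodules.\<close>

definition irreducible_decomposition ::
  "(nat \<Rightarrow> nat) set \<Rightarrow> ('x, 'a::field) action \<Rightarrow> ('x \<Rightarrow> 'a) set \<Rightarrow> ('x \<Rightarrow> 'a) set set \<Rightarrow> bool"
  where "irreducible_decomposition G \<rho> V D \<longleftrightarrow> finite D \<and>
    (\<forall>U\<in>D. irreducible_mod G \<rho> U) \<and>
    fs.span (\<Union>D) = V \<and>
    (\<forall>v. (\<forall>U\<in>D. v U \<in> U) \<and> (\<Sum>U\<in>D. v U) = 0 \<longrightarrow> (\<forall>U\<in>D. v U = 0))"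

text \<open>
  The multiplicity of the irreducible module \<open>S\<close> (action \<open>\<rho>\<close>) in the module \<open>V\<close> (action \<open>\<tau>\<close>):
  the number of summands isomorphic to \<open>S\<close> in any decomposition of \<open>V\<close> into irreducibles.
\<close>

definition multiplicity_mod ::
  "(nat \<Rightarrow> nat) set \<Rightarrow> ('x, 'a::field) action \<Rightarrow> ('x \<Rightarrow> 'a) set \<Rightarrow>
   ('y, 'a) action \<Rightarrow> ('y \<Rightarrow> 'a) set \<Rightarrow> nat"
  where "multiplicity_mod G \<rho> S \<tau> V =
    (THE m. \<exists>D. irreducible_decomposition G \<tau> V D \<and> m = card {U \<in> D. iso_mod G \<rho> S \<tau> U})"


section \<open>Partitions and standard tableaux\<close>

text \<open>Partitions are weakly decreasing lists of positive parts; cells \<open>(row, column)\<close> count from \<open>0\<close>.\<close>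

definition is_partition :: "nat list \<Rightarrow> nat \<Rightarrow> bool"
  where "is_partition l n \<longleftrightarrow> sorted_wrt (\<ge>) l \<and> 0 \<notin> set l \<and> sum_list l = n"

definition one_part :: "nat \<Rightarrow> nat list"
  where "one_part m = (if m = 0 then [] else [m])"

definition sharp :: "nat list \<Rightarrow> nat list"
  where "sharp l = tl l"

definition young :: "nat list \<Rightarrow> (nat \<times> nat) set"
  where "young l = {(i, j). i < length l \<and> j < l ! i}"

text \<open>
  Standard tableaux of the skew shape \<open>\<lambda>/\<nu>\<close> (for \<^term>\<open>young nu \<subseteq> young l\<close>).  Fillings are fixed to
  \<open>0\<close> outside the shape so that they can be counted.
\<close>

definition standard_tableaux :: "nat list \<Rightarrow> nat list \<Rightarrow> (nat \<times> nat \<Rightarrow> nat) set"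
  where "standard_tableaux l nu = (let Y = young l - young nu in {T.
    bij_betw T Y {1..card Y} \<and>
    (\<forall>c. c \<notin> Y \<longrightarrow> T c = 0) \<and>
    (\<forall>i j j'. (i, j) \<in> Y \<longrightarrow> (i, j') \<in> Y \<longrightarrow> j < j' \<longrightarrow> T (i, j) < T (i, j')) \<and>
    (\<forall>i i' j. (i, j) \<in> Y \<longrightarrow> (i', j) \<in> Y \<longrightarrow> i < i' \<longrightarrow> T (i, j) < T (i', j))})"

definition num_std :: "nat list \<Rightarrow> nat list \<Rightarrow> nat"
  where "num_std l nu = card (standard_tableaux l nu)"


section \<open>Specht modules\<close>

definition tableau :: "nat list \<Rightarrow> (nat \<times> nat \<Rightarrow> nat) \<Rightarrow> bool"
  where "tableau l t \<longleftrightarrow> bij_betw t (young l) {1..sum_list l}"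

text \<open>A tabloid is recorded as the list of the sets of entries of its rows.\<close>

definition tabloid :: "nat list \<Rightarrow> (nat \<times> nat \<Rightarrow> nat) \<Rightarrow> nat set list"
  where "tabloid l t = map (\<lambda>i. {t (i, j) | j. j < l ! i}) [0..<length l]"

definition tabloid_action :: "(nat set list, 'a) action"
  where "tabloid_action = perm_action (\<lambda>\<sigma>. map ((`) \<sigma>))"

definition column_stabilizer :: "nat list \<Rightarrow> (nat \<times> nat \<Rightarrow> nat) \<Rightarrow> (nat \<Rightarrow> nat) set"
  where "column_stabilizer l t = {\<sigma> \<in> Sym (sum_list l).
    \<forall>j. \<sigma> ` {t (i, j) | i. (i, j) \<in> young l} = {t (i, j) | i. (i, j) \<in> young l}}"

definition polytabloid :: "nat list \<Rightarrow> (nat \<times> nat \<Rightarrow> nat) \<Rightarrow> nat set list \<Rightarrow> 'a::field"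
  where "polytabloid l t =
    (\<Sum>\<sigma>\<in>column_stabilizer l t. fscale (of_int (sign \<sigma>)) (delta (tabloid l (\<sigma> \<circ> t))))"

definition specht :: "nat list \<Rightarrow> (nat set list \<Rightarrow> 'a::field) set"
  where "specht l = fs.span {polytabloid l t | t. tableau l t}"

definition specht_char :: "nat list \<Rightarrow> (nat \<Rightarrow> nat) \<Rightarrow> 'a::field"
  where "specht_char l \<sigma> = trace_on (specht l) (tabloid_action \<sigma>)"


section \<open>Tensor powers of the permutation module\<close>

text \<open>
  The basis vector \<open>v\<^sub>i\<^sub>1 \<otimes> \<dots> \<otimes> v\<^sub>i\<^sub>k\<close> of the \<open>k\<close>-th tensor power of the permutation module
  is \<open>delta [i1, \<dots>, ik]\<close>; the permutation \<open>\<sigma>\<close> sends it to \<open>delta [\<sigma> i1, \<dots>, \<sigma> ik]\<close>.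
\<close>

definition tensor_power :: "nat \<Rightarrow> nat \<Rightarrow> (nat list \<Rightarrow> 'a::field) set"
  where "tensor_power n k = {f. \<forall>w. f w \<noteq> 0 \<longrightarrow> length w = k \<and> set w \<subseteq> {1..n}}"

definition tensor_action :: "(nat list, 'a) action"
  where "tensor_action = perm_action map"

text \<open>\<open>Z\<^sub>k\<^sub>,\<^sub>n\<close> and \<open>Z\<^sub>k\<^sub>+\<^sub>1\<^sub>/\<^sub>2\<^sub>,\<^sub>n\<close>:\<close>

definition Z_end :: "nat \<Rightarrow> nat \<Rightarrow> ((nat list \<Rightarrow> 'a::field) \<Rightarrow> nat list \<Rightarrow> 'a) set"
  where "Z_end k n =
    Hom_mod (Sym n) tensor_action (tensor_power n k) tensor_action (tensor_power n k)"

definition Z_end_half :: "nat \<Rightarrow> nat \<Rightarrow> ((nat list \<Rightarrow> 'a::field) \<Rightarrow> nat list \<Rightarrow> 'a) set"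
  where "Z_end_half k n =
    Hom_mod (Sym (n - 1)) tensor_action (tensor_power n k) tensor_action (tensor_power n k)"

definition Z_irr ::
  "nat \<Rightarrow> nat \<Rightarrow> nat list \<Rightarrow> ((nat set list \<Rightarrow> 'a::field) \<Rightarrow> nat list \<Rightarrow> 'a) set"
  where "Z_irr k n l =
    Hom_mod (Sym n) tabloid_action (specht l) tensor_action (tensor_power n k)"

definition Z_half_irr ::
  "nat \<Rightarrow> nat \<Rightarrow> nat list \<Rightarrow> ((nat set list \<Rightarrow> 'a::field) \<Rightarrow> nat list \<Rightarrow> 'a) set"
  where "Z_half_irr k n mu =
    Hom_mod (Sym (n - 1)) tabloid_action (specht mu) tensor_action (tensor_power n k)"

text \<open>The argument of type \<open>'a itself\<close> names the ground field.\<close>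

definition tensor_mult :: "'a::field itself \<Rightarrow> nat \<Rightarrow> nat \<Rightarrow> nat list \<Rightarrow> nat"
  where "tensor_mult _ k n l = multiplicity_mod (Sym n)
    tabloid_action (specht l :: (nat set list \<Rightarrow> 'a) set) tensor_action (tensor_power n k)"

definition tensor_mult_half :: "'a::field itself \<Rightarrow> nat \<Rightarrow> nat \<Rightarrow> nat list \<Rightarrow> nat"
  where "tensor_mult_half _ k n mu = multiplicity_mod (Sym (n - 1))
    tabloid_action (specht mu :: (nat set list \<Rightarrow> 'a) set) tensor_action (tensor_power n k)"

definition Lam :: "'a::field itself \<Rightarrow> nat \<Rightarrow> nat \<Rightarrow> nat list set"
  where "Lam F k n = {l. is_partition l n \<and> tensor_mult F k n l \<ge> 1}"

definition Lam_half :: "'a::field itself \<Rightarrow> nat \<Rightarrow> nat \<Rightarrow> nat list set"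
  where "Lam_half F k n = {mu. is_partition mu (n - 1) \<and> tensor_mult_half F k n mu \<ge> 1}"


section \<open>Fixed points and Bell numbers\<close>

definition fixpts :: "nat \<Rightarrow> (nat \<Rightarrow> nat) \<Rightarrow> nat"
  where "fixpts n \<sigma> = card {i \<in> {1..n}. \<sigma> i = i}"

definition bell :: "nat \<Rightarrow> nat"
  where "bell l = card {P. partition_on {1..l} P}"

definition bell_le :: "nat \<Rightarrow> nat \<Rightarrow> nat"
  where "bell_le l n = card {P. partition_on {1..l} P \<and> card P \<le> n}"

end

theory Submission
  imports Defs
begin

text \<open>
  Averaging over the group gives the dimension of \<open>Hom(V, W)\<close>, for \<open>W\<close> a permutation module, as the
  mean of the fixed point character of \<open>W\<close> times the character of \<open>V\<close>.  For tensor powers that character is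
  \<open>F ^ k\<close> or \<open>(F + 1) ^ k\<close>, a combination with Stirling coefficients of the falling factorials of \<open>F\<close>,
  which are the fixed point characters on injective words of length \<open>t\<close>.  It remains to show that
  the Specht module of \<open>\<lambda>\<close> occurs \<open>f\<^bsup>\<lambda>/[n-t]\<^esup>\<close> times in the space of injective words.

  James' argument with column antisymmetrizers shows that Specht modules are irreducible, pairwise
  non-isomorphic and have only scalar endomorphisms.  Standard skew tableaux provide independent
  homomorphisms, because the coefficients of polytabloids are unitriangular; standard tableaux
  likewise give independent polytabloids.  Neither a branching rule nor Garnir relations are needed for the converse inequalities:
  the commutation relation of Young's lattice gives \<open>\<Sum>\<^sub>\<lambda> f\<^bsup>\<lambda>/[n-t]\<^esup> f\<^bsup>\<lambda>\<^esup> = n!/(n-t)!\<close>, so that the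
  lower bounds already exhaust the dimension of the space of injective words.
\<close>

section \<open>Traces and averaging\<close>

text \<open>Dimensions of Hom spaces and characters of Specht modules both hide a choice of basis.
  Traces are therefore computed from redundant spanning systems with dual functionals, for instance
  from the projected basis functions \<open>p (delta y)\<close> of a submodule. The resulting
  identities live in the field; characteristic zero makes them identities of natural numbers.

  The delicate half of the count is the upper bound. There are two unknowns for each shape, the
  multiplicity \<open>d\<close> in the space of injective words and the dimension \<open>s\<close>
  of the Specht module, with tableau counts \<open>b\<close> and \<open>f\<close> as lower bounds.
  Different shapes claim different summands, so the sum of the products \<open>d * s\<close> is at
  most the number of injective words, while the sum of the products \<open>b * f\<close> is at least
  that number. Hence all products agree, and positivity of \<open>s\<close> separates the two
  factors.

  Two orders of the classical theory become comparisons of numbers: \<open>row_sum\<close> stands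
  for dominance of shapes, \<open>tableau_key\<close> for the order on tabloids.\<close>

definition lin_on :: "('k \<Rightarrow> 'v::plus \<Rightarrow> 'v) \<Rightarrow> ('k \<Rightarrow> 'w::plus \<Rightarrow> 'w) \<Rightarrow> 'v set \<Rightarrow> ('v \<Rightarrow> 'w) \<Rightarrow> bool"
  where "lin_on s1 s2 V f \<longleftrightarrow>
    (\<forall>u\<in>V. \<forall>v\<in>V. f (u + v) = f u + f v) \<and> (\<forall>c. \<forall>v\<in>V. f (s1 c v) = s2 c (f v))"

lemma lin_onD:
  assumes "lin_on s1 s2 V f"
  shows "u \<in> V \<Longrightarrow> v \<in> V \<Longrightarrow> f (u + v) = f u + f v" "v \<in> V \<Longrightarrow> f (s1 c v) = s2 c (f v)"
  using assms by (auto simp: lin_on_def)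

lemma lin_on_subset: "lin_on s1 s2 V f \<Longrightarrow> U \<subseteq> V \<Longrightarrow> lin_on s1 s2 U f"
  by (simp add: lin_on_def subset_iff)

context vector_space_pair
begin

lemma lin_on_zero:
  assumes "vs1.subspace V" "lin_on s1 s2 V f"
  shows "f 0 = 0"
  using lin_onD(2)[OF assms(2) vs1.subspace_0[OF assms(1)], of 0] by simp

text \<open>Linearity is confined to \<open>V\<close> because homomorphisms are set to 0 outside
  their domain and so are not linear on the whole type; partial sums have to stay inside
  \<open>V\<close> during the induction.\<close>

lemma lin_on_sum:
  assumes V: "vs1.subspace V" and f: "lin_on s1 s2 V f" and v: "\<And>i. i \<in> I \<Longrightarrow> v i \<in> V"
  shows "f (\<Sum>i\<in>I. c i *a v i) = (\<Sum>i\<in>I. c i *b f (v i))"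
  using v
proof (induction I rule: infinite_finite_induct)
  case (insert i I)
  then have "(\<Sum>i\<in>I. c i *a v i) \<in> V" "c i *a v i \<in> V"
    by (auto intro!: vs1.subspace_sum[OF V] vs1.subspace_scale[OF V])
  then show ?case
    using insert by (simp add: lin_onD[OF f])
qed (auto simp: lin_on_zero[OF V f])

end

text \<open>The field as a space over itself: coordinate functionals then fall under the same notion
  of linearity.\<close>

lemma vector_space_mult: "vector_space ((*) :: 'a::field \<Rightarrow> 'a \<Rightarrow> 'a)"
  by unfold_locales (auto simp: algebra_simps)

context vector_space
begin

text \<open>A finite frame computes traces: expand each \<open>d i\<close> in \<open>B\<close> and interchange the two sums.\<close>

lemma frame_trace:
  assumes V: "subspace V" and I: "finite I" and d: "\<And>i. i \<in> I \<Longrightarrow> d i \<in> V"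
    and al: "\<And>i. i \<in> I \<Longrightarrow> lin_on scale (*) V (al i)"
    and frame: "\<And>v. v \<in> V \<Longrightarrow> (\<Sum>i\<in>I. scale (al i v) (d i)) = v"
    and A: "lin_on scale scale V A" "\<And>v. v \<in> V \<Longrightarrow> A v \<in> V"
    and B: "independent B" "span B = V"
  shows "finite B" "(\<Sum>i\<in>I. al i (A (d i))) = (\<Sum>b\<in>B. representation B (A b) b)"
proof -
  have "V \<subseteq> span (d ` I)"
  proof
    fix v assume "v \<in> V"
    have "(\<Sum>i\<in>I. scale (al i v) (d i)) \<in> span (d ` I)"
      by (intro span_sum span_scale span_base) auto
    then show "v \<in> span (d ` I)"
      using frame[OF \<open>v \<in> V\<close>] by simp
  qed
  then show fB: "finite B"
    using independent_span_bound[of "d ` I" B] I B span_superset[of B] by auto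
  have BV: "b \<in> V" if "b \<in> B" for b
    using B(2) span_base that by blast
  interpret p1: vector_space_pair scale "(*)"
    by (intro vector_space_pair.intro vector_space_mult vector_space_axioms)
  interpret p2: vector_space_pair scale scale
    by (intro vector_space_pair.intro vector_space_axioms)
  have "al i (A (d i)) = (\<Sum>b\<in>B. representation B (d i) b * al i (A b))" if i: "i \<in> I" for i
  proof -
    have "d i = (\<Sum>b\<in>B. scale (representation B (d i) b) b)"
      using sum_representation_eq[OF B(1) _ fB order_refl] B(2) d[OF i] by metis
    moreover have "A (\<Sum>b\<in>B. scale (representation B (d i) b) b) = (\<Sum>b\<in>B. scale (representation B (d i) b) (A b))"
      by (rule p2.lin_on_sum[OF V A(1) BV])
    ultimately have "A (d i) = (\<Sum>b\<in>B. scale (representation B (d i) b) (A b))"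
      by argo
    then show ?thesis
      by (simp add: p1.lin_on_sum[OF V al[OF i]] A(2) BV)
  qed
  then have "(\<Sum>i\<in>I. al i (A (d i))) = (\<Sum>i\<in>I. \<Sum>b\<in>B. representation B (d i) b * al i (A b))"
    by simp
  also have "\<dots> = (\<Sum>b\<in>B. \<Sum>i\<in>I. al i (A b) * representation B (d i) b)"
    by (subst sum.swap) (simp add: mult.commute)
  also have "\<dots> = (\<Sum>b\<in>B. representation B (A b) b)"
  proof (rule sum.cong[OF refl])
    fix b assume b: "b \<in> B"
    have "representation B (A b) = representation B (\<Sum>i\<in>I. scale (al i (A b)) (d i))"
      using frame[OF A(2)[OF BV[OF b]]] by simp
    also have "\<dots> = (\<lambda>b'. \<Sum>i\<in>I. al i (A b) * representation B (d i) b')"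
      by (subst representation_sum)
         (use B d in \<open>auto simp: representation_scale span_scale intro!: sum.cong\<close>)
    finally show "(\<Sum>i\<in>I. al i (A b) * representation B (d i) b) = representation B (A b) b"
      by simp
  qed
  finally show "(\<Sum>i\<in>I. al i (A (d i))) = (\<Sum>b\<in>B. representation B (A b) b)" .
qed

text \<open>The trace of the identity. Its value is the image of the dimension in the field, which
  determines the dimension in characteristic zero.\<close>

corollary frame_dim:
  assumes "subspace V" "finite I" "\<And>i. i \<in> I \<Longrightarrow> d i \<in> V"
    and "\<And>i. i \<in> I \<Longrightarrow> lin_on scale (*) V (al i)"
    and "\<And>v. v \<in> V \<Longrightarrow> (\<Sum>i\<in>I. scale (al i v) (d i)) = v"
  shows "(\<Sum>i\<in>I. al i (d i)) = of_nat (dim V)"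
proof -
  obtain B where B: "B \<subseteq> V" "independent B" "V \<subseteq> span B" "card B = dim V"
    using basis_exists .
  then have sB: "span B = V"
    by (simp add: assms(1) span_subspace)
  have "(\<Sum>i\<in>I. al i (d i)) = (\<Sum>b\<in>B. representation B b b)"
    using frame_trace(2)[OF assms(1-5) _ _ B(2) sB, of "\<lambda>v. v"] by (simp add: lin_on_def)
  also have "\<dots> = of_nat (card B)"
    using B(2) by (simp add: representation_basis)
  finally show ?thesis using B(4) by simp
qed

text \<open>Injectivity is part of the claim so that the cardinality of the index set becomes a
  lower bound for a dimension.\<close>

lemma independent_family:
  assumes I: "finite I"
    and zero: "\<And>g i. (\<Sum>i\<in>I. scale (g i) (f i)) = 0 \<Longrightarrow> i \<in> I \<Longrightarrow> g i = 0"
  shows "inj_on f I" "independent (f ` I)"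
proof -
  show inj: "inj_on f I"
  proof (rule inj_onI, rule ccontr)
    fix i j assume ij: "i \<in> I" "j \<in> I" "f i = f j" "i \<noteq> j"
    \<comment> \<open>The coefficients of the relation \<open>f i - f j = 0\<close>.\<close>
    let ?g = "\<lambda>k. (if k = i then 1 else 0) - (if k = j then 1 else 0) :: 'a"
    have "(\<Sum>k\<in>I. scale (?g k) (f k)) = (\<Sum>k\<in>I. (if k = i then f i else 0) - (if k = j then f j else 0))"
      by (rule sum.cong) auto
    also have "\<dots> = 0"
      using I ij by (simp add: sum_subtractf)
    finally have "?g i = 0" by (rule zero[of ?g i, OF _ ij(1)])
    then show False using ij(4) by simp
  qed
  have "g v = 0" if g: "(\<Sum>v\<in>f ` I. scale (g v) v) = 0" and v: "v \<in> f ` I" for g v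
  proof -
    have "(\<Sum>i\<in>I. scale (g (f i)) (f i)) = 0" using g by (simp add: sum.reindex[OF inj])
    then show ?thesis using zero[of "\<lambda>i. g (f i)"] v by auto
  qed
  then show "independent (f ` I)"
    using independent_if_scalars_zero[OF finite_imageI[OF I]] by blast
qed

text \<open>The finite set \<open>F\<close> keeps bases finite; an infinite basis would have
  \<open>card\<close> 0 and so make \<open>dim\<close> too small.\<close>

lemma card_le_dim:
  assumes "independent B" "B \<subseteq> V" "V \<subseteq> span F" "finite F"
  shows "card B \<le> dim V"
proof -
  obtain C where C: "B \<subseteq> C" "C \<subseteq> V" "independent C" "V \<subseteq> span C"
    using maximal_independent_subset_extend[OF assms(2,1)] .
  have "finite C"
    using independent_span_bound[OF assms(4) C(3)] C(2) assms(3) by auto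
  then show ?thesis
    using card_mono[OF _ C(1)] basis_card_eq_dim[OF C(2,4,3)] by simp
qed

lemma subspace_eq_if_dim_le:
  assumes "subspace U" "subspace V" "U \<subseteq> V" "dim V \<le> dim U" "V \<subseteq> span F" "finite F"
  shows "U = V"
proof (rule ccontr)
  assume "U \<noteq> V"
  then obtain v where v: "v \<in> V" "v \<notin> U" using assms(3) by auto
  obtain B where B: "B \<subseteq> U" "independent B" "U \<subseteq> span B" "card B = dim U"
    using basis_exists .
  obtain C where C: "C \<subseteq> V" "independent C" "V \<subseteq> span C" "card C = dim V"
    using basis_exists .
  have fC: "finite C"
    using independent_span_bound[OF assms(6) C(2)] C(1) assms(5) by auto
  have "v \<notin> span B"
    using v(2) span_minimal[OF B(1) assms(1)] by auto
  then have i: "independent (insert v B)" "v \<notin> B"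
    using independent_insertI B(2) span_base by auto
  moreover have "insert v B \<subseteq> span C"
    using v(1) B(1) assms(3) C(3) by blast
  ultimately have "finite (insert v B) \<and> card (insert v B) \<le> card C"
    by (intro independent_span_bound[OF fC i(1)])
  then show False
    using i(2) B(4) C(4) assms(4) by auto
qed

end

section \<open>Functions supported on a set of labels\<close>

lemma sum_fun_apply: "(\<Sum>i\<in>I. f i) x = (\<Sum>i\<in>I. f i x)"
  by (induction I rule: infinite_finite_induct) auto

lemma fscale_apply [simp]: "fscale c f x = c * f x"
  by (simp add: fscale_def)

lemma hscale_apply [simp]: "hscale c T v = fscale c (T v)"
  by (simp add: hscale_def)

interpretation ff: vector_space_pair
  "fscale :: 'a::field \<Rightarrow> ('x \<Rightarrow> 'a) \<Rightarrow> 'x \<Rightarrow> 'a" "fscale :: 'a::field \<Rightarrow> ('y \<Rightarrow> 'a) \<Rightarrow> 'y \<Rightarrow> 'a" ..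

text \<open>The free module with basis \<open>X\<close>, cut out of a function type by a support
  condition; words of all lengths, injective or not, thus live in one type.\<close>

definition supported :: "'x set \<Rightarrow> ('x \<Rightarrow> 'a::field) set"
  where "supported X = {f. \<forall>x. f x \<noteq> 0 \<longrightarrow> x \<in> X}"

lemma subspace_supported [simp]: "fs.subspace (supported X)"
  unfolding fs.subspace_def by (auto simp: supported_def) (metis add_0)

lemma delta_supported [simp]: "delta x \<in> supported X \<longleftrightarrow> x \<in> X"
  by (auto simp: supported_def delta_def)

lemma supported_sum:
  assumes "finite X" "f \<in> supported X"
  shows "(\<Sum>x\<in>X. fscale (f x) (delta x)) = f"
proof
  fix y
  have "(\<Sum>x\<in>X. f x * delta x y) = (\<Sum>x\<in>X. if x = y then f y else 0)"
    by (rule sum.cong) (auto simp: delta_def)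
  then show "(\<Sum>x\<in>X. fscale (f x) (delta x)) y = f y"
    using assms by (auto simp: sum_fun_apply supported_def)
qed

lemma supported_subset_span:
  assumes "finite X"
  shows "supported X \<subseteq> fs.span (delta ` X :: ('x \<Rightarrow> 'a::field) set)"
proof
  fix f :: "'x \<Rightarrow> 'a" assume "f \<in> supported X"
  moreover have "(\<Sum>x\<in>X. fscale (f x) (delta x)) \<in> fs.span (delta ` X)"
    by (intro fs.span_sum fs.span_scale fs.span_base) auto
  ultimately show "f \<in> fs.span (delta ` X)"
    using supported_sum[OF assms] by metis
qed

lemma finite_basis_supported:
  assumes "finite X" "fs.subspace V" "V \<subseteq> supported X"
  obtains B where "finite B" "fs.independent B" "fs.span B = V" "card B = fs.dim V"
proof -
  obtain B where B: "B \<subseteq> V" "fs.independent B" "V \<subseteq> fs.span B" "card B = fs.dim V"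
    using fs.basis_exists .
  have "finite B"
    using fs.independent_span_bound[OF finite_imageI[OF assms(1)] B(2)]
      supported_subset_span[OF assms(1)] B(1) assms(3) by blast
  then show ?thesis
    using that B assms(2) fs.span_subspace by metis
qed

text \<open>The vectors \<open>p (delta y)\<close> with the functionals \<open>v y\<close> form a
  frame of \<open>V\<close>, in general a redundant one: apply \<open>p\<close> to the expansion of
  \<open>v\<close> in the \<open>delta y\<close>.\<close>

lemma projection_frame:
  assumes Y: "finite Y" and V: "fs.subspace V" "V \<subseteq> supported Y"
    and p: "lin_on fscale fscale (supported Y) p" "\<And>v. v \<in> V \<Longrightarrow> p v = v"
    and v: "v \<in> V"
  shows "(\<Sum>y\<in>Y. fscale (v y) (p (delta y))) = v"
proof -
  have "(\<Sum>y\<in>Y. fscale (v y) (p (delta y))) = p (\<Sum>y\<in>Y. fscale (v y) (delta y))"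
    by (rule ff.lin_on_sum[OF subspace_supported p(1), symmetric]) auto
  then show ?thesis
    using supported_sum[OF Y] V(2) v p(2) by (metis subsetD)
qed

text \<open>\<open>trace_on\<close> refers to a basis picked by \<open>SOME\<close>; the frame gives
  a formula free of that choice.\<close>

lemma projection_trace:
  assumes Y: "finite Y" and V: "fs.subspace V" "V \<subseteq> supported Y"
    and p: "lin_on fscale fscale (supported Y) p" "\<And>v. v \<in> V \<Longrightarrow> p v = v"
      "\<And>v. v \<in> supported Y \<Longrightarrow> p v \<in> V"
    and A: "lin_on fscale fscale V A" "\<And>v. v \<in> V \<Longrightarrow> A v \<in> V"
  shows "trace_on V A = (\<Sum>y\<in>Y. A (p (delta y)) y)"
proof -
  define B where "B = (SOME B. fs.independent B \<and> fs.span B = V)"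
  have "\<exists>B. fs.independent B \<and> fs.span B = V"
    using finite_basis_supported[OF Y V] by metis
  then have B: "fs.independent B" "fs.span B = V"
    unfolding B_def by (metis (mono_tags, lifting) someI_ex)+
  have "(\<Sum>y\<in>Y. A (p (delta y)) y) = (\<Sum>b\<in>B. fs.representation B (A b) b)"
    by (rule fs.frame_trace(2)[where al = "\<lambda>y v. v y", OF V(1) Y _ _ projection_frame[OF Y V p(1,2)] A B])
       (auto simp: p(3) lin_on_def)
  then show ?thesis
    by (simp add: trace_on_def B_def Let_def)
qed

lemma projection_dim:
  assumes Y: "finite Y" and V: "fs.subspace V" "V \<subseteq> supported Y"
    and p: "lin_on fscale fscale (supported Y) p" "\<And>v. v \<in> V \<Longrightarrow> p v = v"
      "\<And>v. v \<in> supported Y \<Longrightarrow> p v \<in> V"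
  shows "of_nat (fs.dim V) = (\<Sum>y\<in>Y. p (delta y) y)"
  by (rule fs.frame_dim[where al = "\<lambda>y v. v y", OF V(1) Y _ _ projection_frame[OF Y V p(1,2)], symmetric])
     (auto simp: p(3) lin_on_def)

section \<open>Modules spanned by permuted basis elements\<close>

lemma Sym_facts [simp]:
  "finite (Sym N)" "id \<in> Sym N" "card (Sym N) = fact N"
  "\<sigma> \<in> Sym N \<Longrightarrow> inv \<sigma> \<in> Sym N" "\<sigma> \<in> Sym N \<Longrightarrow> \<tau> \<in> Sym N \<Longrightarrow> \<sigma> \<circ> \<tau> \<in> Sym N"
  "\<sigma> \<in> Sym N \<Longrightarrow> bij \<sigma>"
  by (auto simp: Sym_def permutes_id permutes_inv permutes_compose card_permutations
      finite_permutations permutes_bij)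

lemma Sym_inv_simps:
  assumes "\<sigma> \<in> Sym N"
  shows "inv \<sigma> \<circ> \<sigma> = id" "\<sigma> \<circ> inv \<sigma> = id" "inv (inv \<sigma>) = \<sigma>" "inv \<sigma> (\<sigma> i) = i" "\<sigma> (inv \<sigma> i) = i"
  using assms permutes_inv_o[of \<sigma> "{1..N}"] permutes_inverses[of \<sigma> "{1..N}"]
  by (auto simp: Sym_def inv_inv_eq permutes_bij)

lemma Sym_inv_comp: "\<sigma> \<in> Sym N \<Longrightarrow> \<tau> \<in> Sym N \<Longrightarrow> inv (\<sigma> \<circ> \<tau>) = inv \<tau> \<circ> inv \<sigma>"
  by (simp add: o_inv_distrib)

lemma sum_Sym_inv: "(\<Sum>\<sigma>\<in>Sym N. f (inv \<sigma>)) = (\<Sum>\<sigma>\<in>Sym N. f \<sigma>)"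
  by (rule sum.reindex_bij_witness[of _ inv inv]) (auto simp: Sym_inv_simps)

lemma sum_Sym_comp:
  assumes "\<tau> \<in> Sym N"
  shows "(\<Sum>\<sigma>\<in>Sym N. f (\<tau> \<circ> \<sigma>)) = (\<Sum>\<sigma>\<in>Sym N. f \<sigma>)"
  by (rule sum.reindex_bij_witness[of _ "\<lambda>\<sigma>. inv \<tau> \<circ> \<sigma>" "\<lambda>\<sigma>. \<tau> \<circ> \<sigma>"])
     (use assms in \<open>auto simp: Sym_inv_simps fun_eq_iff\<close>)

lemma average_const: "fscale (1 / fact N) (\<Sum>\<sigma>\<in>Sym N. w) = (w :: 'x \<Rightarrow> 'a::field_char_0)"
  by (rule ext) (simp only: sum_fun_apply fscale_apply, simp)

lemma perm_action_linear [simp]: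
  "perm_action act \<sigma> (f + g) = perm_action act \<sigma> f + perm_action act \<sigma> g"
  "perm_action act \<sigma> (fscale c f) = fscale c (perm_action act \<sigma> f)"
  "perm_action act \<sigma> (\<Sum>i\<in>I. h i) = (\<Sum>i\<in>I. perm_action act \<sigma> (h i))"
  "perm_action act \<sigma> 0 = (0 :: 'x \<Rightarrow> 'a::field)"
  by (auto simp: perm_action_def fun_eq_iff sum_fun_apply)

lemma lin_on_perm_action [simp]: "lin_on fscale fscale V (perm_action act \<sigma>)"
  by (simp add: lin_on_def)

text \<open>A common setting for tabloids, where permutations act by \<open>image\<close> on the
  rows, and for words, where they act by \<open>map\<close>. The two action laws are asked for all
  functions and labels, which is immediate in both cases.\<close>

locale perm_set =
  fixes N :: nat and act :: "(nat \<Rightarrow> nat) \<Rightarrow> 'x \<Rightarrow> 'x" and X :: "'x set"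
  assumes finite_X [simp]: "finite X"
    and act_id [simp]: "act id x = x"
    and act_comp: "act (\<sigma> \<circ> \<tau>) x = act \<sigma> (act \<tau> x)"
    and act_closed: "\<sigma> \<in> Sym N \<Longrightarrow> x \<in> X \<Longrightarrow> act \<sigma> x \<in> X"
begin

lemma act_inv [simp]:
  assumes "\<sigma> \<in> Sym N"
  shows "act (inv \<sigma>) (act \<sigma> x) = x" "act \<sigma> (act (inv \<sigma>) x) = x"
  using assms by (simp_all add: act_comp[symmetric] Sym_inv_simps)

lemma act_eq_iff:
  assumes "\<sigma> \<in> Sym N"
  shows "act (inv \<sigma>) x = y \<longleftrightarrow> x = act \<sigma> y"
  using act_inv[OF assms] by metis

lemma act_closed_iff: "\<sigma> \<in> Sym N \<Longrightarrow> act \<sigma> x \<in> X \<longleftrightarrow> x \<in> X"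
  by (metis act_closed act_inv(1) Sym_facts(4))

lemma perm_action_delta: "\<sigma> \<in> Sym N \<Longrightarrow> perm_action act \<sigma> (delta x) = delta (act \<sigma> x)"
  by (auto simp: perm_action_def delta_def fun_eq_iff act_eq_iff)

lemma perm_action_comp:
  "\<sigma> \<in> Sym N \<Longrightarrow> \<tau> \<in> Sym N \<Longrightarrow>
    perm_action act (\<sigma> \<circ> \<tau>) f = perm_action act \<sigma> (perm_action act \<tau> f)"
  by (simp add: perm_action_def Sym_inv_comp act_comp)

lemma perm_action_id [simp]: "perm_action act id f = f"
  by (simp add: perm_action_def inv_id)

lemma perm_action_inv:
  "\<sigma> \<in> Sym N \<Longrightarrow> perm_action act (inv \<sigma>) (perm_action act \<sigma> f) = f"
  "\<sigma> \<in> Sym N \<Longrightarrow> perm_action act \<sigma> (perm_action act (inv \<sigma>) f) = f"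
  by (simp_all add: perm_action_comp[symmetric] Sym_inv_simps)

lemma perm_action_supported: "\<sigma> \<in> Sym N \<Longrightarrow> f \<in> supported X \<Longrightarrow> perm_action act \<sigma> f \<in> supported X"
  by (auto simp: perm_action_def supported_def act_closed_iff)

lemma sum_act: "\<sigma> \<in> Sym N \<Longrightarrow> (\<Sum>x\<in>X. g (act \<sigma> x)) = (\<Sum>x\<in>X. g x)"
  by (rule sum.reindex_bij_witness[of _ "act (inv \<sigma>)" "act \<sigma>"]) (auto simp: act_closed)

lemma module_supported: "is_module (Sym N) (perm_action act) (supported X)"
  by (simp add: is_module_def perm_action_supported)

text \<open>Average the conjugates of an arbitrary linear projection \<open>q\<close> onto
  \<open>V\<close>. The result is linear and equivariant on the whole function type, so it restricts
  to every module containing \<open>V\<close>.\<close>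

lemma maschke:
  fixes V :: "('x \<Rightarrow> 'a::field_char_0) set"
  assumes V: "is_module (Sym N) (perm_action act) V"
  obtains p where "lin_on fscale fscale UNIV p" "\<And>v. p v \<in> V" "\<And>v. v \<in> V \<Longrightarrow> p v = v"
    "\<And>\<sigma> v. \<sigma> \<in> Sym N \<Longrightarrow> p (perm_action act \<sigma> v) = perm_action act \<sigma> (p v)"
proof -
  let ?a = "perm_action act :: ('x, 'a) action"
  have sV: "fs.subspace V" and inV: "\<And>\<sigma> v. \<sigma> \<in> Sym N \<Longrightarrow> v \<in> V \<Longrightarrow> ?a \<sigma> v \<in> V"
    using V by (auto simp: is_module_def)
  obtain q where q: "range q \<subseteq> V" "Vector_Spaces.linear fscale fscale q" "\<And>v. v \<in> V \<Longrightarrow> q v = v"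
    using ff.linear_exists_left_inverse_on[OF fs.linear_ident sV] by (auto simp: inj_on_def)
  have q_add: "q (u + v) = q u + q v" and q_scale: "q (fscale c v) = fscale c (q v)" for u v c
    using q(2) by (simp_all add: Vector_Spaces.linear_iff)
  have qV: "q v \<in> V" for v using q(1) by auto
  define p where "p v = fscale (1 / fact N) (\<Sum>\<sigma>\<in>Sym N. ?a \<sigma> (q (?a (inv \<sigma>) v)))" for v
  show ?thesis
  proof
    show "lin_on fscale fscale UNIV p"
      by (auto simp: lin_on_def p_def q_add q_scale sum.distrib fs.scale_right_distrib
          fs.scale_sum_right fs.scale_left_commute)
    show "p v \<in> V" for v
      unfolding p_def by (intro fs.subspace_scale[OF sV] fs.subspace_sum[OF sV] inV qV)
    show "p v = v" if "v \<in> V" for v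
    proof -
      \<comment> \<open>For \<open>v\<close> in \<open>V\<close> the inner translate stays in
        \<open>V\<close>, where \<open>q\<close> is the identity, so every summand is
        \<open>v\<close> itself.\<close>
      have "(\<Sum>\<sigma>\<in>Sym N. ?a \<sigma> (q (?a (inv \<sigma>) v))) = (\<Sum>\<sigma>\<in>Sym N. v)"
        by (rule sum.cong) (simp_all add: q(3) inV that perm_action_inv)
      then show ?thesis
        by (simp only: p_def average_const)
    qed
    show "p (?a \<tau> v) = ?a \<tau> (p v)" if t: "\<tau> \<in> Sym N" for \<tau> v
    proof -
      have "(\<Sum>\<sigma>\<in>Sym N. ?a \<sigma> (q (?a (inv \<sigma>) (?a \<tau> v)))) =
          (\<Sum>\<sigma>\<in>Sym N. ?a (\<tau> \<circ> \<sigma>) (q (?a (inv (\<tau> \<circ> \<sigma>)) (?a \<tau> v))))"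
        by (rule sum_Sym_comp[OF t, symmetric])
      also have "\<dots> = (\<Sum>\<sigma>\<in>Sym N. ?a \<tau> (?a \<sigma> (q (?a (inv \<sigma>) v))))"
        by (rule sum.cong) (simp_all add: t Sym_inv_comp[OF t] perm_action_comp perm_action_inv)
      finally show ?thesis
        by (simp add: p_def)
    qed
  qed
qed

end

section \<open>Spaces of homomorphisms\<close>

lemma subspace_Hom_mod:
  assumes V: "is_module G (perm_action actY) V" and W: "is_module G (perm_action actX) W"
  shows "hs.subspace (Hom_mod G (perm_action actY) V (perm_action actX) W)"
proof -
  have sV: "fs.subspace V" "fs.subspace W"
    using V W by (auto simp: is_module_def)
  then show ?thesis
    using V W unfolding hs.subspace_def Hom_mod_def is_module_def
    by (auto simp: fs.subspace_0 fs.subspace_add fs.subspace_scale algebra_simps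
        fs.scale_right_distrib fs.scale_left_commute)
qed

lemma Hom_modD:
  assumes "T \<in> Hom_mod G \<rho> V \<tau> W"
  shows "v \<in> V \<Longrightarrow> T v \<in> W" "lin_on fscale fscale V T"
    "\<sigma> \<in> G \<Longrightarrow> v \<in> V \<Longrightarrow> T (\<rho> \<sigma> v) = \<tau> \<sigma> (T v)" "v \<notin> V \<Longrightarrow> T v = 0"
  using assms by (auto simp: Hom_mod_def lin_on_def)

text \<open>The elementary homomorphisms \<open>d (y, x)\<close>, averages of \<open>v \<mapsto> v y * delta x\<close> over the group,
  form a frame of the space of homomorphisms.\<close>

theorem dim_Hom_mod:
  fixes V :: "('y \<Rightarrow> 'a::field_char_0) set"
  assumes "perm_set N actY Y" "perm_set N actX (X :: 'x set)"
    and V: "is_module (Sym N) (perm_action actY) V" "V \<subseteq> supported Y"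
  shows "(of_nat (hs.dim (Hom_mod (Sym N) (perm_action actY) V (perm_action actX) (supported X))) :: 'a)
    = (1 / fact N) * (\<Sum>\<sigma>\<in>Sym N. of_nat (card {x \<in> X. actX \<sigma> x = x}) * trace_on V (perm_action actY \<sigma>))"
    and "\<exists>F. finite F \<and> Hom_mod (Sym N) (perm_action actY) V (perm_action actX) (supported X) \<subseteq> hs.span F"
proof -
  interpret Y: perm_set N actY Y by fact
  interpret X: perm_set N actX X by fact
  let ?b = "perm_action actY :: ('y, 'a) action" and ?a = "perm_action actX :: ('x, 'a) action"
  let ?H = "Hom_mod (Sym N) ?b V ?a (supported X)"
  have sV: "fs.subspace V" and inV: "\<And>\<sigma> v. \<sigma> \<in> Sym N \<Longrightarrow> v \<in> V \<Longrightarrow> ?b \<sigma> v \<in> V"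
    using V(1) by (auto simp: is_module_def)
  obtain p where p: "lin_on fscale fscale UNIV p" "\<And>v. p v \<in> V" "\<And>v. v \<in> V \<Longrightarrow> p v = v"
    "\<And>\<sigma> v. \<sigma> \<in> Sym N \<Longrightarrow> p (?b \<sigma> v) = ?b \<sigma> (p v)"
    using Y.maschke[OF V(1)] by metis
  have p': "lin_on fscale fscale (supported Y) p"
    using p(1) lin_on_subset by blast
  \<comment> \<open>The factor \<open>1 / fact N\<close> makes the frame resolve the identity; the
    case distinction keeps the maps 0 off \<open>V\<close>, as \<open>Hom_mod\<close>
    demands.\<close>
  define d where "d = (\<lambda>(y, x) v. if v \<in> V then fscale (1 / fact N)
      (\<Sum>\<sigma>\<in>Sym N. fscale (v (actY \<sigma> y)) (delta (actX \<sigma> x))) else (0 :: 'x \<Rightarrow> 'a))"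
  \<comment> \<open>The dual functional reads the matrix entry of \<open>T\<close> at
    \<open>(y, x)\<close>; as \<open>delta y\<close> need not lie in \<open>V\<close>, it is
    projected by \<open>p\<close> beforehand.\<close>
  define al where "al = (\<lambda>(y, x) T. (T :: ('y \<Rightarrow> 'a) \<Rightarrow> 'x \<Rightarrow> 'a) (p (delta y)) x)"
  have d_in: "d i \<in> ?H" if "i \<in> Y \<times> X" for i
  proof -
    obtain y x where i: "i = (y, x)" "y \<in> Y" "x \<in> X" using \<open>i \<in> Y \<times> X\<close> by (metis SigmaE)
    have 1: "d i v \<in> supported X" if "v \<in> V" for v
      unfolding i d_def using that i
      by (auto intro!: fs.subspace_scale fs.subspace_sum simp: X.act_closed)
    have 2: "d i (?b \<tau> v) = ?a \<tau> (d i v)" if v: "v \<in> V" and t: "\<tau> \<in> Sym N" for \<tau> v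
    proof -
      have "(\<Sum>\<sigma>\<in>Sym N. fscale ((?b \<tau> v) (actY \<sigma> y)) (delta (actX \<sigma> x))) =
          (\<Sum>\<sigma>\<in>Sym N. fscale ((?b \<tau> v) (actY (\<tau> \<circ> \<sigma>) y)) (delta (actX (\<tau> \<circ> \<sigma>) x)))"
        by (rule sum_Sym_comp[OF t, symmetric])
      also have "\<dots> = (\<Sum>\<sigma>\<in>Sym N. ?a \<tau> (fscale (v (actY \<sigma> y)) (delta (actX \<sigma> x))))"
        by (rule sum.cong[OF refl])
           (use t in \<open>simp add: perm_action_def[of actY] Y.act_comp X.act_comp X.perm_action_delta\<close>)
      finally show ?thesis
        using v t by (simp add: i d_def inV)
    qed
    show ?thesis
      unfolding Hom_mod_def
      by (auto simp: 1 2) (auto simp: i d_def fs.subspace_add[OF sV] fs.subspace_scale[OF sV]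
          fun_eq_iff sum_fun_apply algebra_simps sum.distrib sum_distrib_left)
  qed
  have frame: "(\<Sum>i\<in>Y \<times> X. hscale (al i T) (d i)) = T" if T: "T \<in> ?H" for T
  proof
    note TD = Hom_modD[OF T]
    fix v
    show "(\<Sum>i\<in>Y \<times> X. hscale (al i T) (d i)) v = T v"
    proof (cases "v \<in> V")
      case True
      \<comment> \<open>The translates by one fixed \<open>\<sigma>\<close> already reproduce
        \<open>T\<close>: expand \<open>T (p (delta y))\<close> in the basis, move
        \<open>\<sigma>\<close> through \<open>T\<close> and \<open>p\<close>, and reindex over
        \<open>y\<close>.\<close>
      have step: "(\<Sum>i\<in>Y \<times> X. fscale (al i T * v (actY \<sigma> (fst i))) (delta (actX \<sigma> (snd i)))) = T v"
        if s: "\<sigma> \<in> Sym N" for \<sigma>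
      proof -
        have "(\<Sum>i\<in>Y \<times> X. fscale (al i T * v (actY \<sigma> (fst i))) (delta (actX \<sigma> (snd i))))
          = (\<Sum>y\<in>Y. \<Sum>x\<in>X. fscale (v (actY \<sigma> y)) (?a \<sigma> (fscale (T (p (delta y)) x) (delta x))))"
          unfolding sum.cartesian_product
          by (rule sum.cong) (auto simp: al_def X.perm_action_delta s mult.commute)
        also have "\<dots> = (\<Sum>y\<in>Y. fscale (v (actY \<sigma> y)) (?a \<sigma> (T (p (delta y)))))"
        proof (rule sum.cong[OF refl])
          fix y assume "y \<in> Y"
          have "T (p (delta y)) \<in> supported X" using TD(1) p(2) by blast
          then show "(\<Sum>x\<in>X. fscale (v (actY \<sigma> y)) (?a \<sigma> (fscale (T (p (delta y)) x) (delta x))))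
            = fscale (v (actY \<sigma> y)) (?a \<sigma> (T (p (delta y))))"
            by (simp only: supported_sum[OF X.finite_X] fs.scale_sum_right[symmetric] perm_action_linear(3)[symmetric])
        qed
        also have "\<dots> = (\<Sum>y\<in>Y. fscale (v (actY \<sigma> y)) (T (p (delta (actY \<sigma> y)))))"
          by (rule sum.cong[OF refl])
             (use s in \<open>simp add: TD(3)[symmetric] p(2) p(4)[symmetric] Y.perm_action_delta\<close>)
        also have "\<dots> = (\<Sum>y\<in>Y. fscale (v y) (T (p (delta y))))"
          by (rule Y.sum_act[OF s])
        also have "\<dots> = T (\<Sum>y\<in>Y. fscale (v y) (p (delta y)))"
          by (rule ff.lin_on_sum[OF sV TD(2) p(2), symmetric])
        also have "\<dots> = T v"
          using projection_frame[OF Y.finite_X sV V(2) p' p(3) True] by simp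
        finally show ?thesis .
      qed
      have "(\<Sum>i\<in>Y \<times> X. hscale (al i T) (d i)) v = (\<Sum>i\<in>Y \<times> X. fscale (1 / fact N)
          (\<Sum>\<sigma>\<in>Sym N. fscale (al i T * v (actY \<sigma> (fst i))) (delta (actX \<sigma> (snd i)))))"
        by (subst sum_fun_apply, rule sum.cong[OF refl])
           (use True in \<open>auto simp: d_def fun_eq_iff sum_fun_apply sum_distrib_left algebra_simps\<close>)
      also have "\<dots> = fscale (1 / fact N) (\<Sum>\<sigma>\<in>Sym N. \<Sum>i\<in>Y \<times> X.
          fscale (al i T * v (actY \<sigma> (fst i))) (delta (actX \<sigma> (snd i))))"
        by (subst sum.swap) (simp only: fs.scale_sum_right)
      also have "\<dots> = fscale (1 / fact N) (\<Sum>\<sigma>\<in>Sym N. T v)"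
        using step by simp
      also have "\<dots> = T v"
        by (rule average_const)
      finally show ?thesis .
    next
      case False
      then show ?thesis
        by (auto simp: TD(4) sum_fun_apply d_def fun_eq_iff intro!: sum.neutral)
    qed
  qed
  have "?H \<subseteq> hs.span (d ` (Y \<times> X))"
  proof
    fix T assume T: "T \<in> ?H"
    have "(\<Sum>i\<in>Y \<times> X. hscale (al i T) (d i)) \<in> hs.span (d ` (Y \<times> X))"
      by (intro hs.span_sum hs.span_scale hs.span_base imageI)
    then show "T \<in> hs.span (d ` (Y \<times> X))" unfolding frame[OF T] .
  qed
  then show "\<exists>F. finite F \<and> ?H \<subseteq> hs.span F"
    by (intro exI[of _ "d ` (Y \<times> X)"]) simp
  \<comment> \<open>The trace of the identity on the Hom space. For each \<open>\<sigma>\<close> its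
    double sum will split into a trace on \<open>V\<close> times a number of fixed labels.\<close>
  have "of_nat (hs.dim ?H) = (\<Sum>i\<in>Y \<times> X. al i (d i))"
    by (rule hs.frame_dim[OF subspace_Hom_mod[OF V(1) X.module_supported] _ d_in _ frame, symmetric])
       (auto simp: al_def lin_on_def)
  also have "\<dots> = (\<Sum>y\<in>Y. \<Sum>x\<in>X. (1 / fact N) * (\<Sum>\<sigma>\<in>Sym N. p (delta y) (actY \<sigma> y) * delta (actX \<sigma> x) x))"
    unfolding sum.cartesian_product
    by (rule sum.cong) (auto simp: al_def d_def p(2) sum_fun_apply)
  also have "\<dots> = (1 / fact N) * (\<Sum>y\<in>Y. \<Sum>\<sigma>\<in>Sym N. \<Sum>x\<in>X. p (delta y) (actY \<sigma> y) * delta (actX \<sigma> x) x)"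
    by (simp only: sum_distrib_left[symmetric] sum.swap[of _ "Sym N" X])
  also have "\<dots> = (1 / fact N) * (\<Sum>\<sigma>\<in>Sym N. \<Sum>y\<in>Y. \<Sum>x\<in>X. p (delta y) (actY \<sigma> y) * delta (actX \<sigma> x) x)"
    by (simp only: sum.swap[of _ "Sym N" Y])
  \<comment> \<open>The trace appears at \<open>inv \<sigma>\<close>, because
    \<open>perm_action\<close> pulls functions back along the inverse, and the fixed labels are
    rewritten to match; inverting the summation variable then removes the inverses.\<close>
  also have "\<dots> = (1 / fact N) * (\<Sum>\<sigma>\<in>Sym N. of_nat (card {x \<in> X. actX (inv \<sigma>) x = x}) * trace_on V (?b (inv \<sigma>)))"
  proof (intro arg_cong[of _ _ "\<lambda>x. _ * x"] sum.cong refl)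
    fix \<sigma> assume s: "\<sigma> \<in> Sym N"
    have "trace_on V (?b (inv \<sigma>)) = (\<Sum>y\<in>Y. ?b (inv \<sigma>) (p (delta y)) y)"
      by (rule projection_trace[OF Y.finite_X sV V(2) p' p(3,2)]) (use s in \<open>auto simp: inV\<close>)
    also have "\<dots> = (\<Sum>y\<in>Y. p (delta y) (actY \<sigma> y))"
      using s by (simp add: perm_action_def Sym_inv_simps)
    finally have tr: "trace_on V (?b (inv \<sigma>)) = (\<Sum>y\<in>Y. p (delta y) (actY \<sigma> y))" .
    have "(\<Sum>x\<in>X. delta (actX \<sigma> x) x :: 'a) = of_nat (card {x \<in> X. x = actX \<sigma> x})"
      by (simp add: delta_def sum.If_cases Int_def)
    also have "{x \<in> X. x = actX \<sigma> x} = {x \<in> X. actX (inv \<sigma>) x = x}"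
      using X.act_eq_iff[OF s] by auto
    finally have fx: "(\<Sum>x\<in>X. delta (actX \<sigma> x) x :: 'a) = of_nat (card {x \<in> X. actX (inv \<sigma>) x = x})" .
    have "(\<Sum>y\<in>Y. \<Sum>x\<in>X. p (delta y) (actY \<sigma> y) * delta (actX \<sigma> x) x) =
        (\<Sum>y\<in>Y. p (delta y) (actY \<sigma> y)) * (\<Sum>x\<in>X. delta (actX \<sigma> x) x)"
      by (simp only: sum_product)
    then show "(\<Sum>y\<in>Y. \<Sum>x\<in>X. p (delta y) (actY \<sigma> y) * delta (actX \<sigma> x) x) =
        of_nat (card {x \<in> X. actX (inv \<sigma>) x = x}) * trace_on V (?b (inv \<sigma>))"
      by (simp only: tr fx mult.commute)
  qed
  also have "\<dots> = (1 / fact N) * (\<Sum>\<sigma>\<in>Sym N. of_nat (card {x \<in> X. actX \<sigma> x = x}) * trace_on V (?b \<sigma>))"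
    by (simp only: sum_Sym_inv[of "\<lambda>\<sigma>. of_nat (card {x \<in> X. actX \<sigma> x = x}) * trace_on V (?b \<sigma>)"])
  finally show "of_nat (hs.dim ?H) = (1 / fact N) *
    (\<Sum>\<sigma>\<in>Sym N. of_nat (card {x \<in> X. actX \<sigma> x = x}) * trace_on V (?b \<sigma>))" .
qed

section \<open>Decomposition into irreducible modules\<close>

lemma Hom_modI:
  assumes "\<And>v. v \<in> V \<Longrightarrow> T v \<in> W" "lin_on fscale fscale V T"
    "\<And>\<sigma> v. \<sigma> \<in> G \<Longrightarrow> v \<in> V \<Longrightarrow> T (\<rho> \<sigma> v) = \<tau> \<sigma> (T v)"
    "\<And>v. v \<notin> V \<Longrightarrow> T v = 0"
  shows "T \<in> Hom_mod G \<rho> V \<tau> W"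
  using assms by (auto simp: Hom_mod_def lin_on_def)

lemma is_moduleD:
  assumes "is_module G \<rho> V"
  shows "fs.subspace V" "\<sigma> \<in> G \<Longrightarrow> v \<in> V \<Longrightarrow> \<rho> \<sigma> v \<in> V"
    "0 \<in> V" "u \<in> V \<Longrightarrow> v \<in> V \<Longrightarrow> u + v \<in> V" "v \<in> V \<Longrightarrow> fscale c v \<in> V"
  using assms by (auto simp: is_module_def fs.subspace_0 fs.subspace_add fs.subspace_scale)

lemma Hom_mod_zero:
  assumes "is_module G \<rho> V" "T \<in> Hom_mod G \<rho> V \<tau> W"
  shows "T 0 = 0"
  by (rule ff.lin_on_zero[OF is_moduleD(1)[OF assms(1)] Hom_modD(2)[OF assms(2)]])

lemma Hom_mod_comp:
  assumes V: "is_module G \<rho> V" and S: "S \<in> Hom_mod G \<rho> V \<tau> W" and T: "T \<in> Hom_mod G \<tau> W \<kappa> U"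
  shows "(\<lambda>v. if v \<in> V then T (S v) else 0) \<in> Hom_mod G \<rho> V \<kappa> U"
  using Hom_modD[OF S] Hom_modD[OF T] is_moduleD[OF V]
  by (intro Hom_modI) (auto simp: lin_on_def)

lemma Hom_mod_inverse:
  assumes V: "is_module G \<rho> V" and W: "is_module G \<tau> W"
    and T: "T \<in> Hom_mod G \<rho> V \<tau> W" "bij_betw T V W"
  shows "(\<lambda>w. if w \<in> W then inv_into V T w else 0) \<in> Hom_mod G \<tau> W \<rho> V"
proof -
  note TD = Hom_modD[OF T(1)]
  have inv: "inv_into V T w \<in> V" "T (inv_into V T w) = w" if "w \<in> W" for w
    using T(2) that by (auto simp: bij_betw_def inv_into_into f_inv_into_f)
  have eq: "inv_into V T w = v" if "v \<in> V" "T v = w" for v w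
    using T(2) that by (auto simp: bij_betw_def inv_into_f_eq)
  show ?thesis
  proof (intro Hom_modI, goal_cases)
    case 2
    show ?case
      unfolding lin_on_def using is_moduleD[OF V] is_moduleD[OF W] lin_onD[OF TD(2)]
      by (auto intro!: eq simp: inv)
  next
    case (3 \<sigma> w)
    then show ?case
      using is_moduleD[OF V] is_moduleD[OF W] TD(3) by (auto intro!: eq simp: inv)
  qed (auto simp: inv)
qed

lemma irreducible_modD:
  assumes "irreducible_mod G \<rho> V"
  shows "is_module G \<rho> V" "V \<noteq> {0}" "U \<subseteq> V \<Longrightarrow> is_module G \<rho> U \<Longrightarrow> U = {0} \<or> U = V"
  using assms by (simp_all add: irreducible_mod_def)

text \<open>Kernel and image are submodules of irreducible modules, so a kernel other than all of
  \<open>S\<close> leaves only a bijection.\<close>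

lemma schur:
  assumes S: "irreducible_mod G (perm_action a) S" and U: "irreducible_mod G (perm_action b) U"
    and T: "T \<in> Hom_mod G (perm_action a) S (perm_action b) U"
  shows "(\<forall>v\<in>S. T v = 0) \<or> bij_betw T S U"
proof -
  note TD = Hom_modD[OF T]
  have mS: "is_module G (perm_action a) S" and mU: "is_module G (perm_action b) U"
    using S U by (auto simp: irreducible_mod_def)
  note sS = is_moduleD[OF mS] and sU = is_moduleD[OF mU]
  let ?K = "{v \<in> S. T v = 0}"
  have "is_module G (perm_action a) ?K"
    unfolding is_module_def fs.subspace_def
    using sS lin_onD[OF TD(2)] TD(3) Hom_mod_zero[OF mS T] by auto
  then have K: "?K = {0} \<or> ?K = S"
    by (intro irreducible_modD(3)[OF S]) auto
  have "is_module G (perm_action b) (T ` S)"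
    unfolding is_module_def fs.subspace_def
  proof (intro conjI ballI allI)
    show "0 \<in> T ` S"
      using Hom_mod_zero[OF mS T] sS(3) by force
    show "x + y \<in> T ` S" if xy: "x \<in> T ` S" "y \<in> T ` S" for x y
    proof -
      obtain u v where "u \<in> S" "v \<in> S" "x = T u" "y = T v" using xy by blast
      then show ?thesis using lin_onD(1)[OF TD(2), of u v] sS(4) by (metis imageI)
    qed
    show "fscale c x \<in> T ` S" if "x \<in> T ` S" for c x
      using that lin_onD(2)[OF TD(2)] sS(5) by (metis (no_types, lifting) image_iff)
    show "perm_action b \<sigma> x \<in> T ` S" if "\<sigma> \<in> G" "x \<in> T ` S" for \<sigma> x
      using that TD(3) sS(2) by (metis (no_types, lifting) image_iff)
  qed
  moreover have "T ` S \<subseteq> U" using TD(1) by auto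
  ultimately have I: "T ` S = {0} \<or> T ` S = U"
    by (intro irreducible_modD(3)[OF U])
  show ?thesis
  proof (cases "?K = S")
    case True
    then show ?thesis by blast
  next
    case False
    then have K0: "?K = {0}" using K by simp
    have "T ` S \<noteq> {0}"
      using False by auto
    then have img: "T ` S = U" using I by simp
    have "inj_on T S"
    proof (rule inj_onI)
      fix u v assume uv: "u \<in> S" "v \<in> S" "T u = T v"
      have m: "fscale (- 1) v \<in> S" using sS(5) uv(2) by blast
      have "T (u + fscale (- 1) v) = T u + fscale (- 1) (T v)"
        using lin_onD(1)[OF TD(2) uv(1) m] lin_onD(2)[OF TD(2) uv(2)] by metis
      also have "\<dots> = 0" using uv(3) by (auto simp: fun_eq_iff)
      finally have "u + fscale (- 1) v \<in> ?K"
        using sS(4)[OF uv(1) m] by simp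
      then have "u + fscale (- 1) v = 0" using K0 by auto
      then show "u = v" by (auto simp: fun_eq_iff)
    qed
    then show ?thesis using img by (simp add: bij_betw_def)
  qed
qed

text \<open>The frame of \<open>S\<close> obtained from a projection is carried to \<open>U\<close>
  by the isomorphism, with functionals read through the inverse. The trace of the identity is then
  the same sum for both modules.\<close>

lemma iso_mod_dim:
  fixes S :: "('y \<Rightarrow> 'a::field_char_0) set" and U :: "('x \<Rightarrow> 'a) set"
  assumes "perm_set N actY Y"
    and S: "is_module (Sym N) (perm_action actY) S" "S \<subseteq> supported Y"
    and U: "is_module (Sym N) \<tau> U"
    and iso: "iso_mod (Sym N) (perm_action actY) S \<tau> U"
  shows "fs.dim U = fs.dim S"
proof -
  interpret Y: perm_set N actY Y by fact
  obtain T where T: "T \<in> Hom_mod (Sym N) (perm_action actY) S \<tau> U" "bij_betw T S U"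
    using iso by (auto simp: iso_mod_def)
  note TD = Hom_modD[OF T(1)]
  define R where "R w = (if w \<in> U then inv_into S T w else 0)" for w
  have R: "R \<in> Hom_mod (Sym N) \<tau> U (perm_action actY) S"
    unfolding R_def by (rule Hom_mod_inverse[OF S(1) U T])
  note RD = Hom_modD[OF R]
  have TR: "T (R w) = w" if "w \<in> U" for w
    using that T(2) by (auto simp: R_def bij_betw_def f_inv_into_f)
  have RT: "R (T v) = v" if "v \<in> S" for v
    using that T(2) TD(1) by (auto simp: R_def bij_betw_def)
  obtain p where p: "lin_on fscale fscale UNIV p" "\<And>v. p v \<in> S" "\<And>v. v \<in> S \<Longrightarrow> p v = v"
    using Y.maschke[OF S(1)] by metis
  have p': "lin_on fscale fscale (supported Y) p"
    using p(1) lin_on_subset by blast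
  note sS = is_moduleD(1)[OF S(1)] and sU = is_moduleD(1)[OF U]
  have "of_nat (fs.dim U) = (\<Sum>y\<in>Y. R (T (p (delta y))) y)"
  proof (rule fs.frame_dim[where al = "\<lambda>y w. R w y", symmetric, OF sU Y.finite_X])
    show "(\<Sum>y\<in>Y. fscale (R w y) (T (p (delta y)))) = w" if w: "w \<in> U" for w
    proof -
      have "(\<Sum>y\<in>Y. fscale (R w y) (T (p (delta y)))) = T (\<Sum>y\<in>Y. fscale (R w y) (p (delta y)))"
        by (rule ff.lin_on_sum[OF sS TD(2) p(2), symmetric])
      also have "\<dots> = w"
        using projection_frame[OF Y.finite_X sS S(2) p' p(3) RD(1)[OF w]] TR[OF w] by simp
      finally show ?thesis .
    qed
  qed (use TD(1) p(2) lin_onD[OF RD(2)] in \<open>auto simp: lin_on_def\<close>)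
  also have "\<dots> = of_nat (fs.dim S)"
    using projection_dim[OF Y.finite_X sS S(2) p' p(3,2)] by (simp add: RT p(2))
  finally show ?thesis by simp
qed

context perm_set
begin

text \<open>Split off a nonzero submodule of least dimension, which is irreducible, and continue
  with the kernel of an equivariant projection onto it.\<close>

lemma decomposition_exists:
  fixes V :: "('x \<Rightarrow> 'a::field_char_0) set"
  assumes "is_module (Sym N) (perm_action act) V" "V \<subseteq> supported X"
  shows "\<exists>D. irreducible_decomposition (Sym N) (perm_action act) V D"
  using assms
proof (induction "fs.dim V" arbitrary: V rule: less_induct)
  case less
  let ?mod = "is_module (Sym N) (perm_action act) :: ('x \<Rightarrow> 'a) set \<Rightarrow> bool"
  note V = less.prems
  have eq: "W = U" if "?mod W" "?mod U" "W \<subseteq> U" "U \<subseteq> V" "fs.dim U \<le> fs.dim W" for U W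
    by (rule fs.subspace_eq_if_dim_le[where F = "delta ` X"])
       (use that V(2) supported_subset_span[OF finite_X] in \<open>auto simp: is_module_def\<close>)
  show ?case
  proof (cases "V = {0}")
    case True
    then show ?thesis
      by (intro exI[of _ "{}"]) (simp add: irreducible_decomposition_def)
  next
    case False
    then have "?mod V \<and> V \<subseteq> V \<and> V \<noteq> {0}" using V by simp
    from ex_has_least_nat[of "\<lambda>U. ?mod U \<and> U \<subseteq> V \<and> U \<noteq> {0}" V fs.dim, OF this]
    obtain U where U: "?mod U" "U \<subseteq> V" "U \<noteq> {0}"
      and least: "\<And>W. ?mod W \<Longrightarrow> W \<subseteq> V \<Longrightarrow> W \<noteq> {0} \<Longrightarrow> fs.dim U \<le> fs.dim W"
      by auto
    have irr: "irreducible_mod (Sym N) (perm_action act) U"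
      unfolding irreducible_mod_def using U eq least by blast
    obtain p where p: "lin_on fscale fscale UNIV p" "\<And>v. p v \<in> U" "\<And>v. v \<in> U \<Longrightarrow> p v = v"
      "\<And>\<sigma> v. \<sigma> \<in> Sym N \<Longrightarrow> p (perm_action act \<sigma> v) = perm_action act \<sigma> (p v)"
      by (rule maschke[OF U(1)]) (rule that; assumption)
    have p0: "p 0 = 0"
      using ff.lin_on_zero[OF fs.subspace_UNIV p(1)] .
    have padd: "p (u + v) = p u + p v" and pscale: "p (fscale c v) = fscale c (p v)" for u v c
      using lin_onD[OF p(1)] by auto
    define W where "W = {v \<in> V. p v = 0}"
    have W: "?mod W"
      using is_moduleD[OF V(1)] unfolding W_def is_module_def fs.subspace_def
      by (auto simp: p0 padd pscale p(4))
    have UW: "u = 0" if "u \<in> U" "u \<in> W" for u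
      using that p(3) by (auto simp: W_def)
    have "fs.dim W < fs.dim V"
    proof (rule ccontr)
      assume "\<not> fs.dim W < fs.dim V"
      then have "W = V" using eq[OF W V(1)] by (auto simp: W_def)
      then have "U \<subseteq> {0}" using UW U(2) by auto
      then show False using U(3) is_moduleD(3)[OF U(1)] by auto
    qed
    then obtain D where D: "irreducible_decomposition (Sym N) (perm_action act) W D"
      using less.hyps[of W] W V(2) by (auto simp: W_def)
    then have D': "finite D" "fs.span (\<Union>D) = W" "\<And>A. A \<in> D \<Longrightarrow> irreducible_mod (Sym N) (perm_action act) A"
      "\<And>f. (\<And>A. A \<in> D \<Longrightarrow> f A \<in> A) \<Longrightarrow> (\<Sum>A\<in>D. f A) = 0 \<Longrightarrow> (\<forall>A\<in>D. f A = 0)"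
      unfolding irreducible_decomposition_def by blast+
    have DW: "A \<subseteq> W" if "A \<in> D" for A
      using D'(2) fs.span_superset that by blast
    have UD: "U \<notin> D"
      using DW UW U(3) is_moduleD(3)[OF U(1)] by blast
    have "fs.span (\<Union>(insert U D)) = V"
    proof
      show "fs.span (\<Union>(insert U D)) \<subseteq> V"
        by (rule fs.span_minimal) (use U DW is_moduleD[OF V(1)] in \<open>auto simp: W_def\<close>)
      show "V \<subseteq> fs.span (\<Union>(insert U D))"
      proof
        fix v assume v: "v \<in> V"
        let ?w = "v + fscale (- 1) (p v)"
        have "?w \<in> W"
        proof -
          have "?w \<in> V"
            using v p(2)[of v] U(2) by (intro is_moduleD(4,5)[OF V(1)]) auto
          moreover have "p ?w = p v + fscale (- 1) (p v)"
            by (simp only: padd pscale p(3)[OF p(2)])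
          ultimately show ?thesis
            by (simp add: W_def fun_eq_iff)
        qed
        then have "?w \<in> fs.span (\<Union>(insert U D))"
          using D'(2) fs.span_mono[of "\<Union>D" "\<Union>(insert U D)"] by auto
        moreover have "p v \<in> fs.span (\<Union>(insert U D))"
          using p(2) by (intro fs.span_base) auto
        ultimately have "?w + p v \<in> fs.span (\<Union>(insert U D))"
          by (rule fs.span_add)
        also have "?w + p v = v" by (auto simp: fun_eq_iff)
        finally show "v \<in> fs.span (\<Union>(insert U D))" .
      qed
    qed
    moreover have "\<forall>A\<in>insert U D. f A = 0"
      if f: "\<forall>A\<in>insert U D. f A \<in> A" "(\<Sum>A\<in>insert U D. f A) = 0" for f
    proof -
      have s: "f U + (\<Sum>A\<in>D. f A) = 0"
        using f(2) UD D'(1) by simp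
      have "(\<Sum>A\<in>D. f A) \<in> W"
        using f(1) DW by (intro fs.subspace_sum is_moduleD(1)[OF W]) auto
      then have "p (f U + (\<Sum>A\<in>D. f A)) = f U"
        using f(1) by (simp add: padd p(3) W_def)
      then have "f U = 0" using s p0 by simp
      moreover have "\<forall>A\<in>D. f A = 0"
        by (rule D'(4)) (use s f(1) \<open>f U = 0\<close> in simp_all)
      ultimately show ?thesis by simp
    qed
    ultimately have "irreducible_decomposition (Sym N) (perm_action act) V (insert U D)"
      unfolding irreducible_decomposition_def using D'(1,3) irr by (intro conjI allI impI) blast+
    then show ?thesis ..
  qed
qed

end

text \<open>Direct sum coordinates, meaningful for \<open>v\<close> in the span of \<open>D\<close>;
  independence of the summands makes the choice unique on the members of \<open>D\<close>.\<close>

definition component :: "('x \<Rightarrow> 'a::field) set set \<Rightarrow> ('x \<Rightarrow> 'a) \<Rightarrow> ('x \<Rightarrow> 'a) set \<Rightarrow> 'x \<Rightarrow> 'a"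
  where "component D v = (SOME f. (\<forall>U\<in>D. f U \<in> U) \<and> (\<Sum>U\<in>D. f U) = v)"

locale decomposed_module =
  fixes G and act :: "(nat \<Rightarrow> nat) \<Rightarrow> 'x \<Rightarrow> 'x" and V :: "('x \<Rightarrow> 'a::field) set" and D
  assumes dec: "irreducible_decomposition G (perm_action act) V D"
begin

lemma finite_D: "finite D"
  and irreducible_D: "U \<in> D \<Longrightarrow> irreducible_mod G (perm_action act) U"
  and span_D: "fs.span (\<Union>D) = V"
  and independent_D: "(\<And>U. U \<in> D \<Longrightarrow> f U \<in> U) \<Longrightarrow> (\<Sum>U\<in>D. f U) = 0 \<Longrightarrow> U \<in> D \<Longrightarrow> f U = 0"
  using dec unfolding irreducible_decomposition_def by blast+

lemma module_D: "U \<in> D \<Longrightarrow> is_module G (perm_action act) U"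
  using irreducible_D by (simp add: irreducible_mod_def)

lemma D_subset: "U \<in> D \<Longrightarrow> U \<subseteq> V"
  using span_D fs.span_superset by blast

lemma subspace_V: "fs.subspace V"
  using span_D fs.subspace_span by metis

lemma component:
  assumes "v \<in> V"
  shows "U \<in> D \<Longrightarrow> component D v U \<in> U" "(\<Sum>U\<in>D. component D v U) = v"
proof -
  have "v \<in> fs.span (\<Union>D)" using assms span_D by simp
  then have "\<exists>f. (\<forall>U\<in>D. f U \<in> U) \<and> (\<Sum>U\<in>D. f U) = v"
  proof (induction rule: fs.span_induct_alt)
    case base
    show ?case
      by (intro exI[of _ "\<lambda>_. 0"] conjI ballI sum.neutral_const) (rule is_moduleD(3)[OF module_D])
  next
    case (step c x y)
    then obtain f U where f: "\<forall>A\<in>D. f A \<in> A" "(\<Sum>A\<in>D. f A) = y" and U: "U \<in> D" "x \<in> U" by auto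
    let ?g = "\<lambda>A. (if A = U then fscale c x else 0) + f A"
    have "\<forall>A\<in>D. ?g A \<in> A"
      using f U is_moduleD[OF module_D] by auto
    moreover have "(\<Sum>A\<in>D. ?g A) = fscale c x + y"
      using f U finite_D by (simp add: sum.distrib)
    ultimately have "(\<forall>A\<in>D. ?g A \<in> A) \<and> (\<Sum>A\<in>D. ?g A) = fscale c x + y" ..
    then show ?case
      by (rule exI[of "\<lambda>g. (\<forall>A\<in>D. g A \<in> A) \<and> (\<Sum>A\<in>D. g A) = fscale c x + y" ?g])
  qed
  then have "(\<forall>U\<in>D. component D v U \<in> U) \<and> (\<Sum>U\<in>D. component D v U) = v"
    unfolding component_def by (rule someI_ex)
  then show "U \<in> D \<Longrightarrow> component D v U \<in> U" "(\<Sum>U\<in>D. component D v U) = v" by auto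
qed

text \<open>The tool behind all further properties of components: it suffices to exhibit one
  decomposition of the vector.\<close>

lemma component_unique:
  assumes "\<And>U. U \<in> D \<Longrightarrow> f U \<in> U" "(\<Sum>U\<in>D. f U) = v" "U \<in> D"
  shows "component D v U = f U"
proof -
  have v: "v \<in> V"
    using assms D_subset subspace_V by (auto intro!: fs.subspace_sum)
  have "component D v U - f U = 0"
  proof (rule independent_D[of "\<lambda>U. component D v U - f U", OF _ _ assms(3)])
    show "component D v A - f A \<in> A" if "A \<in> D" for A
      using that component(1)[OF v] assms(1) is_moduleD(1)[OF module_D[OF that]]
      by (auto intro: fs.subspace_diff)
    show "(\<Sum>A\<in>D. component D v A - f A) = 0"
      using component(2)[OF v] assms(2) by (simp add: sum_subtractf)
  qed
  then show ?thesis by simp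
qed

lemma component_linear:
  assumes "U \<in> D"
  shows "lin_on fscale fscale V (\<lambda>v. component D v U)"
  unfolding lin_on_def
proof (intro conjI ballI allI)
  fix u v assume uv: "u \<in> V" "v \<in> V"
  show "component D (u + v) U = component D u U + component D v U"
    by (rule component_unique[OF _ _ assms, where f = "\<lambda>A. component D u A + component D v A"])
       (simp_all only: sum.distrib component uv is_moduleD(4)[OF module_D])
next
  fix c v assume v: "v \<in> V"
  show "component D (fscale c v) U = fscale c (component D v U)"
    by (rule component_unique[OF _ _ assms, where f = "\<lambda>A. fscale c (component D v A)"])
       (simp_all only: fs.scale_sum_right[symmetric] component v is_moduleD(5)[OF module_D])
qed

lemma component_equivariant:
  assumes "U \<in> D" "v \<in> V" "\<sigma> \<in> G"
  shows "component D (perm_action act \<sigma> v) U = perm_action act \<sigma> (component D v U)"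
  by (rule component_unique[OF _ _ assms(1), where f = "\<lambda>A. perm_action act \<sigma> (component D v A)"])
     (simp_all only: perm_action_linear(3)[symmetric] component assms is_moduleD(2)[OF module_D])

lemma component_same: "U \<in> D \<Longrightarrow> v \<in> U \<Longrightarrow> component D v U = v"
  by (rule trans[OF component_unique[where f = "\<lambda>A. if A = U then v else 0"]])
     (auto simp: finite_D is_moduleD(3)[OF module_D])

text \<open>Choose an isomorphism \<open>I U\<close> onto each summand \<open>U\<close> isomorphic
  to \<open>S\<close>. These maps are independent, since their values at a nonzero vector lie in
  different summands. They span, since by Schur and the scalar endomorphisms a map from
  \<open>S\<close> to a summand is zero or a multiple of \<open>I U\<close>.\<close>

lemma dim_Hom_eq_card:
  fixes S :: "('y \<Rightarrow> 'a) set"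
  assumes S: "irreducible_mod G (perm_action actY) S"
    and scalar: "\<And>T. T \<in> Hom_mod G (perm_action actY) S (perm_action actY) S \<Longrightarrow>
      \<exists>c. \<forall>v\<in>S. T v = fscale c v"
  shows "hs.dim (Hom_mod G (perm_action actY) S (perm_action act) V)
    = card {U \<in> D. iso_mod G (perm_action actY) S (perm_action act) U}"
proof -
  let ?b = "perm_action actY :: ('y, 'a) action" and ?a = "perm_action act :: ('x, 'a) action"
  define D' where "D' = {U \<in> D. iso_mod G ?b S ?a U}"
  have D': "D' \<subseteq> D" "finite D'" using finite_D by (auto simp: D'_def)
  have mS: "is_module G ?b S" using S by (simp add: irreducible_mod_def)
  obtain s where s: "s \<in> S" "s \<noteq> 0"
    using S is_moduleD(3)[OF mS] unfolding irreducible_mod_def by blast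
  have "\<exists>T. T \<in> Hom_mod G ?b S ?a U \<and> bij_betw T S U" if "U \<in> D'" for U
    using that by (auto simp: D'_def iso_mod_def)
  then obtain I where I: "\<And>U. U \<in> D' \<Longrightarrow> I U \<in> Hom_mod G ?b S ?a U"
    "\<And>U. U \<in> D' \<Longrightarrow> bij_betw (I U) S U" by metis
  have I0: "I U 0 = 0" if "U \<in> D'" for U
    using Hom_mod_zero[OF mS I(1)[OF that]] .
  have Is: "I U s \<noteq> 0" "I U s \<in> U" if "U \<in> D'" for U
    using I(2)[OF that] I0[OF that] s is_moduleD(3)[OF mS] Hom_modD(1)[OF I(1)[OF that] s(1)]
    by (metis bij_betw_def inj_onD, simp)
  have zero: "g U = 0" if g: "(\<Sum>U\<in>D'. fscale (g U) (I U s)) = 0" and U: "U \<in> D'" for g U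
  proof -
    let ?f = "\<lambda>A. if A \<in> D' then fscale (g A) (I A s) else 0"
    have "?f U = 0"
    proof (rule independent_D)
      show "?f A \<in> A" if "A \<in> D" for A
        using that Is is_moduleD[OF module_D[OF that]] by auto
      have "(\<Sum>A\<in>D. ?f A) = (\<Sum>A\<in>D'. fscale (g A) (I A s))"
        by (rule sum.mono_neutral_cong_right) (use D' finite_D in auto)
      then show "(\<Sum>A\<in>D. ?f A) = 0" using g by simp
    qed (use U D' in auto)
    then show ?thesis using U Is(1)[OF U] by simp
  qed
  have zero': "g U = 0" if g: "(\<Sum>U\<in>D'. hscale (g U) (I U)) = 0" and U: "U \<in> D'" for g U
  proof -
    have "(\<Sum>U\<in>D'. hscale (g U) (I U)) s = 0" using g by simp
    then have "(\<Sum>U\<in>D'. fscale (g U) (I U s)) = 0"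
      by (simp add: sum_fun_apply)
    then show ?thesis using zero U by simp
  qed
  have ind: "inj_on I D'" "hs.independent (I ` D')"
    by (rule hs.independent_family[OF D'(2)]; erule (1) zero')+
  have "hs.dim (Hom_mod G ?b S ?a V) = card (I ` D')"
  proof (rule hs.dim_unique)
    show "I ` D' \<subseteq> Hom_mod G ?b S ?a V"
      using I(1) D_subset D'(1) by (fastforce simp: Hom_mod_def)
    show "hs.independent (I ` D')" by (rule ind(2))
    show "Hom_mod G ?b S ?a V \<subseteq> hs.span (I ` D')"
    proof
      fix T assume T: "T \<in> Hom_mod G ?b S ?a V"
      note TD = Hom_modD[OF T]
      \<comment> \<open>The part of \<open>T\<close> that lands in \<open>U\<close>; these parts add
        up to \<open>T\<close>.\<close>
      define P where "P U = (\<lambda>v. if v \<in> S then component D (T v) U else 0)" for U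
      have P: "P U \<in> Hom_mod G ?b S ?a U" if U: "U \<in> D" for U
        unfolding P_def using U TD is_moduleD[OF mS] component(1) component_equivariant
          lin_onD[OF component_linear[OF U]] lin_onD[OF TD(2)]
        by (intro Hom_modI) (auto simp: lin_on_def)
      have P_span: "P U \<in> hs.span (I ` D')" if U: "U \<in> D" for U
      proof (cases "\<forall>v\<in>S. P U v = 0")
        case True
        then have "P U = 0" by (auto simp: fun_eq_iff P_def)
        then show ?thesis by (simp add: hs.span_zero)
      next
        case False
        then have "bij_betw (P U) S U"
          using schur[OF S irreducible_D[OF U] P[OF U]] by argo
        then have UD: "U \<in> D'"
          using P[OF U] U by (auto simp: D'_def iso_mod_def)
        define R where "R w = (if w \<in> U then inv_into S (I U) w else 0)" for w
        have R: "R \<in> Hom_mod G ?a U ?b S"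
          unfolding R_def by (rule Hom_mod_inverse[OF mS module_D[OF U] I[OF UD]])
        \<comment> \<open>\<open>R\<close> after \<open>P U\<close> is an endomorphism of
          \<open>S\<close>, hence a scalar; applying \<open>I U\<close> shows \<open>P U\<close> to
          be that multiple of \<open>I U\<close>.\<close>
        obtain c where c: "\<And>v. v \<in> S \<Longrightarrow> R (P U v) = fscale c v"
          using scalar[OF Hom_mod_comp[OF mS P[OF U] R]] by auto
        have IR: "I U (R w) = w" if "w \<in> U" for w
          using that I(2)[OF UD] by (auto simp: R_def bij_betw_def f_inv_into_f)
        have "P U v = fscale c (I U v)" if v: "v \<in> S" for v
          using IR[OF Hom_modD(1)[OF P[OF U] v]] c[OF v] lin_onD(2)[OF Hom_modD(2)[OF I(1)[OF UD]] v]
          by simp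
        then have "P U v = hscale c (I U) v" for v
          using Hom_modD(4)[OF P[OF U]] Hom_modD(4)[OF I(1)[OF UD]] by (cases "v \<in> S") simp_all
        then have "P U = hscale c (I U)" ..
        then show ?thesis
          using UD by (auto intro: hs.span_scale hs.span_base)
      qed
      have "(\<Sum>U\<in>D. P U) = T"
      proof
        fix v show "(\<Sum>U\<in>D. P U) v = T v"
          by (cases "v \<in> S") (simp_all add: sum_fun_apply P_def component(2) TD(1,4))
      qed
      then show "T \<in> hs.span (I ` D')"
        using hs.span_sum[of D P "I ` D'"] P_span by auto
    qed
  qed (rule refl)
  then show ?thesis
    unfolding card_image[OF ind(1)] by (simp only: D'_def)
qed

end

context perm_set
begin

text \<open>The dimension of a summand is the trace of the projection onto it, and the projections
  add up to the identity, whose trace is \<open>card X\<close>.\<close>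

lemma sum_dim_decomposition:
  assumes "irreducible_decomposition (Sym N) (perm_action act) (supported X :: ('x \<Rightarrow> 'a::field_char_0) set) D"
  shows "(\<Sum>U\<in>D. fs.dim U) = card X"
proof -
  interpret D: decomposed_module "Sym N" act "supported X :: ('x \<Rightarrow> 'a) set" D
    by unfold_locales fact
  have "(\<Sum>U\<in>D. of_nat (fs.dim U)) = (\<Sum>U\<in>D. \<Sum>x\<in>X. component D (delta x) U x)"
    by (intro sum.cong refl projection_dim[OF finite_X])
       (auto simp: is_moduleD(1)[OF D.module_D] D.component D.component_same D.component_linear
         dest: D.D_subset)
  also have "\<dots> = (\<Sum>x\<in>X. (\<Sum>U\<in>D. component D (delta x) U) x)"
    by (subst sum.swap) (simp add: sum_fun_apply)
  also have "\<dots> = (\<Sum>x\<in>X. 1 :: 'a)"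
    by (rule sum.cong) (simp_all add: D.component, simp add: delta_def)
  finally have "of_nat (\<Sum>U\<in>D. fs.dim U) = (of_nat (card X) :: 'a)" by simp
  then show ?thesis by (simp only: of_nat_eq_iff)
qed

text \<open>The description in \<open>multiplicity_mod\<close> needs existence and uniqueness. Every
  decomposition yields the dimension of the Hom space, which does not mention the decomposition, and
  this is the uniqueness.\<close>

lemma multiplicity_eq_dim_Hom:
  fixes S :: "('y \<Rightarrow> 'a::field_char_0) set"
  assumes S: "irreducible_mod (Sym N) (perm_action actY) S"
    and scalar: "\<And>T. T \<in> Hom_mod (Sym N) (perm_action actY) S (perm_action actY) S \<Longrightarrow>
      \<exists>c. \<forall>v\<in>S. T v = fscale c v"
  shows "multiplicity_mod (Sym N) (perm_action actY) S (perm_action act) (supported X)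
    = hs.dim (Hom_mod (Sym N) (perm_action actY) S (perm_action act) (supported X))"
proof -
  obtain D where D: "irreducible_decomposition (Sym N) (perm_action act) (supported X :: ('x \<Rightarrow> 'a) set) D"
    using decomposition_exists[OF module_supported] by auto
  have *: "card {U \<in> E. iso_mod (Sym N) (perm_action actY) S (perm_action act) U} =
      hs.dim (Hom_mod (Sym N) (perm_action actY) S (perm_action act) (supported X))"
    if "irreducible_decomposition (Sym N) (perm_action act) (supported X :: ('x \<Rightarrow> 'a) set) E" for E
    using decomposed_module.dim_Hom_eq_card[OF decomposed_module.intro[OF that] S scalar] by simp
  show ?thesis
    unfolding multiplicity_mod_def
  proof (intro the_equality)
    show "\<exists>E. irreducible_decomposition (Sym N) (perm_action act) (supported X :: ('x \<Rightarrow> 'a) set) E \<and>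
      hs.dim (Hom_mod (Sym N) (perm_action actY) S (perm_action act) (supported X)) =
      card {U \<in> E. iso_mod (Sym N) (perm_action actY) S (perm_action act) U}"
      by (intro exI conjI, rule D, rule *[OF D, symmetric])
  qed (elim exE conjE, simp only: *)
qed

end

section \<open>Specht modules\<close>

definition row_of :: "nat list \<Rightarrow> (nat \<times> nat \<Rightarrow> nat) \<Rightarrow> nat \<Rightarrow> nat"
  where "row_of l t x = fst (inv_into (young l) t x)"

definition col_of :: "nat list \<Rightarrow> (nat \<times> nat \<Rightarrow> nat) \<Rightarrow> nat \<Rightarrow> nat"
  where "col_of l t x = snd (inv_into (young l) t x)"

lemma young_Sigma: "young l = Sigma {..<length l} (\<lambda>i. {..<l ! i})"
  by (auto simp: young_def)

lemma finite_young [simp]: "finite (young l)"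
  by (simp add: young_Sigma)

lemma card_young: "card (young l) = sum_list l"
  by (simp add: young_Sigma sum_list_sum_nth atLeast0LessThan)

lemma young_down_closed:
  assumes "sorted_wrt (\<ge>) l" "(i, j) \<in> young l" "i' \<le> i" "j' \<le> j"
  shows "(i', j') \<in> young l"
proof -
  have "l ! i \<le> l ! i'"
    using assms sorted_wrt_nth_less[OF assms(1), of i' i] by (cases "i' = i") (auto simp: young_def)
  then show ?thesis using assms by (auto simp: young_def)
qed

lemma tableau_cell:
  assumes "tableau l t" "x \<in> {1..sum_list l}"
  shows "(row_of l t x, col_of l t x) \<in> young l" "t (row_of l t x, col_of l t x) = x"
proof -
  have "x \<in> t ` young l" using assms by (simp add: tableau_def bij_betw_def)
  then show "(row_of l t x, col_of l t x) \<in> young l" "t (row_of l t x, col_of l t x) = x"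
    by (simp_all add: row_of_def col_of_def inv_into_into f_inv_into_f)
qed

lemma tableau_entry:
  assumes "tableau l t" "(i, j) \<in> young l"
  shows "row_of l t (t (i, j)) = i" "col_of l t (t (i, j)) = j" "t (i, j) \<in> {1..sum_list l}"
  using assms by (auto simp: tableau_def bij_betw_def row_of_def col_of_def)

lemma tableau_eqI:
  assumes "tableau l t" "x \<in> {1..sum_list l}" "y \<in> {1..sum_list l}"
    "row_of l t x = row_of l t y" "col_of l t x = col_of l t y"
  shows "x = y"
  using tableau_cell(2)[OF assms(1,2)] tableau_cell(2)[OF assms(1,3)] assms(4,5) by metis

lemma bij_betw_cells:
  "tableau l t \<Longrightarrow> bij_betw (\<lambda>x. (row_of l t x, col_of l t x)) {1..sum_list l} (young l)"
  unfolding tableau_def row_of_def col_of_def by (simp add: bij_betw_inv_into)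

lemma Sym_in: "\<sigma> \<in> Sym n \<Longrightarrow> \<sigma> x \<in> {1..n} \<longleftrightarrow> x \<in> {1..n}"
  unfolding Sym_def by (simp only: mem_Collect_eq permutes_in_image)

lemma tableau_comp:
  assumes "tableau l t" "\<sigma> \<in> Sym (sum_list l)"
  shows "tableau l (\<sigma> \<circ> t)"
  using assms unfolding tableau_def Sym_def by (auto intro: bij_betw_trans permutes_imp_bij)

lemma cell_comp:
  assumes "tableau l t" "\<sigma> \<in> Sym (sum_list l)" "x \<in> {1..sum_list l}"
  shows "row_of l (\<sigma> \<circ> t) x = row_of l t (inv \<sigma> x)" "col_of l (\<sigma> \<circ> t) x = col_of l t (inv \<sigma> x)"
proof -
  have x: "inv \<sigma> x \<in> {1..sum_list l}"
    using assms(2,3) Sym_in[of "inv \<sigma>"] by simp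
  have "(\<sigma> \<circ> t) (row_of l t (inv \<sigma> x), col_of l t (inv \<sigma> x)) = x"
    using tableau_cell(2)[OF assms(1) x] Sym_inv_simps(5)[OF assms(2)] by simp
  then show "row_of l (\<sigma> \<circ> t) x = row_of l t (inv \<sigma> x)" "col_of l (\<sigma> \<circ> t) x = col_of l t (inv \<sigma> x)"
    using tableau_entry[OF tableau_comp[OF assms(1,2)] tableau_cell(1)[OF assms(1) x]] by simp_all
qed

lemma tabloid_nth:
  assumes "tableau l t" "i < length l"
  shows "tabloid l t ! i = {x \<in> {1..sum_list l}. row_of l t x = i}"
proof -
  have "tabloid l t ! i = {t (i, j) |j. (i, j) \<in> young l}"
    using assms(2) by (auto simp: tabloid_def young_def)
  also have "\<dots> = {x \<in> {1..sum_list l}. row_of l t x = i}"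
    using tableau_entry[OF assms(1)] tableau_cell[OF assms(1)] by (auto simp del: atLeastAtMost_iff) metis
  finally show ?thesis .
qed

lemma length_tabloid [simp]: "length (tabloid l t) = length l"
  by (simp add: tabloid_def)

text \<open>Allows tabloids to be treated as functions from entries to rows.\<close>

lemma tabloid_eq_iff:
  assumes "tableau l t" "tableau l s"
  shows "tabloid l t = tabloid l s \<longleftrightarrow> (\<forall>x\<in>{1..sum_list l}. row_of l t x = row_of l s x)"
proof
  assume eq: "tabloid l t = tabloid l s"
  show "\<forall>x\<in>{1..sum_list l}. row_of l t x = row_of l s x"
  proof
    fix x assume x: "x \<in> {1..sum_list l}"
    have i: "row_of l t x < length l"
      using tableau_cell(1)[OF assms(1) x] by (simp add: young_def)
    then have "x \<in> tabloid l s ! row_of l t x"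
      using x by (simp flip: eq add: tabloid_nth[OF assms(1)])
    then show "row_of l t x = row_of l s x"
      using i by (simp add: tabloid_nth[OF assms(2)])
  qed
next
  assume "\<forall>x\<in>{1..sum_list l}. row_of l t x = row_of l s x"
  then show "tabloid l t = tabloid l s"
    by (intro nth_equalityI) (auto simp: tabloid_nth[OF assms(1)] tabloid_nth[OF assms(2)])
qed

lemma tabloid_comp: "tabloid l (\<sigma> \<circ> t) = map ((`) \<sigma>) (tabloid l t)"
  by (auto simp: tabloid_def)

lemma column_eq:
  assumes "tableau l t"
  shows "{t (i, j) |i. (i, j) \<in> young l} = {x \<in> {1..sum_list l}. col_of l t x = j}"
  using tableau_entry[OF assms] tableau_cell[OF assms] by (auto simp del: atLeastAtMost_iff) metis

text \<open>Stability of every column as a set becomes a pointwise condition, the form in which it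
  enters later computations.\<close>

lemma column_stabilizer_iff:
  assumes t: "tableau l t"
  shows "\<sigma> \<in> column_stabilizer l t \<longleftrightarrow>
    \<sigma> \<in> Sym (sum_list l) \<and> (\<forall>x\<in>{1..sum_list l}. col_of l t (\<sigma> x) = col_of l t x)"
proof -
  let ?A = "\<lambda>j. {x \<in> {1..sum_list l}. col_of l t x = j}"
  have "(\<forall>j. \<sigma> ` ?A j = ?A j) \<longleftrightarrow> (\<forall>x\<in>{1..sum_list l}. col_of l t (\<sigma> x) = col_of l t x)"
    if s: "\<sigma> \<in> Sym (sum_list l)"
  proof
    assume "\<forall>j. \<sigma> ` ?A j = ?A j"
    then show "\<forall>x\<in>{1..sum_list l}. col_of l t (\<sigma> x) = col_of l t x" by blast
  next
    assume *: "\<forall>x\<in>{1..sum_list l}. col_of l t (\<sigma> x) = col_of l t x"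
    have sub: "\<sigma> ` ?A j \<subseteq> ?A j" for j
      using * Sym_in[OF s] by auto
    show "\<forall>j. \<sigma> ` ?A j = ?A j"
    proof
      fix j
      \<comment> \<open>An injective self-map of a finite column is onto.\<close>
      have "inj_on \<sigma> (?A j)"
        using s bij_is_inj[OF Sym_facts(6)[OF s]] inj_on_subset by blast
      then show "\<sigma> ` ?A j = ?A j"
        using sub by (intro endo_inj_surj) auto
    qed
  qed
  then show ?thesis
    unfolding column_stabilizer_def column_eq[OF t] by blast
qed

lemma finite_column_stabilizer [simp]: "finite (column_stabilizer l t)"
  by (rule finite_subset[OF _ Sym_facts(1)[of "sum_list l"]]) (auto simp: column_stabilizer_def)

lemma column_stabilizer_Sym: "\<sigma> \<in> column_stabilizer l t \<Longrightarrow> \<sigma> \<in> Sym (sum_list l)"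
  by (simp add: column_stabilizer_def)

lemma column_stabilizer_group:
  assumes t: "tableau l t"
  shows "id \<in> column_stabilizer l t"
    "\<sigma> \<in> column_stabilizer l t \<Longrightarrow> \<tau> \<in> column_stabilizer l t \<Longrightarrow> \<sigma> \<circ> \<tau> \<in> column_stabilizer l t"
    "\<sigma> \<in> column_stabilizer l t \<Longrightarrow> inv \<sigma> \<in> column_stabilizer l t"
proof -
  show "id \<in> column_stabilizer l t" by (simp add: column_stabilizer_iff[OF t])
  show "\<sigma> \<circ> \<tau> \<in> column_stabilizer l t" if "\<sigma> \<in> column_stabilizer l t" "\<tau> \<in> column_stabilizer l t"
    using that Sym_in[of \<tau> "sum_list l"] unfolding column_stabilizer_iff[OF t]
    by (auto simp del: atLeastAtMost_iff One_nat_def)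
  show "inv \<sigma> \<in> column_stabilizer l t" if "\<sigma> \<in> column_stabilizer l t"
  proof -
    have s: "\<sigma> \<in> Sym (sum_list l)" using that by (rule column_stabilizer_Sym)
    have "col_of l t (inv \<sigma> x) = col_of l t x" if x: "x \<in> {1..sum_list l}" for x
    proof -
      have "inv \<sigma> x \<in> {1..sum_list l}" using Sym_in[of "inv \<sigma>"] s x by simp
      then have "col_of l t (\<sigma> (inv \<sigma> x)) = col_of l t (inv \<sigma> x)"
        using \<open>\<sigma> \<in> column_stabilizer l t\<close> column_stabilizer_iff[OF t] by blast
      then show ?thesis by (simp add: Sym_inv_simps(5)[OF s])
    qed
    then show ?thesis using s by (simp add: column_stabilizer_iff[OF t])
  qed
qed

section \<open>Signed sums over column stabilizers\<close>

lemma sign_Sym: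
  assumes "\<sigma> \<in> Sym n" "\<tau> \<in> Sym n"
  shows "sign (\<sigma> \<circ> \<tau>) = sign \<sigma> * sign \<tau>" "sign (inv \<sigma>) = sign \<sigma>"
  using assms by (auto simp: Sym_def intro!: sign_compose sign_inverse permutation_permutes[THEN iffD2])

text \<open>All lists of sets of the right length, a superset of the genuine tabloids: what matters
  is that it is finite, stable under the action and contains the support of every Specht
  vector.\<close>

definition tabloids :: "nat list \<Rightarrow> nat set list set"
  where "tabloids l = {xs. set xs \<subseteq> Pow {1..sum_list l} \<and> length xs = length l}"

lemma tabloid_in_tabloids: "tableau l t \<Longrightarrow> tabloid l t \<in> tabloids l"
  by (auto simp: tabloids_def in_set_conv_nth tabloid_nth)

lemma perm_set_tabloids: "perm_set (sum_list l) (\<lambda>\<sigma>. map ((`) \<sigma>)) (tabloids l)"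
proof
  show "finite (tabloids l)"
    unfolding tabloids_def by (rule finite_lists_length_eq) simp
  fix \<sigma> :: "nat \<Rightarrow> nat" and x assume "\<sigma> \<in> Sym (sum_list l)" "x \<in> tabloids l"
  then show "map ((`) \<sigma>) x \<in> tabloids l"
    using Sym_in[of \<sigma> "sum_list l"] by (fastforce simp: tabloids_def)
qed (auto simp: image_comp)

text \<open>The signed column sum, usually written \<open>\<kappa>\<^sub>t\<close>. It acts on
  functions on tabloids whose shape may differ from \<open>l\<close>, as the comparison of two
  Specht modules requires.\<close>

definition column_antisym :: "nat list \<Rightarrow> (nat \<times> nat \<Rightarrow> nat) \<Rightarrow> (nat set list \<Rightarrow> 'a::field) \<Rightarrow> nat set list \<Rightarrow> 'a"
  where "column_antisym l t v =
    (\<Sum>\<sigma>\<in>column_stabilizer l t. fscale (of_int (sign \<sigma>)) (tabloid_action \<sigma> v))"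

lemma tabloid_action_delta:
  "\<sigma> \<in> Sym n \<Longrightarrow> tabloid_action \<sigma> (delta x) = delta (map ((`) \<sigma>) x)"
proof -
  assume s: "\<sigma> \<in> Sym n"
  have "x = map ((`) \<sigma>) y \<longleftrightarrow> map ((`) (inv \<sigma>)) x = y" for x y
    using s by (auto simp: image_comp Sym_inv_simps o_def)
  then show ?thesis
    by (auto simp: tabloid_action_def perm_action_def delta_def fun_eq_iff)
qed

lemma polytabloid_eq: "polytabloid l t = column_antisym l t (delta (tabloid l t))"
  unfolding polytabloid_def column_antisym_def
  by (rule sum.cong) (simp_all add: tabloid_action_delta[OF column_stabilizer_Sym] tabloid_comp)

lemma column_antisym_linear [simp]:
  fixes u v :: "nat set list \<Rightarrow> 'a::field" and f :: "'i \<Rightarrow> nat set list \<Rightarrow> 'a"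
  shows "column_antisym l t (u + v) = column_antisym l t u + column_antisym l t v"
  "column_antisym l t (fscale c v) = fscale c (column_antisym l t v)"
  "column_antisym l t (\<Sum>i\<in>I. f i) = (\<Sum>i\<in>I. column_antisym l t (f i))"
  "column_antisym l t 0 = (0 :: nat set list \<Rightarrow> 'a)"
proof -
  have add: "column_antisym l t (u + v) = column_antisym l t u + column_antisym l t v" for u v :: "nat set list \<Rightarrow> 'a"
    by (simp add: column_antisym_def tabloid_action_def fs.scale_right_distrib sum.distrib)
  then show "column_antisym l t (u + v) = column_antisym l t u + column_antisym l t v" .
  show "column_antisym l t (fscale c v) = fscale c (column_antisym l t v)"
    by (simp add: column_antisym_def tabloid_action_def fs.scale_sum_right mult.commute)
  show z: "column_antisym l t 0 = (0 :: nat set list \<Rightarrow> 'a)"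
    by (simp add: column_antisym_def tabloid_action_def)
  show "column_antisym l t (\<Sum>i\<in>I. f i) = (\<Sum>i\<in>I. column_antisym l t (f i))"
    by (induction I rule: infinite_finite_induct)
       (simp_all only: sum.infinite sum.empty sum.insert add z not_False_eq_True)
qed

text \<open>Only the action laws are wanted, for \<open>Sym n\<close> with arbitrary
  \<open>n\<close>; the empty label set makes closure trivial.\<close>

lemma perm_set_image: "perm_set n (\<lambda>\<sigma>. map ((`) \<sigma>)) {}"
  by standard (auto simp: image_comp)

lemma tabloid_action_comp:
  "\<sigma> \<in> Sym n \<Longrightarrow> \<tau> \<in> Sym n \<Longrightarrow> tabloid_action (\<sigma> \<circ> \<tau>) v = tabloid_action \<sigma> (tabloid_action \<tau> v)"
  using perm_set.perm_action_comp[OF perm_set_image, of \<sigma> n \<tau> v] by (simp add: tabloid_action_def)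

lemma of_int_sign_square: "of_int (sign \<sigma>) * of_int (sign \<sigma>) = (1 :: 'a::ring_1)"
  by (simp flip: of_int_mult)

text \<open>Right multiplication by \<open>\<sigma>\<close> permutes the column stabilizer and
  multiplies every sign by that of \<open>\<sigma>\<close>, which is its own inverse and can change
  sides.\<close>

lemma column_antisym_absorb:
  assumes t: "tableau l t" and s: "\<sigma> \<in> column_stabilizer l t"
  shows "column_antisym l t (tabloid_action \<sigma> v) = fscale (of_int (sign \<sigma>)) (column_antisym l t v)"
proof -
  note grp = column_stabilizer_group[OF t] and sym = column_stabilizer_Sym
  have "column_antisym l t v = (\<Sum>\<tau>\<in>column_stabilizer l t.
      fscale (of_int (sign (\<tau> \<circ> \<sigma>))) (tabloid_action (\<tau> \<circ> \<sigma>) v))"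
    unfolding column_antisym_def
    by (rule sum.reindex_bij_witness[of _ "\<lambda>\<tau>. \<tau> \<circ> \<sigma>" "\<lambda>\<tau>. \<tau> \<circ> inv \<sigma>"])
       (use s grp in \<open>auto simp: o_assoc[symmetric] Sym_inv_simps[OF sym[OF s]]\<close>)
  also have "\<dots> = fscale (of_int (sign \<sigma>)) (column_antisym l t (tabloid_action \<sigma> v))"
    unfolding column_antisym_def fs.scale_sum_right
    by (rule sum.cong)
       (simp_all add: sign_Sym[OF sym sym[OF s]] tabloid_action_comp[OF sym sym[OF s]] mult.commute)
  finally have "fscale (of_int (sign \<sigma>)) (column_antisym l t v) =
      fscale (of_int (sign \<sigma>) * of_int (sign \<sigma>)) (column_antisym l t (tabloid_action \<sigma> v))"
    by simp
  then show ?thesis by (simp add: of_int_sign_square)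
qed

text \<open>The antisymmetrizer absorbs each of its own summands, so it is idempotent up to the
  order of the stabilizer.\<close>

lemma column_antisym_square:
  assumes t: "tableau l t"
  shows "column_antisym l t (column_antisym l t v) =
    fscale (of_nat (card (column_stabilizer l t))) (column_antisym l t v)"
proof -
  have "column_antisym l t (column_antisym l t v) = (\<Sum>\<sigma>\<in>column_stabilizer l t.
      fscale (of_int (sign \<sigma>)) (column_antisym l t (tabloid_action \<sigma> v)))"
    by (subst (2) column_antisym_def) simp
  also have "\<dots> = (\<Sum>\<sigma>\<in>column_stabilizer l t. column_antisym l t v)"
    by (rule sum.cong) (simp_all add: column_antisym_absorb[OF t] of_int_sign_square)
  finally show ?thesis
    by (simp add: fun_eq_iff sum_fun_apply)
qed

text \<open>The transposition of \<open>a\<close> and \<open>b\<close> lies in the column stabilizer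
  of \<open>t\<close> and fixes the tabloid of \<open>s\<close>, so the value equals its own
  negative, which forces 0 in characteristic zero.\<close>

lemma column_antisym_eq_0:
  fixes v :: "nat set list \<Rightarrow> 'a::field_char_0"
  assumes t: "tableau l t" and s: "tableau m s" and eq: "sum_list m = sum_list l"
    and a: "a \<in> {1..sum_list l}" "b \<in> {1..sum_list l}" "a \<noteq> b"
      "col_of l t a = col_of l t b" "row_of m s a = row_of m s b"
    and v: "v = delta (tabloid m s)"
  shows "column_antisym l t v = 0"
proof -
  let ?p = "transpose a b"
  have p: "?p \<in> Sym (sum_list l)"
    using a(1,2) by (simp add: Sym_def permutes_swap_id)
  then have C: "?p \<in> column_stabilizer l t"
    using a(4) by (auto simp: column_stabilizer_iff[OF t] transpose_def)
  have "tabloid m (?p \<circ> s) = tabloid m s"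
    using p eq a(5) cell_comp[OF s, of ?p] tableau_comp[OF s, of ?p]
    by (subst tabloid_eq_iff) (auto simp: s transpose_def)
  then have "tabloid_action ?p v = v"
    unfolding v by (simp add: tabloid_action_delta[OF p] flip: tabloid_comp)
  then have "column_antisym l t v = fscale (- 1) (column_antisym l t v)"
    using column_antisym_absorb[OF t C, of v] a(3) by (simp add: sign_swap_id)
  then have "column_antisym l t v x = - column_antisym l t v x" for x
    by (metis fscale_apply mult_minus1)
  then show ?thesis by (simp add: fun_eq_iff)
qed

text \<open>The statistic n(\<lambda>), the sum of the products i \<lambda>_i with rows counted from
  0. It strictly decreases when a shape grows in dominance order.\<close>

definition row_sum :: "nat list \<Rightarrow> nat"
  where "row_sum l = (\<Sum>c\<in>young l. fst c)"

lemma down_closed_nat_mem: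
  fixes A :: "nat set"
  assumes "finite A" "\<And>i j. i \<in> A \<Longrightarrow> j \<le> i \<Longrightarrow> j \<in> A" "r < card A"
  shows "r \<in> A"
proof (rule ccontr)
  assume "r \<notin> A"
  then have "A \<subseteq> {..<r}" using assms(2) by (meson lessThan_iff not_le subsetI)
  then have "card A \<le> r" using card_mono[of "{..<r}" A] by simp
  then show False using assms(3) by simp
qed

text \<open>Stated for any arrangement of entries in the cells, so that it applies both to the rows
  of a tableau and to columns that have been sorted.\<close>

lemma row_of_cells:
  assumes "bij_betw (\<lambda>x. (r x, c x)) A (young l)"
  shows "(\<Sum>x\<in>A. r x) = row_sum l"
    "card {x \<in> A. r x = i} = (if i < length l then l ! i else 0)"
proof -
  show "(\<Sum>x\<in>A. r x) = row_sum l"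
    unfolding row_sum_def using sum.reindex_bij_betw[OF assms, of fst] by simp
  have "{p \<in> young l. fst p = i} = (\<lambda>x. (r x, c x)) ` {x \<in> A. r x = i}"
    unfolding bij_betw_imp_surj_on[OF assms, symmetric] by auto
  then have "bij_betw (\<lambda>x. (r x, c x)) {x \<in> A. r x = i} {p \<in> young l. fst p = i}"
    using bij_betw_imp_inj_on[OF assms] by (auto simp: bij_betw_def intro: inj_on_subset)
  then have "card {x \<in> A. r x = i} = card {p \<in> young l. fst p = i}"
    by (rule bij_betw_same_card)
  also have "{p \<in> young l. fst p = i} = Pair i ` {j. i < length l \<and> j < l ! i}"
    by (auto simp: young_def)
  also have "card \<dots> = (if i < length l then l ! i else 0)"
    by (subst card_image) (auto simp: inj_on_def)
  finally show "card {x \<in> A. r x = i} = (if i < length l then l ! i else 0)" .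
qed

text \<open>If no two entries share a row of \<open>s\<close> and a column of \<open>t\<close>, then sorting each column of \<open>t\<close> by
  the rows of \<open>s\<close> puts every entry at most as low as \<open>s\<close> does; this bounds the row sums, and in case
  of equality the sorted tableau is the required column permutation of \<open>t\<close>.\<close>

lemma column_antisym_nonzero:
  assumes l: "sorted_wrt (\<ge>) l" "0 \<notin> set l" and m: "0 \<notin> set m"
    and t: "tableau l t" and s: "tableau m s" and eq: "sum_list m = sum_list l"
    and nz: "column_antisym l t (delta (tabloid m s) :: nat set list \<Rightarrow> 'a::field_char_0) \<noteq> 0"
  shows "row_sum l \<le> row_sum m"
    "row_sum m \<le> row_sum l \<Longrightarrow> l = m"
    "row_sum m \<le> row_sum l \<Longrightarrow> \<exists>\<pi>\<in>column_stabilizer l t. tabloid m s = tabloid l (\<pi> \<circ> t)"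
proof -
  let ?N = "{1..sum_list l}" and ?r = "row_of m s" and ?c = "col_of l t"
  have inj: "x = y" if "x \<in> ?N" "y \<in> ?N" "?c x = ?c y" "?r x = ?r y" for x y
    using column_antisym_eq_0[OF t s eq that(1,2) _ that(3,4) refl] nz by blast
  \<comment> \<open>The row of \<open>x\<close> after its column of \<open>t\<close> has been sorted
    by the rows of \<open>s\<close>.\<close>
  define \<rho> where "\<rho> x = card {y \<in> ?N. ?c y = ?c x \<and> ?r y < ?r x}" for x
  have \<rho>_young: "(\<rho> x, ?c x) \<in> young l" if x: "x \<in> ?N" for x
  proof -
    \<comment> \<open>The rows met by the column of \<open>x\<close>: an initial segment as long as
      the column, whose length the rank of \<open>x\<close> cannot reach.\<close>
    let ?A = "{i. (i, ?c x) \<in> young l}"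
    have "?A \<subseteq> {..<length l}" by (auto simp: young_def)
    then have fA: "finite ?A" using finite_subset by blast
    have "bij_betw (row_of l t) {y \<in> ?N. ?c y = ?c x} ?A"
    proof (rule bij_betw_imageI)
      show "inj_on (row_of l t) {y \<in> ?N. ?c y = ?c x}"
        using tableau_eqI[OF t] by (auto simp: inj_on_def)
      show "row_of l t ` {y \<in> ?N. ?c y = ?c x} = ?A"
      proof (intro equalityI subsetI)
        fix i assume "i \<in> ?A"
        then have i: "(i, ?c x) \<in> young l" by simp
        then have "t (i, ?c x) \<in> {y \<in> ?N. ?c y = ?c x}"
          using tableau_entry[OF t i] by simp
        then show "i \<in> row_of l t ` {y \<in> ?N. ?c y = ?c x}"
          by (intro image_eqI[of i "row_of l t" "t (i, ?c x)"] tableau_entry(1)[OF t i, symmetric])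
      next
        fix i assume "i \<in> row_of l t ` {y \<in> ?N. ?c y = ?c x}"
        then obtain y where "y \<in> ?N" "?c y = ?c x" "i = row_of l t y" by blast
        then show "i \<in> ?A"
          using tableau_cell(1)[OF t, of y] by simp
      qed
    qed
    then have "card {y \<in> ?N. ?c y = ?c x} = card ?A" by (rule bij_betw_same_card)
    moreover have "\<rho> x < card {y \<in> ?N. ?c y = ?c x}"
      unfolding \<rho>_def by (rule psubset_card_mono) (use x in auto)
    ultimately have "\<rho> x < card ?A" by linarith
    moreover have "j \<in> ?A" if "i \<in> ?A" "j \<le> i" for i j
      using young_down_closed[OF l(1), of i "?c x" j "?c x"] that by simp
    ultimately have "\<rho> x \<in> ?A"
      using down_closed_nat_mem[OF fA, of "\<rho> x"] by metis
    then show ?thesis by simp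
  qed
  have \<rho>_less: "\<rho> x < \<rho> y" if "x \<in> ?N" "y \<in> ?N" "?c x = ?c y" "?r x < ?r y" for x y
    unfolding \<rho>_def by (rule psubset_card_mono) (use that in auto)
  have \<rho>_inj: "inj_on (\<lambda>x. (\<rho> x, ?c x)) ?N"
  proof (rule inj_onI)
    fix x y assume xy: "x \<in> ?N" "y \<in> ?N" "(\<rho> x, ?c x) = (\<rho> y, ?c y)"
    then show "x = y"
      using \<rho>_less[of x y] \<rho>_less[of y x] inj[of x y] by (metis Pair_inject less_irrefl linorder_neqE_nat)
  qed
  have \<rho>_bij: "bij_betw (\<lambda>x. (\<rho> x, ?c x)) ?N (young l)"
    unfolding bij_betw_def
  proof
    show "(\<lambda>x. (\<rho> x, ?c x)) ` ?N = young l"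
      by (rule card_subset_eq) (use \<rho>_young card_image[OF \<rho>_inj] in \<open>auto simp: card_young\<close>)
  qed (fact \<rho>_inj)
  have s_bij: "bij_betw (\<lambda>x. (?r x, col_of m s x)) ?N (young m)"
    using bij_betw_cells[OF s] eq by simp
  have \<rho>_le: "\<rho> x \<le> ?r x" if "x \<in> ?N" for x
  proof -
    \<comment> \<open>The entries counted by the rank occupy distinct rows of \<open>s\<close> above
      that of \<open>x\<close>.\<close>
    have "inj_on ?r {y \<in> ?N. ?c y = ?c x \<and> ?r y < ?r x}"
      using inj by (auto simp: inj_on_def)
    then have "\<rho> x \<le> card {..<?r x}"
      unfolding \<rho>_def by (rule card_inj_on_le) auto
    then show ?thesis by simp
  qed
  show le: "row_sum l \<le> row_sum m"
    unfolding row_of_cells(1)[OF \<rho>_bij, symmetric] row_of_cells(1)[OF s_bij, symmetric]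
    by (rule sum_mono) (rule \<rho>_le)
  assume ge: "row_sum m \<le> row_sum l"
  \<comment> \<open>Termwise comparable families with equal sums agree termwise.\<close>
  have \<rho>_eq: "\<rho> x = ?r x" if "x \<in> ?N" for x
    by (rule sum_mono_inv[where I = ?N])
       (use le ge that \<rho>_le row_of_cells(1)[OF \<rho>_bij] row_of_cells(1)[OF s_bij] in auto)
  have len: "(if i < length l then l ! i else 0) = (if i < length m then m ! i else 0)" for i
    unfolding row_of_cells(2)[OF \<rho>_bij, symmetric] row_of_cells(2)[OF s_bij, symmetric]
    using \<rho>_eq by (intro arg_cong[of _ _ card]) auto
  have ll: "length l = length m"
  proof (rule ccontr)
    assume "length l \<noteq> length m"
    then consider "length l < length m" | "length m < length l" by linarith
    then show False
    proof cases
      case 1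
      then have "m ! length l \<in> set m" by (rule nth_mem)
      moreover have "m ! length l = 0" using 1 len[of "length l"] by simp
      ultimately show False using m by simp
    next
      case 2
      then have "l ! length m \<in> set l" by (rule nth_mem)
      moreover have "l ! length m = 0" using 2 len[of "length m"] by simp
      ultimately show False using l(2) by simp
    qed
  qed
  show lm: "l = m"
  proof (rule nth_equalityI[OF ll])
    show "l ! i = m ! i" if "i < length l" for i
      using len[of i] ll that by simp
  qed
  have bij: "bij_betw (\<lambda>x. (?r x, ?c x)) ?N (young l)"
    using \<rho>_bij bij_betw_cong[of ?N "\<lambda>x. (\<rho> x, ?c x)" "\<lambda>x. (?r x, ?c x)"] \<rho>_eq by auto
  \<comment> \<open>\<open>\<gamma>\<close> sends \<open>x\<close> to the entry of \<open>t\<close>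
    in the row that \<open>s\<close> gives to \<open>x\<close> and the column that \<open>t\<close>
    gives to \<open>x\<close>. The required permutation is its inverse, since the rows of
    \<open>inv \<gamma> \<circ> t\<close> are read through \<open>\<gamma>\<close>.\<close>
  define \<gamma> where "\<gamma> x = (if x \<in> ?N then t (?r x, ?c x) else x)" for x
  have "bij_betw (t \<circ> (\<lambda>x. (?r x, ?c x))) ?N ?N"
    using bij_betw_trans[OF bij] t by (simp add: tableau_def)
  then have "bij_betw \<gamma> ?N ?N"
    by (rule bij_betw_cong[THEN iffD1, rotated]) (simp add: \<gamma>_def)
  then have \<gamma>: "\<gamma> \<in> Sym (sum_list l)"
    unfolding Sym_def by (intro CollectI bij_imp_permutes) (auto simp: \<gamma>_def)
  have cell: "(?r x, ?c x) \<in> young l" if "x \<in> ?N" for x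
    using bij that by (auto simp: bij_betw_def)
  have "\<gamma> \<in> column_stabilizer l t"
    using \<gamma> tableau_entry(2)[OF t cell] by (auto simp: column_stabilizer_iff[OF t] \<gamma>_def)
  then have "inv \<gamma> \<in> column_stabilizer l t"
    by (rule column_stabilizer_group(3)[OF t])
  moreover have "tabloid m s = tabloid l (inv \<gamma> \<circ> t)"
  proof -
    have i: "inv \<gamma> \<in> Sym (sum_list l)" using \<gamma> by simp
    have "?r x = row_of l (inv \<gamma> \<circ> t) x" if x: "x \<in> ?N" for x
      using cell_comp(1)[OF t i x] tableau_entry(1)[OF t cell[OF x]] x
      by (simp add: Sym_inv_simps(3)[OF \<gamma>] \<gamma>_def)
    then show ?thesis
      using lm tabloid_eq_iff[of l s "inv \<gamma> \<circ> t"] s tableau_comp[OF t i] by simp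
  qed
  ultimately show "\<exists>\<pi>\<in>column_stabilizer l t. tabloid m s = tabloid l (\<pi> \<circ> t)" by blast
qed

text \<open>Conjugation by \<open>\<sigma>\<close> carries the column stabilizer of \<open>t\<close>
  onto that of \<open>\<sigma> \<circ> t\<close> and preserves signs.\<close>

lemma polytabloid_action:
  assumes t: "tableau l t" and s: "\<sigma> \<in> Sym (sum_list l)"
  shows "tabloid_action \<sigma> (polytabloid l t) = polytabloid l (\<sigma> \<circ> t)"
proof -
  let ?N = "{1..sum_list l}"
  note sym = column_stabilizer_Sym
  have t': "tableau l (\<sigma> \<circ> t)" by (rule tableau_comp[OF t s])
  have in_N: "\<tau> x \<in> ?N" if "\<tau> \<in> Sym (sum_list l)" "x \<in> ?N" for \<tau> x
    using Sym_in that by blast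
  have 1: "inv \<sigma> \<circ> \<tau> \<circ> \<sigma> \<in> column_stabilizer l t" if \<tau>: "\<tau> \<in> column_stabilizer l (\<sigma> \<circ> t)" for \<tau>
  proof -
    have "col_of l t (inv \<sigma> (\<tau> (\<sigma> x))) = col_of l t x" if x: "x \<in> ?N" for x
    proof -
      have "col_of l t (inv \<sigma> (\<tau> (\<sigma> x))) = col_of l (\<sigma> \<circ> t) (\<tau> (\<sigma> x))"
        by (rule cell_comp(2)[OF t s in_N[OF sym[OF \<tau>] in_N[OF s x]], symmetric])
      also have "\<dots> = col_of l (\<sigma> \<circ> t) (\<sigma> x)"
        using \<tau> in_N[OF s x] column_stabilizer_iff[OF t'] by blast
      also have "\<dots> = col_of l t x"
        using cell_comp(2)[OF t s in_N[OF s x]] by (simp add: Sym_inv_simps[OF s])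
      finally show ?thesis .
    qed
    then show ?thesis using s sym[OF \<tau>] by (simp add: column_stabilizer_iff[OF t])
  qed
  have 2: "\<sigma> \<circ> \<tau> \<circ> inv \<sigma> \<in> column_stabilizer l (\<sigma> \<circ> t)" if \<tau>: "\<tau> \<in> column_stabilizer l t" for \<tau>
  proof -
    have i: "inv \<sigma> \<in> Sym (sum_list l)" using s by simp
    have "col_of l (\<sigma> \<circ> t) (\<sigma> (\<tau> (inv \<sigma> x))) = col_of l (\<sigma> \<circ> t) x" if x: "x \<in> ?N" for x
    proof -
      have "col_of l (\<sigma> \<circ> t) (\<sigma> (\<tau> (inv \<sigma> x))) = col_of l t (inv \<sigma> (\<sigma> (\<tau> (inv \<sigma> x))))"
        by (rule cell_comp(2)[OF t s in_N[OF s in_N[OF sym[OF \<tau>] in_N[OF i x]]]])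
      also have "\<dots> = col_of l t (\<tau> (inv \<sigma> x))"
        by (simp add: Sym_inv_simps[OF s])
      also have "\<dots> = col_of l t (inv \<sigma> x)"
        using \<tau> in_N[OF i x] column_stabilizer_iff[OF t] by blast
      also have "\<dots> = col_of l (\<sigma> \<circ> t) x"
        by (rule cell_comp(2)[OF t s x, symmetric])
      finally show ?thesis .
    qed
    then show ?thesis using s sym[OF \<tau>] by (simp add: column_stabilizer_iff[OF t'])
  qed
  have "tabloid_action \<sigma> (polytabloid l t) = (\<Sum>\<tau>\<in>column_stabilizer l t.
      fscale (of_int (sign \<tau>)) (delta (tabloid l (\<sigma> \<circ> \<tau> \<circ> t))))"
    unfolding polytabloid_def tabloid_action_def perm_action_linear
    by (rule sum.cong) (simp_all add: tabloid_action_delta[OF s, unfolded tabloid_action_def]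
        tabloid_comp[symmetric] o_assoc)
  also have "\<dots> = (\<Sum>\<tau>\<in>column_stabilizer l (\<sigma> \<circ> t).
      fscale (of_int (sign \<tau>)) (delta (tabloid l (\<tau> \<circ> (\<sigma> \<circ> t)))))"
  proof (rule sum.reindex_bij_witness[of _ "\<lambda>\<tau>. inv \<sigma> \<circ> \<tau> \<circ> \<sigma>" "\<lambda>\<tau>. \<sigma> \<circ> \<tau> \<circ> inv \<sigma>"])
    fix \<tau> assume \<tau>: "\<tau> \<in> column_stabilizer l t"
    show "inv \<sigma> \<circ> (\<sigma> \<circ> \<tau> \<circ> inv \<sigma>) \<circ> \<sigma> = \<tau>"
      by (simp add: fun_eq_iff Sym_inv_simps[OF s])
    show "\<sigma> \<circ> \<tau> \<circ> inv \<sigma> \<in> column_stabilizer l (\<sigma> \<circ> t)" by (rule 2[OF \<tau>])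
    have "\<sigma> \<circ> \<tau> \<circ> inv \<sigma> \<circ> (\<sigma> \<circ> t) = \<sigma> \<circ> \<tau> \<circ> t"
      by (simp add: fun_eq_iff Sym_inv_simps[OF s])
    moreover have "sign (\<sigma> \<circ> \<tau> \<circ> inv \<sigma>) = sign \<tau>"
      using s sym[OF \<tau>] by (simp add: sign_Sym[of _ "sum_list l"])
    ultimately show "fscale (of_int (sign (\<sigma> \<circ> \<tau> \<circ> inv \<sigma>))) (delta (tabloid l (\<sigma> \<circ> \<tau> \<circ> inv \<sigma> \<circ> (\<sigma> \<circ> t)))) =
        fscale (of_int (sign \<tau>)) (delta (tabloid l (\<sigma> \<circ> \<tau> \<circ> t)))" by simp
  next
    fix \<tau> assume \<tau>: "\<tau> \<in> column_stabilizer l (\<sigma> \<circ> t)"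
    show "\<sigma> \<circ> (inv \<sigma> \<circ> \<tau> \<circ> \<sigma>) \<circ> inv \<sigma> = \<tau>"
      by (simp add: fun_eq_iff Sym_inv_simps[OF s])
    show "inv \<sigma> \<circ> \<tau> \<circ> \<sigma> \<in> column_stabilizer l t" by (rule 1[OF \<tau>])
  qed
  also have "\<dots> = polytabloid l (\<sigma> \<circ> t)" by (simp add: polytabloid_def)
  finally show ?thesis .
qed

text \<open>Tableaux are unconstrained off their shape, so agreement on the cells does not make them
  equal as functions.\<close>

lemma polytabloid_cong:
  assumes "\<And>c. c \<in> young l \<Longrightarrow> s c = t c"
  shows "polytabloid l s = polytabloid l t"
proof -
  have "tabloid l (\<sigma> \<circ> s) = tabloid l (\<sigma> \<circ> t)" for \<sigma>
    unfolding tabloid_def using assms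
    by (intro map_cong refl Collect_cong iff_exI) (auto simp: young_def)
  moreover have "{s (i, j) |i. (i, j) \<in> young l} = {t (i, j) |i. (i, j) \<in> young l}" for j
    by (intro Collect_cong iff_exI) (use assms in auto)
  then have "column_stabilizer l s = column_stabilizer l t"
    by (simp add: column_stabilizer_def)
  ultimately show ?thesis by (simp add: polytabloid_def)
qed

text \<open>All polytabloids of a shape are translates of a single one, which therefore generates
  the Specht module. The conclusion speaks of polytabloids because \<open>s\<close> and
  \<open>\<sigma> \<circ> t\<close> are compared on the cells only.\<close>

lemma tableau_transitive:
  assumes "tableau l s" "tableau l t"
  obtains \<sigma> where "\<sigma> \<in> Sym (sum_list l)" "polytabloid l s = polytabloid l (\<sigma> \<circ> t)"
proof -
  let ?N = "{1..sum_list l}"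
  define \<sigma> where "\<sigma> x = (if x \<in> ?N then s (inv_into (young l) t x) else x)" for x
  have "bij_betw (s \<circ> inv_into (young l) t) ?N ?N"
    using assms unfolding tableau_def by (blast intro: bij_betw_trans bij_betw_inv_into)
  then have "bij_betw \<sigma> ?N ?N"
    by (rule bij_betw_cong[THEN iffD1, rotated]) (simp add: \<sigma>_def)
  then have s: "\<sigma> \<in> Sym (sum_list l)"
    unfolding Sym_def by (intro CollectI bij_imp_permutes) (auto simp: \<sigma>_def)
  have "s c = (\<sigma> \<circ> t) c" if c: "c \<in> young l" for c
  proof -
    have "t c \<in> ?N" using tableau_entry(3)[OF assms(2), of "fst c" "snd c"] c by simp
    moreover have "inv_into (young l) t (t c) = c"
      using c assms(2) by (simp add: tableau_def bij_betw_def)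
    ultimately show ?thesis by (simp add: \<sigma>_def)
  qed
  then have "polytabloid l s = polytabloid l (\<sigma> \<circ> t)" by (rule polytabloid_cong)
  with s show ?thesis by (rule that)
qed

section \<open>Specht modules as cyclic modules\<close>

lemma tableau_exists: "\<exists>t. tableau l t"
  unfolding tableau_def by (rule finite_same_card_bij) (simp_all add: card_young)

lemma polytabloid_in_specht: "tableau l t \<Longrightarrow> polytabloid l t \<in> specht l"
  unfolding specht_def by (rule fs.span_base) auto

lemma tabloid_comp_in: "tableau l t \<Longrightarrow> \<sigma> \<in> column_stabilizer l t \<Longrightarrow> tabloid l (\<sigma> \<circ> t) \<in> tabloids l"
  by (intro tabloid_in_tabloids tableau_comp column_stabilizer_Sym)

lemma specht_subset: "specht l \<subseteq> supported (tabloids l)"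
  unfolding specht_def
proof (rule fs.span_minimal)
  show "{polytabloid l t |t. tableau l t} \<subseteq> supported (tabloids l)"
    by (auto simp: polytabloid_def tabloid_comp_in intro!: fs.subspace_sum fs.subspace_scale)
qed simp

lemma specht_induct [consumes 1, case_names base step]:
  assumes "v \<in> specht l" "P 0"
    "\<And>c t v. tableau l t \<Longrightarrow> v \<in> specht l \<Longrightarrow> P v \<Longrightarrow> P (fscale c (polytabloid l t) + v)"
  shows "P v"
proof -
  have "v \<in> fs.span {polytabloid l t |t. tableau l t}" using assms(1) by (simp add: specht_def)
  then have "v \<in> specht l \<and> P v"
  proof (induction rule: fs.span_induct_alt)
    case base
    then show ?case using assms(2) fs.span_zero by (auto simp: specht_def simp del: zero_fun_apply)
  next
    case (step c x y)
    then obtain t where t: "tableau l t" "x = polytabloid l t" by auto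
    have "x \<in> specht l"
      unfolding specht_def t(2) by (rule fs.span_base) (use t(1) in auto)
    then have "fscale c x + y \<in> specht l"
      using step unfolding specht_def by (intro fs.span_add fs.span_scale) auto
    moreover have "P (fscale c x + y)"
      unfolding t(2) by (rule assms(3)) (use t step in auto)
    ultimately show ?case by (rule conjI)
  qed
  then show ?thesis by simp
qed

lemma specht_module: "is_module (Sym (sum_list l)) tabloid_action (specht l)"
  unfolding is_module_def
proof (intro conjI ballI)
  show s: "fs.subspace (specht l)" by (simp add: specht_def)
  fix \<sigma> and v :: "nat set list \<Rightarrow> 'a" assume \<sigma>: "\<sigma> \<in> Sym (sum_list l)" and "v \<in> specht l"
  from this(2) show "tabloid_action \<sigma> v \<in> specht l"
  proof (induction rule: specht_induct)
    case base
    then show ?case using fs.subspace_0[OF s] by (simp add: tabloid_action_def del: zero_fun_apply)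
  next
    case (step c t v)
    have eq: "tabloid_action \<sigma> (fscale c (polytabloid l t) + v) =
        fscale c (polytabloid l (\<sigma> \<circ> t)) + tabloid_action \<sigma> v"
      by (simp add: tabloid_action_def polytabloid_action[OF step(1) \<sigma>, unfolded tabloid_action_def])
    have "tabloid_action \<sigma> (fscale c (polytabloid l t) + v) \<in> specht l"
      unfolding eq
      by (intro fs.subspace_add[OF s] fs.subspace_scale[OF s] step polytabloid_in_specht
          tableau_comp[OF step(1) \<sigma>])
    then show ?case .
  qed
qed

text \<open>A column permutation that fixes the tabloid preserves row and column of every entry, so
  it is the identity and a single summand contributes.\<close>

lemma polytabloid_diagonal:
  assumes t: "tableau l t"
  shows "polytabloid l t (tabloid l t) = (1 :: 'a::field)"
proof -
  have "tabloid l t = tabloid l (\<sigma> \<circ> t) \<longleftrightarrow> \<sigma> = id" if s: "\<sigma> \<in> column_stabilizer l t" for \<sigma>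
  proof
    note S = column_stabilizer_Sym[OF s]
    assume eq: "tabloid l t = tabloid l (\<sigma> \<circ> t)"
    have *: "row_of l (\<sigma> \<circ> t) x = row_of l t x" if "x \<in> {1..sum_list l}" for x
      using that eq[symmetric] tabloid_eq_iff[OF tableau_comp[OF t S] t] by blast
    have "inv \<sigma> x = x" if x: "x \<in> {1..sum_list l}" for x
    proof (rule tableau_eqI[OF t])
      show "inv \<sigma> x \<in> {1..sum_list l}" using Sym_in[of "inv \<sigma>"] S x by simp
      show "row_of l t (inv \<sigma> x) = row_of l t x"
        using *[OF x] cell_comp(1)[OF t S x] by simp
      show "col_of l t (inv \<sigma> x) = col_of l t x"
        using column_stabilizer_group(3)[OF t s] x column_stabilizer_iff[OF t] by blast
    qed (fact x)
    then have "\<sigma> x = x" if "x \<in> {1..sum_list l}" for x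
      using that Sym_inv_simps(5)[OF S] by metis
    then show "\<sigma> = id"
      using S by (auto simp: Sym_def permutes_def fun_eq_iff)
  qed simp
  then have "polytabloid l t (tabloid l t) = (\<Sum>\<sigma>\<in>column_stabilizer l t. if \<sigma> = id then 1 else 0 :: 'a)"
    unfolding polytabloid_def sum_fun_apply
    by (intro sum.cong refl) (auto simp: delta_def)
  also have "\<dots> = 1"
    using column_stabilizer_group(1)[OF t] by simp
  finally show ?thesis .
qed

lemma column_antisym_polytabloid:
  assumes t: "tableau l t"
  shows "column_antisym l t (polytabloid l t) = fscale (of_nat (card (column_stabilizer l t))) (polytabloid l t)"
  unfolding polytabloid_eq by (rule column_antisym_square[OF t])

lemma card_column_stabilizer: "tableau l t \<Longrightarrow> card (column_stabilizer l t) \<noteq> 0"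
  using column_stabilizer_group(1) by (auto simp: card_eq_0_iff)

text \<open>A tabloid of shape \<open>l\<close> is either killed by the antisymmetrizer or is a
  column rearrangement of the tabloid of \<open>t\<close>; in the latter case absorption gives plus
  or minus the polytabloid.\<close>

lemma column_antisym_specht:
  fixes v :: "nat set list \<Rightarrow> 'a::field_char_0"
  assumes l: "sorted_wrt (\<ge>) l" "0 \<notin> set l" and t: "tableau l t" and v: "v \<in> specht l"
  shows "\<exists>c. column_antisym l t v = fscale c (polytabloid l t)"
proof -
  have *: "\<exists>c. column_antisym l t (delta (tabloid l s)) = fscale c (polytabloid l t :: nat set list \<Rightarrow> 'a)"
    if s: "tableau l s" for s
  proof (cases "column_antisym l t (delta (tabloid l s) :: nat set list \<Rightarrow> 'a) = 0")
    case True
    then show ?thesis by (intro exI[of _ 0]) simp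
  next
    case False
    obtain \<pi> where \<pi>: "\<pi> \<in> column_stabilizer l t" "tabloid l s = tabloid l (\<pi> \<circ> t)"
      using column_antisym_nonzero(3)[OF l l(2) t s refl False] by auto
    have "delta (tabloid l s) = (tabloid_action \<pi> (delta (tabloid l t)) :: nat set list \<Rightarrow> 'a)"
      using \<pi> by (simp add: tabloid_action_delta[OF column_stabilizer_Sym] tabloid_comp)
    then have "column_antisym l t (delta (tabloid l s)) =
        fscale (of_int (sign \<pi>)) (polytabloid l t :: nat set list \<Rightarrow> 'a)"
      by (simp only: column_antisym_absorb[OF t \<pi>(1)] polytabloid_eq)
    then show ?thesis by (rule exI)
  qed
  have add: "\<exists>c. u + w = fscale c e" if "\<exists>c. u = fscale c e" "\<exists>c. w = fscale c e" for u w e :: "nat set list \<Rightarrow> 'a"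
    using that fs.scale_left_distrib by metis
  have sum: "\<exists>c. (\<Sum>i\<in>I. f i) = fscale c e" if "\<And>i. i \<in> I \<Longrightarrow> \<exists>c. f i = fscale c e"
    for I and f :: "(nat \<Rightarrow> nat) \<Rightarrow> nat set list \<Rightarrow> 'a" and e
    using that
  proof (induction I rule: infinite_finite_induct)
    case (insert i I)
    have "\<exists>c. f i + (\<Sum>i\<in>I. f i) = fscale c e"
      by (rule add) (use insert in blast)+
    then show ?case by (simp only: sum.insert[OF insert(1,2)])
  qed (auto intro!: exI[of _ 0])
  have scale: "\<exists>c. fscale d u = fscale c e" if "\<exists>c. u = fscale c e" for u e :: "nat set list \<Rightarrow> 'a" and d
    using that fs.scale_scale by metis
  from v show ?thesis
  proof (induction rule: specht_induct)
    case base
    show ?case by (intro exI[of _ 0]) (simp del: zero_fun_apply)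
  next
    case (step c s v)
    have "\<exists>c. column_antisym l t (polytabloid l s) = fscale c (polytabloid l t :: nat set list \<Rightarrow> 'a)"
      unfolding polytabloid_def[of l s] column_antisym_linear
      by (intro sum scale * tableau_comp step(1) column_stabilizer_Sym)
    then show ?case
      unfolding column_antisym_linear by (intro add scale step)
  qed
qed

section \<open>Maps between Specht modules\<close>

lemma Hom_column_antisym:
  assumes V: "is_module (Sym (sum_list l)) tabloid_action V" and v: "v \<in> V"
    and T: "lin_on fscale fscale V T"
      "\<And>\<sigma> v. \<sigma> \<in> Sym (sum_list l) \<Longrightarrow> v \<in> V \<Longrightarrow> T (tabloid_action \<sigma> v) = tabloid_action \<sigma> (T v)"
  shows "T (column_antisym l t v) = column_antisym l t (T v)"
proof -
  have "T (column_antisym l t v) = (\<Sum>\<sigma>\<in>column_stabilizer l t.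
      fscale (of_int (sign \<sigma>)) (T (tabloid_action \<sigma> v)))"
    unfolding column_antisym_def
    by (rule ff.lin_on_sum[OF is_moduleD(1)[OF V] T(1)])
       (intro is_moduleD(2)[OF V] column_stabilizer_Sym v)
  also have "\<dots> = column_antisym l t (T v)"
    unfolding column_antisym_def by (rule sum.cong) (simp_all add: T(2)[OF column_stabilizer_Sym v])
  finally show ?thesis .
qed

text \<open>A polytabloid is up to a nonzero factor its own antisymmetrization. As \<open>T\<close>
  commutes with the antisymmetrizer, it sends the polytabloid to a multiple of itself, and
  translation spreads the scalar over the module.\<close>

lemma specht_endomorphism:
  fixes T :: "(nat set list \<Rightarrow> 'a::field_char_0) \<Rightarrow> nat set list \<Rightarrow> 'a"
  assumes l: "sorted_wrt (\<ge>) l" "0 \<notin> set l"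
    and T: "\<And>v. v \<in> specht l \<Longrightarrow> T v \<in> specht l" "lin_on fscale fscale (specht l) T"
      "\<And>\<sigma> v. \<sigma> \<in> Sym (sum_list l) \<Longrightarrow> v \<in> specht l \<Longrightarrow> T (tabloid_action \<sigma> v) = tabloid_action \<sigma> (T v)"
  shows "\<exists>c. \<forall>v\<in>specht l. T v = fscale c v"
proof -
  obtain t where t: "tableau l t" using tableau_exists by auto
  let ?e = "polytabloid l t :: nat set list \<Rightarrow> 'a" and ?c = "of_nat (card (column_stabilizer l t)) :: 'a"
  have c: "?c \<noteq> 0" using card_column_stabilizer[OF t] by simp
  note e = polytabloid_in_specht[OF t]
  obtain a where a: "column_antisym l t (T ?e) = fscale a ?e"
    using column_antisym_specht[OF l t T(1)[OF e]] by auto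
  have "fscale ?c (T ?e) = T (column_antisym l t ?e)"
    using lin_onD(2)[OF T(2) e] by (simp add: column_antisym_polytabloid[OF t])
  also have "\<dots> = fscale a ?e"
    using Hom_column_antisym[OF specht_module e T(2,3)] a by simp
  finally have "fscale (1 / ?c) (fscale ?c (T ?e)) = fscale (1 / ?c) (fscale a ?e)" by simp
  then have Te: "T ?e = fscale (a / ?c) ?e" using c by simp
  have "T v = fscale (a / ?c) v" if "v \<in> specht l" for v
    using that
  proof (induction rule: specht_induct)
    case base
    show ?case
      using ff.lin_on_zero[OF is_moduleD(1)[OF specht_module] T(2)] by (simp del: zero_fun_apply)
  next
    case (step b s v)
    obtain \<sigma> where \<sigma>: "\<sigma> \<in> Sym (sum_list l)"
      "polytabloid l s = (polytabloid l (\<sigma> \<circ> t) :: nat set list \<Rightarrow> 'a)"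
      using tableau_transitive[OF step(1) t] by metis
    have s: "polytabloid l s = tabloid_action \<sigma> ?e"
      unfolding \<sigma>(2) by (rule polytabloid_action[OF t \<sigma>(1), symmetric])
    have "T (polytabloid l s) = tabloid_action \<sigma> (T ?e)"
      unfolding s by (rule T(3)[OF \<sigma>(1) e])
    also have "\<dots> = fscale (a / ?c) (polytabloid l s)"
      unfolding s Te by (simp only: tabloid_action_def perm_action_linear)
    finally have 1: "T (polytabloid l s) = fscale (a / ?c) (polytabloid l s)" .
    have "T (fscale b (polytabloid l s) + v) = fscale b (T (polytabloid l s)) + T v"
      using lin_onD[OF T(2)] polytabloid_in_specht[OF step(1)] step(2) is_moduleD(5)[OF specht_module] by metis
    then show ?case
      unfolding 1 step(3) by (simp add: fs.scale_right_distrib mult.commute del: plus_fun_apply)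
  qed
  then show ?thesis by blast
qed

lemma specht_Hom_scalar:
  assumes "sorted_wrt (\<ge>) l" "0 \<notin> set l"
    and T: "T \<in> Hom_mod (Sym (sum_list l)) tabloid_action (specht l :: (nat set list \<Rightarrow> 'a::field_char_0) set)
      tabloid_action (specht l)"
  shows "\<exists>c. \<forall>v\<in>specht l. T v = fscale c v"
  by (rule specht_endomorphism[OF assms(1,2) Hom_modD(1-3)[OF T]])

text \<open>Complete reducibility turns the scalar endomorphisms into irreducibility: a projection onto
  a submodule is a scalar.\<close>

lemma specht_irreducible:
  assumes l: "sorted_wrt (\<ge>) l" "0 \<notin> set l"
  shows "irreducible_mod (Sym (sum_list l)) tabloid_action (specht l :: (nat set list \<Rightarrow> 'a::field_char_0) set)"
  unfolding irreducible_mod_def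
proof (intro conjI allI impI)
  show "is_module (Sym (sum_list l)) tabloid_action (specht l :: (nat set list \<Rightarrow> 'a) set)"
    by (rule specht_module)
  obtain t where t: "tableau l t" using tableau_exists by auto
  show "specht l \<noteq> {0 :: nat set list \<Rightarrow> 'a}"
    using polytabloid_in_specht[OF t, where ?'a = 'a] polytabloid_diagonal[OF t, where ?'a = 'a]
    by (metis singletonD zero_fun_apply zero_neq_one)
  fix U :: "(nat set list \<Rightarrow> 'a) set"
  assume U: "U \<subseteq> specht l" "is_module (Sym (sum_list l)) tabloid_action U"
  interpret perm_set "sum_list l" "\<lambda>\<sigma>. map ((`) \<sigma>)" "tabloids l"
    by (rule perm_set_tabloids)
  obtain p where p: "lin_on fscale fscale UNIV p" "\<And>v. p v \<in> U" "\<And>v. v \<in> U \<Longrightarrow> p v = v"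
    "\<And>\<sigma> v. \<sigma> \<in> Sym (sum_list l) \<Longrightarrow> p (tabloid_action \<sigma> v) = tabloid_action \<sigma> (p v)"
    by (rule maschke[OF U(2)[unfolded tabloid_action_def], folded tabloid_action_def]) (rule that; assumption)
  have "\<exists>c. \<forall>v\<in>specht l. p v = fscale c v"
    using p U(1) by (intro specht_endomorphism[OF l]) (auto intro: lin_on_subset)
  then obtain c where c: "\<And>v. v \<in> specht l \<Longrightarrow> p v = fscale c v" by auto
  show "U = {0} \<or> U = specht l"
  proof (cases "c = 0")
    case True
    then have "U \<subseteq> {0}" using c p(3) U(1) by fastforce
    then show ?thesis using is_moduleD(3)[OF U(2)] by auto
  next
    case False
    have "v \<in> U" if "v \<in> specht l" for v
    proof -
      have "fscale (1 / c) (p v) \<in> U" by (rule is_moduleD(5)[OF U(2) p(2)])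
      then show ?thesis using c[OF that] False by simp
    qed
    then show ?thesis using U(1) by auto
  qed
qed

text \<open>A nonzero map does not kill every polytabloid. Antisymmetrizing the image of a surviving
  one shows that some tabloid of shape \<open>m\<close> is not annihilated by the column
  antisymmetrizer of a tableau of shape \<open>l\<close>.\<close>

lemma specht_Hom_row_sum:
  fixes T :: "(nat set list \<Rightarrow> 'a::field_char_0) \<Rightarrow> nat set list \<Rightarrow> 'a"
  assumes l: "sorted_wrt (\<ge>) l" "0 \<notin> set l" and m: "0 \<notin> set m" and eq: "sum_list m = sum_list l"
    and T: "T \<in> Hom_mod (Sym (sum_list l)) tabloid_action (specht l) tabloid_action (specht m)"
    and nz: "\<exists>v\<in>specht l. T v \<noteq> 0"
  shows "row_sum l \<le> row_sum m" "row_sum m \<le> row_sum l \<Longrightarrow> l = m"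
proof -
  note TD = Hom_modD[OF T]
  have "\<exists>t. tableau l t \<and> T (polytabloid l t) \<noteq> 0"
  proof (rule ccontr)
    assume *: "\<not> ?thesis"
    have "T v = 0" if "v \<in> specht l" for v
      using that
    proof (induction rule: specht_induct)
      case base
      show ?case by (rule Hom_mod_zero[OF specht_module T])
    next
      case (step c t v)
      have "T (fscale c (polytabloid l t) + v) = fscale c (T (polytabloid l t)) + T v"
        using lin_onD[OF TD(2)] polytabloid_in_specht[OF step(1)] step(2) is_moduleD(5)[OF specht_module] by metis
      then show ?case using * step by (simp del: zero_fun_apply plus_fun_apply)
    qed
    then show False using nz by blast
  qed
  then obtain t where t: "tableau l t" and Tt: "T (polytabloid l t) \<noteq> 0" by auto
  note e = polytabloid_in_specht[OF t]
  have "column_antisym l t (T (polytabloid l t)) = T (column_antisym l t (polytabloid l t))"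
    by (rule Hom_column_antisym[OF specht_module e TD(2,3), symmetric])
  also have "\<dots> = fscale (of_nat (card (column_stabilizer l t))) (T (polytabloid l t))"
    using lin_onD(2)[OF TD(2) e] by (simp add: column_antisym_polytabloid[OF t])
  finally have nz': "column_antisym l t (T (polytabloid l t)) \<noteq> 0"
    using Tt card_column_stabilizer[OF t] by simp
  have "\<exists>s. tableau m s \<and> column_antisym l t (delta (tabloid m s)) \<noteq> (0 :: nat set list \<Rightarrow> 'a)"
  proof (rule ccontr)
    assume *: "\<not> ?thesis"
    have "column_antisym l t v = 0" if "v \<in> specht m" for v :: "nat set list \<Rightarrow> 'a"
      using that
    proof (induction rule: specht_induct)
      case (step c s v)
      have "column_antisym l t (polytabloid m s) = (0 :: nat set list \<Rightarrow> 'a)"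
        unfolding polytabloid_def column_antisym_linear
        by (intro sum.neutral ballI) (use * tableau_comp[OF step(1) column_stabilizer_Sym] in simp)
      then show ?case using step by (simp del: zero_fun_apply plus_fun_apply)
    qed (simp del: zero_fun_apply)
    then show False using nz' TD(1)[OF e] by blast
  qed
  then obtain s where s: "tableau m s" "column_antisym l t (delta (tabloid m s)) \<noteq> (0 :: nat set list \<Rightarrow> 'a)"
    by auto
  show "row_sum l \<le> row_sum m" "row_sum m \<le> row_sum l \<Longrightarrow> l = m"
    by (rule column_antisym_nonzero(1,2)[OF l m t s(1) eq s(2)]; assumption)+
qed

text \<open>The comparison of row sums applies to the isomorphism and to its inverse, and equal row
  sums force equal shapes.\<close>

lemma specht_iso_imp_eq:
  assumes l: "sorted_wrt (\<ge>) l" "0 \<notin> set l" and m: "sorted_wrt (\<ge>) m" "0 \<notin> set m"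
    and eq: "sum_list m = sum_list l"
    and iso: "iso_mod (Sym (sum_list l)) tabloid_action (specht l :: (nat set list \<Rightarrow> 'a::field_char_0) set)
      tabloid_action (specht m)"
  shows "l = m"
proof -
  obtain T where T: "T \<in> Hom_mod (Sym (sum_list l)) tabloid_action (specht l :: (nat set list \<Rightarrow> 'a) set)
      tabloid_action (specht m)" and bij: "bij_betw T (specht l) (specht m)"
    using iso by (auto simp: iso_mod_def)
  have ne: "\<exists>v\<in>V. R v \<noteq> 0"
    if V: "is_module G \<rho> V" "V \<noteq> {0}" and R: "R \<in> Hom_mod G \<rho> V \<tau> W" "inj_on R V"
    for G \<rho> V \<tau> W and R :: "(nat set list \<Rightarrow> 'a) \<Rightarrow> nat set list \<Rightarrow> 'a"
  proof -
    obtain v where v: "v \<in> V" "v \<noteq> 0" using V(2) is_moduleD(3)[OF V(1)] by blast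
    have "R v \<noteq> R 0"
      using inj_onD[OF R(2) _ v(1) is_moduleD(3)[OF V(1)]] v(2) by blast
    then show ?thesis
      using v(1) by (auto simp: Hom_mod_zero[OF V(1) R(1)])
  qed
  let ?R = "\<lambda>w. if w \<in> specht m then inv_into (specht l) T w else 0"
  have mm: "is_module (Sym (sum_list l)) tabloid_action (specht m :: (nat set list \<Rightarrow> 'a) set)"
    using specht_module[of m] eq by simp
  have R: "?R \<in> Hom_mod (Sym (sum_list m)) tabloid_action (specht m) tabloid_action (specht l)"
    using Hom_mod_inverse[OF specht_module mm T bij] eq by simp
  have "inj_on (inv_into (specht l) T) (specht m)"
    using bij_betw_inv_into[OF bij] by (simp add: bij_betw_def)
  then have injR: "inj_on ?R (specht m)"
    by (simp add: inj_on_def)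
  have "row_sum m \<le> row_sum l"
    by (rule specht_Hom_row_sum(1)[OF m l(2) eq[symmetric] R ne[OF specht_module _ R injR]])
       (rule irreducible_modD(2)[OF specht_irreducible[OF m]])
  then show ?thesis
    by (rule specht_Hom_row_sum(2)[OF l m(2) eq T ne[OF specht_module _ T bij_betw_imp_inj_on[OF bij]], rotated])
       (rule irreducible_modD(2)[OF specht_irreducible[OF l]])
qed

section \<open>Homomorphisms from standard tableaux\<close>

definition column_strict :: "nat list \<Rightarrow> (nat \<times> nat \<Rightarrow> nat) \<Rightarrow> bool"
  where "column_strict l t \<longleftrightarrow>
    (\<forall>i i' j. (i, j) \<in> young l \<longrightarrow> (i', j) \<in> young l \<longrightarrow> i < i' \<longrightarrow> t (i, j) < t (i', j))"

definition row_strict :: "nat list \<Rightarrow> (nat \<times> nat \<Rightarrow> nat) \<Rightarrow> bool"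
  where "row_strict l t \<longleftrightarrow>
    (\<forall>i j j'. (i, j) \<in> young l \<longrightarrow> (i, j') \<in> young l \<longrightarrow> j < j' \<longrightarrow> t (i, j) < t (i, j'))"

text \<open>Comparing keys amounts to comparing the rows of the largest entry placed differently.\<close>

definition tableau_key :: "nat list \<Rightarrow> (nat \<times> nat \<Rightarrow> nat) \<Rightarrow> nat"
  where "tableau_key l t = (\<Sum>x\<in>{1..sum_list l}. row_of l t x * Suc (length l) ^ x)"

lemma digits_less:
  fixes r :: "nat \<Rightarrow> nat"
  assumes "\<And>i. i \<in> {1..<x} \<Longrightarrow> r i < B" "0 < B"
  shows "(\<Sum>i\<in>{1..<x}. r i * B ^ i) < B ^ x"
  using assms(1)
proof (induction x)
  case (Suc x)
  show ?case
  proof (cases "x = 0")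
    case False
    have "(\<Sum>i\<in>{1..<Suc x}. r i * B ^ i) = (\<Sum>i\<in>{1..<x}. r i * B ^ i) + r x * B ^ x"
      using False by (subst sum.atLeastLessThan_Suc) auto
    also have "\<dots> < B ^ x + r x * B ^ x"
      using Suc by simp
    also have "\<dots> = Suc (r x) * B ^ x" by simp
    also have "\<dots> \<le> B * B ^ x"
      using Suc.prems[of x] False by (intro mult_right_mono) auto
    finally show ?thesis by simp
  qed (use assms(2) in simp)
qed simp

text \<open>Positional notation in base \<open>B\<close>: the highest differing digit
  decides.\<close>

lemma digits_compare:
  fixes r r' :: "nat \<Rightarrow> nat"
  assumes r: "\<And>i. i \<in> {1..n} \<Longrightarrow> r i < B" and x: "x \<in> {1..n}" "r x < r' x"
    and eq: "\<And>z. z \<in> {1..n} \<Longrightarrow> x < z \<Longrightarrow> r z = r' z"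
  shows "(\<Sum>i\<in>{1..n}. r i * B ^ i) < (\<Sum>i\<in>{1..n}. r' i * B ^ i)"
proof -
  have split: "(\<Sum>i\<in>{1..n}. f i) = (\<Sum>i\<in>{1..<x}. f i) + f x + (\<Sum>i\<in>{Suc x..n}. f i)" for f :: "nat \<Rightarrow> nat"
  proof -
    have "{1..n} = ({1..<x} \<union> {x}) \<union> {Suc x..n}" using x(1) by auto
    then have "(\<Sum>i\<in>{1..n}. f i) = (\<Sum>i\<in>({1..<x} \<union> {x}) \<union> {Suc x..n}. f i)" by simp
    also have "\<dots> = (\<Sum>i\<in>{1..<x}. f i) + f x + (\<Sum>i\<in>{Suc x..n}. f i)"
      by (subst sum.union_disjoint) (auto simp: sum.union_disjoint)
    finally show ?thesis .
  qed
  have "0 < B" using r[OF x(1)] by simp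
  then have "(\<Sum>i\<in>{1..<x}. r i * B ^ i) < B ^ x"
    using r x(1) by (intro digits_less) auto
  then have "(\<Sum>i\<in>{1..<x}. r i * B ^ i) + r x * B ^ x < Suc (r x) * B ^ x" by simp
  also have "\<dots> \<le> r' x * B ^ x" using x(2) by (intro mult_right_mono) auto
  finally have "(\<Sum>i\<in>{1..<x}. r i * B ^ i) + r x * B ^ x < (\<Sum>i\<in>{1..<x}. r' i * B ^ i) + r' x * B ^ x"
    by simp
  moreover have "(\<Sum>i\<in>{Suc x..n}. r i * B ^ i) = (\<Sum>i\<in>{Suc x..n}. r' i * B ^ i)"
    using x(1) by (intro sum.cong) (auto simp: eq)
  ultimately show ?thesis unfolding split by simp
qed

text \<open>The tabloid arises from a column permutation of \<open>t\<close>. The largest entry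
  moved takes the row of a smaller entry of its column, hence a higher row by column strictness, and
  all larger entries stay in place.\<close>

lemma polytabloid_triangular:
  assumes t: "tableau l t" "column_strict l t" and s: "tableau l s"
    and nz: "polytabloid l t (tabloid l s) \<noteq> (0 :: 'a::field)"
  shows "tabloid l s = tabloid l t \<or> tableau_key l s < tableau_key l t"
proof -
  have "\<exists>\<pi>\<in>column_stabilizer l t. tabloid l s = tabloid l (\<pi> \<circ> t)"
  proof (rule ccontr)
    assume "\<not> ?thesis"
    then have "polytabloid l t (tabloid l s) = (0 :: 'a)"
      unfolding polytabloid_def sum_fun_apply by (intro sum.neutral) (auto simp: delta_def)
    then show False using nz by simp
  qed
  then obtain \<pi> where \<pi>: "\<pi> \<in> column_stabilizer l t" and eq: "tabloid l s = tabloid l (\<pi> \<circ> t)" by auto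
  let ?N = "{1..sum_list l}"
  note S = column_stabilizer_Sym[OF \<pi>]
  have row: "row_of l s x = row_of l t (inv \<pi> x)" if x: "x \<in> ?N" for x
    using eq x tabloid_eq_iff[OF s tableau_comp[OF t(1) S]] cell_comp(1)[OF t(1) S x] by simp
  define M where "M = {x \<in> ?N. inv \<pi> x \<noteq> x}"
  show ?thesis
  proof (cases "M = {}")
    case True
    then have "row_of l s x = row_of l t x" if "x \<in> ?N" for x
      using row that by (auto simp: M_def)
    then show ?thesis using tabloid_eq_iff[OF s t(1)] by blast
  next
    case False
    have fM: "finite M" by (simp add: M_def)
    define x where "x = Max M"
    have xM: "x \<in> M" using False fM by (simp add: x_def)
    then have x: "x \<in> ?N" "inv \<pi> x \<noteq> x" by (auto simp: M_def)
    let ?y = "inv \<pi> x"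
    have i: "inv \<pi> \<in> column_stabilizer l t" by (rule column_stabilizer_group(3)[OF t(1) \<pi>])
    have y: "?y \<in> ?N" using Sym_in[OF column_stabilizer_Sym[OF i]] x(1) by blast
    have "inv \<pi> ?y \<noteq> ?y"
      using x(2) Sym_inv_simps(5)[OF S] by metis
    then have "?y \<in> M" using y by (simp add: M_def)
    then have "?y \<le> x" unfolding x_def by (rule Max_ge[OF fM])
    then have "?y < x" using x(2) by simp
    have col: "col_of l t ?y = col_of l t x"
      using i x(1) column_stabilizer_iff[OF t(1)] by blast
    have less: "row_of l t ?y < row_of l t x"
    proof (rule ccontr)
      assume "\<not> ?thesis"
      moreover have "row_of l t ?y \<noteq> row_of l t x"
        using tableau_eqI[OF t(1) y x(1) _ col] x(2) by blast
      ultimately have "row_of l t x < row_of l t ?y" by simp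
      then have "t (row_of l t x, col_of l t x) < t (row_of l t ?y, col_of l t x)"
        using t(2) tableau_cell(1)[OF t(1) x(1)] tableau_cell(1)[OF t(1) y] col
        unfolding column_strict_def by metis
      then have "x < ?y"
        using tableau_cell(2)[OF t(1) x(1)] tableau_cell(2)[OF t(1) y] col by simp
      then show False using \<open>?y < x\<close> by simp
    qed
    have "tableau_key l s < tableau_key l t"
      unfolding tableau_key_def
    proof (rule digits_compare)
      show "row_of l s z < Suc (length l)" if "z \<in> ?N" for z
        using tableau_cell(1)[OF s that] by (simp add: young_def)
      show "row_of l s x < row_of l t x" using less row[OF x(1)] by simp
      show "row_of l s z = row_of l t z" if z: "z \<in> ?N" "x < z" for z
      proof -
        have "z \<notin> M" using Max_ge[OF fM, of z] z(2) by (auto simp: x_def)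
        then show ?thesis using row[OF z(1)] z(1) by (simp add: M_def)
      qed
    qed (fact x(1))
    then show ?thesis ..
  qed
qed

text \<open>Each row, read as a strictly increasing list, is determined by its set of
  entries.\<close>

lemma row_strict_determined:
  assumes t: "tableau l t" "row_strict l t" and s: "tableau l s" "row_strict l s"
    and eq: "tabloid l t = tabloid l s" and c: "c \<in> young l"
  shows "t c = s c"
proof -
  obtain i j where ij: "c = (i, j)" "i < length l" "j < l ! i"
    using c by (auto simp: young_def)
  have sorted: "sorted_wrt (<) (map (\<lambda>j. u (i, j)) [0..<l ! i])" if "row_strict l u" for u
    using that ij(2) unfolding row_strict_def sorted_wrt_map
    by (intro sorted_wrt_mono_rel[OF _ sorted_wrt_upt]) (auto simp: young_def)
  have img: "set (map (\<lambda>j. u (i, j)) [0..<l ! i]) = tabloid l u ! i" for u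
    using ij(2) by (auto simp: tabloid_def)
  have "map (\<lambda>j. t (i, j)) [0..<l ! i] = map (\<lambda>j. s (i, j)) [0..<l ! i]"
    by (rule strict_sorted_equal[OF sorted[OF s(2)] sorted[OF t(2)]]) (simp only: img eq)
  then have "map (\<lambda>j. t (i, j)) [0..<l ! i] ! j = map (\<lambda>j. s (i, j)) [0..<l ! i] ! j" by (rule arg_cong)
  then show ?thesis using ij by simp
qed

section \<open>Skew tableaux completed to full tableaux\<close>

lemma sum_list_one_part [simp]: "sum_list (one_part m) = m"
  by (simp add: one_part_def)

lemma young_one_part: "young (one_part m) = {0} \<times> {..<m}"
  by (auto simp: young_def one_part_def)

text \<open>The removed cells receive the smallest entries, so strictness along rows and columns
  survives the completion; \<open>m = 0\<close> recovers ordinary standard tableaux.\<close>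

definition fill :: "nat \<Rightarrow> (nat \<times> nat \<Rightarrow> nat) \<Rightarrow> nat \<times> nat \<Rightarrow> nat"
  where "fill m U c = (if c \<in> young (one_part m) then Suc (snd c) else U c + m)"

lemma standard_tableauxD:
  assumes "U \<in> standard_tableaux l nu"
  shows "bij_betw U (young l - young nu) {1..card (young l - young nu)}"
    "c \<notin> young l - young nu \<Longrightarrow> U c = 0"
    "(i, j) \<in> young l - young nu \<Longrightarrow> (i, j') \<in> young l - young nu \<Longrightarrow> j < j' \<Longrightarrow> U (i, j) < U (i, j')"
    "(i, j) \<in> young l - young nu \<Longrightarrow> (i', j) \<in> young l - young nu \<Longrightarrow> i < i' \<Longrightarrow> U (i, j) < U (i', j)"
  using assms unfolding standard_tableaux_def Let_def by blast+

lemma fill_tableau: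
  assumes sub: "young (one_part m) \<subseteq> young l" and U: "U \<in> standard_tableaux l (one_part m)"
  shows "tableau l (fill m U)" "column_strict l (fill m U)" "row_strict l (fill m U)"
proof -
  let ?Z = "young (one_part m)"
  note UD = standard_tableauxD[OF U]
  have cZ: "card ?Z = m" by (simp add: young_one_part)
  have cY: "card (young l - ?Z) = sum_list l - m" and le: "m \<le> sum_list l"
    using card_Diff_subset[OF finite_subset[OF sub finite_young] sub] card_mono[OF finite_young sub]
    by (simp_all add: card_young cZ)
  have pos: "0 < U c" if "c \<in> young l - ?Z" for c
    using UD(1) that by (fastforce simp: bij_betw_def)
  show "tableau l (fill m U)"
  proof -
    have 1: "bij_betw (fill m U) ?Z {1..m}"
      by (rule bij_betw_byWitness[where f' = "\<lambda>x. (0, x - 1)"]) (auto simp: fill_def young_one_part)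
    have "bij_betw ((\<lambda>x. x + m) \<circ> U) (young l - ?Z) {m + 1..sum_list l}"
    proof (rule bij_betw_trans[OF UD(1)])
      show "bij_betw (\<lambda>x. x + m) {1..card (young l - ?Z)} {m + 1..sum_list l}"
        by (rule bij_betw_byWitness[where f' = "\<lambda>x. x - m"]) (use cY le in auto)
    qed
    then have 2: "bij_betw (fill m U) (young l - ?Z) {m + 1..sum_list l}"
      by (rule bij_betw_cong[THEN iffD1, rotated]) (simp add: fill_def)
    have "bij_betw (fill m U) (?Z \<union> (young l - ?Z)) ({1..m} \<union> {m + 1..sum_list l})"
      by (rule bij_betw_combine[OF 1 2]) auto
    moreover have "?Z \<union> (young l - ?Z) = young l" using sub by auto
    moreover have "{1..m} \<union> {m + 1..sum_list l} = {1..sum_list l}" using le by auto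
    ultimately show ?thesis by (simp add: tableau_def)
  qed
  show "column_strict l (fill m U)"
    unfolding column_strict_def
  proof (intro allI impI)
    fix i i' j assume ij: "(i, j) \<in> young l" "(i', j) \<in> young l" "i < i'"
    then have "(i', j) \<notin> ?Z" by (auto simp: young_one_part)
    then show "fill m U (i, j) < fill m U (i', j)"
      using ij UD(4)[of i j i'] pos[of "(i', j)"] by (auto simp: fill_def young_one_part)
  qed
  show "row_strict l (fill m U)"
    unfolding row_strict_def
  proof (intro allI impI)
    fix i j j' assume ij: "(i, j) \<in> young l" "(i, j') \<in> young l" "j < j'"
    then show "fill m U (i, j) < fill m U (i, j')"
      using UD(3)[of i j j'] pos[of "(i, j')"] by (auto simp: fill_def young_one_part)
  qed
qed

lemma fill_inj:
  assumes sub: "young (one_part m) \<subseteq> young l"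
    and U: "U \<in> standard_tableaux l (one_part m)" "V \<in> standard_tableaux l (one_part m)"
    and eq: "tabloid l (fill m U) = tabloid l (fill m V)"
  shows "U = V"
proof
  fix c
  note f = fill_tableau[OF sub]
  show "U c = V c"
  proof (cases "c \<in> young l - young (one_part m)")
    case True
    then have "fill m U c = fill m V c"
      using row_strict_determined[OF f(1)[OF U(1)] f(3)[OF U(1)] f(1)[OF U(2)] f(3)[OF U(2)] eq] by simp
    then show ?thesis using True by (simp add: fill_def)
  next
    case False
    then show ?thesis using standard_tableauxD(2)[OF U(1)] standard_tableauxD(2)[OF U(2)] by simp
  qed
qed

text \<open>Among the indices with nonzero coefficient take one of least key: its equation has a
  single surviving term. Integer keys serve both orders, by negation.\<close>

lemma unitriangular_kernel:
  fixes g :: "'i \<Rightarrow> 'a::field" and key :: "'i \<Rightarrow> int"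
  assumes fin: "finite S" and U: "U \<in> S"
    and diag: "\<And>V. V \<in> S \<Longrightarrow> a V V = 1"
    and tri: "\<And>V W. V \<in> S \<Longrightarrow> W \<in> S \<Longrightarrow> V \<noteq> W \<Longrightarrow> a V W \<noteq> 0 \<Longrightarrow> key V < key W"
    and zero: "\<And>V. V \<in> S \<Longrightarrow> (\<Sum>W\<in>S. g W * a W V) = 0"
  shows "g U = 0"
proof (rule ccontr)
  let ?A = "{W \<in> S. g W \<noteq> 0}"
  assume "g U \<noteq> 0"
  then have "finite (key ` ?A)" "key ` ?A \<noteq> {}" using fin U by auto
  then have "Min (key ` ?A) \<in> key ` ?A" by (rule Min_in)
  then obtain V where V: "V \<in> S" "g V \<noteq> 0" "Min (key ` ?A) = key V" by auto
  have "(\<Sum>W\<in>S. g W * a W V) = (\<Sum>W\<in>S. if W = V then g V else 0)"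
  proof (rule sum.cong[OF refl])
    fix W assume W: "W \<in> S"
    have "key V \<le> key W" if "g W \<noteq> 0"
      using Min_le[of "key ` ?A" "key W"] fin that V(3) W by auto
    then have "W = V \<or> g W = 0 \<or> a W V = 0"
      using tri[OF W V(1)] by linarith
    then show "g W * a W V = (if W = V then g V else 0)"
      using diag[OF V(1)] by auto
  qed
  then show False using zero[OF V(1)] V fin by simp
qed

lemma fill_triangular:
  assumes sub: "young (one_part m) \<subseteq> young l"
    and U: "U \<in> standard_tableaux l (one_part m)" "V \<in> standard_tableaux l (one_part m)" "U \<noteq> V"
    and nz: "polytabloid l (fill m V) (tabloid l (fill m U)) \<noteq> (0 :: 'a::field)"
  shows "tableau_key l (fill m U) < tableau_key l (fill m V)"
  using polytabloid_triangular[OF fill_tableau(1,2)[OF sub U(2)] fill_tableau(1)[OF sub U(1)] nz]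
    fill_inj[OF sub U(1,2)] U(3) by blast

lemma num_std_le_dim_specht:
  "num_std l [] \<le> fs.dim (specht l :: (nat set list \<Rightarrow> 'a::field) set)"
proof (cases "finite (standard_tableaux l [])")
  case True
  have sub: "young (one_part 0) \<subseteq> young l" by (simp add: young_one_part)
  \<comment> \<open>The empty inner shape is the row of length 0, so the completion of skew tableaux
    applies.\<close>
  have nil: "[] = one_part 0" by (simp add: one_part_def)
  let ?S = "standard_tableaux l (one_part 0)" and ?f = "\<lambda>U. polytabloid l (fill 0 U) :: nat set list \<Rightarrow> 'a"
  have fin: "finite ?S" using True nil by simp
  have zero: "g U = 0" if g: "(\<Sum>U\<in>?S. fscale (g U) (?f U)) = 0" and U: "U \<in> ?S" for g U
  \<comment> \<open>The polytabloid carries the first index and has the larger tableau key, whereas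
    the first index is to have the smaller key; hence the sign.\<close>
  proof (rule unitriangular_kernel[where a = "\<lambda>U V. ?f U (tabloid l (fill 0 V))"
        and key = "\<lambda>U. - int (tableau_key l (fill 0 U))", OF fin U])
    show "(\<Sum>W\<in>?S. g W * ?f W (tabloid l (fill 0 V))) = 0" for V
      using fun_cong[OF g, of "tabloid l (fill 0 V)"] by (simp add: sum_fun_apply)
  qed (use fill_triangular[OF sub] in \<open>auto simp: polytabloid_diagonal[OF fill_tableau(1)[OF sub]]\<close>)
  have ind: "inj_on ?f ?S" "fs.independent (?f ` ?S)"
    by (rule fs.independent_family[OF fin]; erule (1) zero)+
  interpret perm_set "sum_list l" "\<lambda>\<sigma>. map ((`) \<sigma>)" "tabloids l"
    by (rule perm_set_tabloids)
  have "card (?f ` ?S) \<le> fs.dim (specht l :: (nat set list \<Rightarrow> 'a) set)"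
  proof (rule fs.card_le_dim[OF ind(2)])
    show "?f ` ?S \<subseteq> specht l"
      using fill_tableau(1)[OF sub] polytabloid_in_specht by blast
    show "specht l \<subseteq> fs.span (delta ` tabloids l :: (nat set list \<Rightarrow> 'a) set)"
      using specht_subset supported_subset_span[OF finite_X] by blast
  qed simp
  then show ?thesis by (simp add: card_image[OF ind(1)] num_std_def nil)
qed (simp add: num_std_def)

text \<open>The basis of the Young permutation module of shape (n - t, 1^t): the letters of a word
  fill the rows of length one, all remaining entries the long row.\<close>

definition inj_words :: "nat \<Rightarrow> nat \<Rightarrow> nat list set"
  where "inj_words n t = {w. length w = t \<and> distinct w \<and> set w \<subseteq> {1..n}}"

lemma perm_set_inj_words: "perm_set n map (inj_words n t)"
proof
  show "finite (inj_words n t)"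
    by (rule finite_subset[OF _ finite_lists_length_eq[of "{1..n}" t]]) (auto simp: inj_words_def)
  fix \<sigma> :: "nat \<Rightarrow> nat" and w assume s: "\<sigma> \<in> Sym n" and w: "w \<in> inj_words n t"
  have "inj_on \<sigma> (set w)" using bij_is_inj[OF Sym_facts(6)[OF s]] inj_on_subset by blast
  then show "map \<sigma> w \<in> inj_words n t"
    using w Sym_in[OF s] by (auto simp: inj_words_def distinct_map)
qed auto

text \<open>The tabloid obtained from \<open>t\<close> by replacing the entries \<open>m + 1, \<dots>, n\<close> with the letters of \<open>w\<close>
  and putting all other entries into the first row.\<close>

definition word_tabloid :: "nat list \<Rightarrow> nat \<Rightarrow> (nat \<times> nat \<Rightarrow> nat) \<Rightarrow> nat list \<Rightarrow> nat set list"
  where "word_tabloid l m t w = map (\<lambda>r. {w ! i | i. i < length w \<and> row_of l t (Suc (m + i)) = r}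
    \<union> (if r = 0 then {1..sum_list l} - set w else {})) [0..<length l]"

text \<open>The row of a letter depends on its position in the word only, so pulling back along
  \<open>word_tabloid\<close> is equivariant.\<close>

lemma word_tabloid_map:
  assumes "\<sigma> \<in> Sym (sum_list l)"
  shows "word_tabloid l m t (map \<sigma> w) = map ((`) \<sigma>) (word_tabloid l m t w)"
proof -
  have 1: "{map \<sigma> w ! i | i. i < length w \<and> P i} = \<sigma> ` {w ! i | i. i < length w \<and> P i}" for P
    unfolding setcompr_eq_image image_image by (intro image_cong) auto
  have "\<sigma> ` {1..sum_list l} = {1..sum_list l}"
    using assms by (simp add: Sym_def permutes_image)
  moreover have "inj \<sigma>" using bij_is_inj[OF Sym_facts(6)[OF assms]] .
  ultimately have 2: "\<sigma> ` ({1..sum_list l} - set w) = {1..sum_list l} - \<sigma> ` set w"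
    by (simp add: image_set_diff)
  show ?thesis
    by (simp add: word_tabloid_def 1 2 image_Un del: One_nat_def)
qed

text \<open>At the word of all entries above \<open>m\<close> the pullback reads off the coefficient
  at the tabloid of \<open>t\<close>. The condition on rows holds for tableaux whose entries up to
  \<open>m\<close> fill the start of the top row.\<close>

lemma word_tabloid_initial:
  assumes t: "tableau l t" and m: "m \<le> sum_list l"
    and row: "\<And>x. x \<in> {1..m} \<Longrightarrow> row_of l t x = 0"
  shows "word_tabloid l m t [Suc m..<Suc (sum_list l)] = tabloid l t"
proof (rule nth_equalityI)
  fix r assume "r < length (word_tabloid l m t [Suc m..<Suc (sum_list l)])"
  then have r: "r < length l" by (simp add: word_tabloid_def)
  have "{[Suc m..<Suc (sum_list l)] ! i | i. i < sum_list l - m \<and> row_of l t (Suc (m + i)) = r} =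
      {x \<in> {Suc m..sum_list l}. row_of l t x = r}"
  proof (intro equalityI subsetI)
    fix x assume x: "x \<in> {x \<in> {Suc m..sum_list l}. row_of l t x = r}"
    then show "x \<in> {[Suc m..<Suc (sum_list l)] ! i | i. i < sum_list l - m \<and> row_of l t (Suc (m + i)) = r}"
      by (intro CollectI exI[of _ "x - Suc m"]) (auto simp del: upt_Suc)
  qed (auto simp del: upt_Suc)
  moreover have "{1..sum_list l} - set [Suc m..<Suc (sum_list l)] = {1..m}"
    using m by (auto simp del: upt_Suc)
  ultimately have "word_tabloid l m t [Suc m..<Suc (sum_list l)] ! r =
      {x \<in> {Suc m..sum_list l}. row_of l t x = r} \<union> (if r = 0 then {1..m} else {})"
    using r by (simp add: word_tabloid_def del: upt_Suc)
  also have "\<dots> = {x \<in> {1..sum_list l}. row_of l t x = r}"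
  proof (rule set_eqI)
    show "x \<in> {x \<in> {Suc m..sum_list l}. row_of l t x = r} \<union> (if r = 0 then {1..m} else {}) \<longleftrightarrow>
      x \<in> {x \<in> {1..sum_list l}. row_of l t x = r}" for x
      by (cases "x \<le> m") (use m row[of x] in auto)
  qed
  also have "\<dots> = tabloid l t ! r" by (rule tabloid_nth[OF t r, symmetric])
  finally show "word_tabloid l m t [Suc m..<Suc (sum_list l)] ! r = tabloid l t ! r" .
qed (simp add: word_tabloid_def)

text \<open>Each standard filling \<open>U\<close> gives a homomorphism, the pullback of functions
  from tabloids to words. At a suitable word, the image of the polytabloid of \<open>V\<close> has
  as value its coefficient at the tabloid of \<open>U\<close>, and these coefficients form a
  unitriangular matrix.\<close>

lemma num_std_le_dim_Hom:
  assumes sub: "young (one_part m) \<subseteq> young l"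
  shows "num_std l (one_part m) \<le> hs.dim (Hom_mod (Sym (sum_list l)) tabloid_action
    (specht l :: (nat set list \<Rightarrow> 'a::field_char_0) set) tensor_action
    (supported (inj_words (sum_list l) (sum_list l - m))))"
proof (cases "finite (standard_tableaux l (one_part m))")
  case fin: True
  let ?n = "sum_list l" and ?S = "standard_tableaux l (one_part m)"
  let ?X = "inj_words ?n (?n - m)" and ?V = "specht l :: (nat set list \<Rightarrow> 'a) set"
  let ?H = "Hom_mod (Sym ?n) tabloid_action ?V tensor_action (supported ?X)"
  interpret X: perm_set ?n map ?X by (rule perm_set_inj_words)
  note sV = is_moduleD[OF specht_module[of l, where ?'a = 'a]]
  have m: "m \<le> ?n"
    using card_mono[OF finite_young sub] by (simp add: card_young young_one_part)
  define T where "T U = (\<lambda>v w. if v \<in> ?V \<and> w \<in> ?X then v (word_tabloid l m (fill m U) w) else 0)" for U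
  have T: "T U \<in> ?H" for U
  proof (rule Hom_modI)
    show "T U (tabloid_action \<sigma> v) = tensor_action \<sigma> (T U v)"
      if s: "\<sigma> \<in> Sym ?n" and v: "v \<in> ?V" for \<sigma> v
    proof
      fix w
      have i: "inv \<sigma> \<in> Sym ?n" using s by simp
      have "map (inv \<sigma>) w \<in> ?X \<longleftrightarrow> w \<in> ?X"
        by (rule X.act_closed_iff[OF i])
      then show "T U (tabloid_action \<sigma> v) w = tensor_action \<sigma> (T U v) w"
        using v sV(2)[OF s v] word_tabloid_map[OF i]
        by (simp add: T_def tensor_action_def perm_action_def tabloid_action_def)
    qed
  qed (auto simp: T_def lin_on_def supported_def fun_eq_iff sV)
  \<comment> \<open>The upper bound is exclusive: the letters are \<open>m + 1\<close> up to the
    size of \<open>l\<close>, and the length is that size minus \<open>m\<close>.\<close>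
  let ?w = "[Suc m..<Suc ?n]"
  have w: "?w \<in> ?X" by (auto simp: inj_words_def)
  have row0: "row_of l (fill m U) x = 0" if U: "U \<in> ?S" and x: "x \<in> {1..m}" for U x
  proof -
    have "(0, x - 1) \<in> young (one_part m)" using x by (auto simp: young_one_part)
    moreover from this have "fill m U (0, x - 1) = x" using x by (simp add: fill_def)
    ultimately show ?thesis
      using tableau_entry(1)[OF fill_tableau(1)[OF sub U], of 0 "x - 1"] sub by auto
  qed
  have T_val: "T U v ?w = v (tabloid l (fill m U))" if U: "U \<in> ?S" and v: "v \<in> ?V" for U v
    using word_tabloid_initial[OF fill_tableau(1)[OF sub U] m row0[OF U]] v w by (simp add: T_def)
  have zero: "g U = 0" if g: "(\<Sum>U\<in>?S. hscale (g U) (T U)) = 0" and U: "U \<in> ?S" for g U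
  \<comment> \<open>Here the polytabloid carries the second index, so the keys enter without a
    sign.\<close>
  proof (rule unitriangular_kernel[where a = "\<lambda>U V. polytabloid l (fill m V) (tabloid l (fill m U))"
        and key = "\<lambda>U. int (tableau_key l (fill m U))", OF fin U])
    fix V assume V: "V \<in> ?S"
    have e: "polytabloid l (fill m V) \<in> ?V"
      by (rule polytabloid_in_specht[OF fill_tableau(1)[OF sub V]])
    have "(\<Sum>U\<in>?S. hscale (g U) (T U)) (polytabloid l (fill m V)) ?w = 0"
      using g by simp
    then show "(\<Sum>U\<in>?S. g U * polytabloid l (fill m V) (tabloid l (fill m U))) = 0"
      by (simp add: sum_fun_apply T_val[OF _ e] del: upt_Suc)
  qed (use fill_triangular[OF sub] in \<open>auto simp: polytabloid_diagonal[OF fill_tableau(1)[OF sub]]\<close>)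
  have ind: "inj_on T ?S" "hs.independent (T ` ?S)"
    by (rule hs.independent_family[OF fin]; erule (1) zero)+
  obtain F where F: "finite F" "?H \<subseteq> hs.span F"
    using dim_Hom_mod(2)[OF perm_set_tabloids perm_set_inj_words
        specht_module[unfolded tabloid_action_def] specht_subset]
    unfolding tabloid_action_def tensor_action_def by metis
  have "card (T ` ?S) \<le> hs.dim ?H"
    by (rule hs.card_le_dim[OF ind(2) _ F(2,1)]) (use T in auto)
  then show ?thesis by (simp add: card_image[OF ind(1)] num_std_def)
qed (simp add: num_std_def)

section \<open>Counting in Young's lattice\<close>

text \<open>Shapes as finite down-closed sets of cells, for which adding and removing a cell are
  plain set operations.\<close>

definition diagram :: "(nat \<times> nat) set \<Rightarrow> bool"
  where "diagram D \<longleftrightarrow> finite D \<and>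
    (\<forall>i j i' j'. (i, j) \<in> D \<longrightarrow> i' \<le> i \<longrightarrow> j' \<le> j \<longrightarrow> (i', j') \<in> D)"

definition diagrams :: "nat \<Rightarrow> (nat \<times> nat) set set"
  where "diagrams n = {D. diagram D \<and> card D = n}"

text \<open>The conditions of \<open>standard_tableaux\<close> for arbitrary sets of cells, as a
  recursion over corners requires.\<close>

definition fillings :: "(nat \<times> nat) set \<Rightarrow> (nat \<times> nat) set \<Rightarrow> (nat \<times> nat \<Rightarrow> nat) set"
  where "fillings D Z = {T. bij_betw T (D - Z) {1..card (D - Z)} \<and>
    (\<forall>c. c \<notin> D - Z \<longrightarrow> T c = 0) \<and>
    (\<forall>i j j'. (i, j) \<in> D - Z \<longrightarrow> (i, j') \<in> D - Z \<longrightarrow> j < j' \<longrightarrow> T (i, j) < T (i, j')) \<and>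
    (\<forall>i i' j. (i, j) \<in> D - Z \<longrightarrow> (i', j) \<in> D - Z \<longrightarrow> i < i' \<longrightarrow> T (i, j) < T (i', j))}"

lemma num_std_eq: "num_std l nu = card (fillings (young l) (young nu))"
  by (simp add: num_std_def standard_tableaux_def fillings_def Let_def)

lemma diagramD: "diagram D \<Longrightarrow> (i, j) \<in> D \<Longrightarrow> i' \<le> i \<Longrightarrow> j' \<le> j \<Longrightarrow> (i', j') \<in> D"
  unfolding diagram_def by blast

lemma diagram_finite: "diagram D \<Longrightarrow> finite D"
  by (simp add: diagram_def)

definition addable :: "(nat \<times> nat) set \<Rightarrow> (nat \<times> nat) set"
  where "addable D = {c. c \<notin> D \<and> diagram (insert c D)}"

definition removable :: "(nat \<times> nat) set \<Rightarrow> (nat \<times> nat) set"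
  where "removable D = {c \<in> D. diagram (D - {c})}"

lemma fillingsD:
  assumes "T \<in> fillings D Z"
  shows "bij_betw T (D - Z) {1..card (D - Z)}"
    "c \<notin> D - Z \<Longrightarrow> T c = 0"
    "(i, j) \<in> D - Z \<Longrightarrow> (i, j') \<in> D - Z \<Longrightarrow> j < j' \<Longrightarrow> T (i, j) < T (i, j')"
    "(i, j) \<in> D - Z \<Longrightarrow> (i', j) \<in> D - Z \<Longrightarrow> i < i' \<Longrightarrow> T (i, j) < T (i', j)"
  using assms unfolding fillings_def by blast+

lemma fillings_bounds:
  assumes "T \<in> fillings D Z" "c \<in> D - Z"
  shows "0 < T c" "T c \<le> card (D - Z)"
  using fillingsD(1)[OF assms(1)] assms(2) by (fastforce simp: bij_betw_def)+

text \<open>Delete the cell with the largest entry.\<close>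

lemma fillings_step:
  assumes D: "diagram D" and Z: "diagram Z" "Z \<subseteq> D" and k: "card (D - Z) = Suc k"
  shows "fillings D Z = (\<Union>c\<in>removable D - Z. (\<lambda>T. T(c := Suc k)) ` fillings (D - {c}) Z)"
proof (intro equalityI subsetI)
  fix T assume T: "T \<in> fillings D Z"
  note TD = fillingsD[OF T]
  have "Suc k \<in> T ` (D - Z)" using TD(1) k by (simp add: bij_betw_def)
  then obtain c where c: "c \<in> D" "c \<notin> Z" "T c = Suc k" by auto
  have top: "x = c" if "x \<in> D - Z" "Suc k \<le> T x" for x
  proof -
    have "T x = T c" using fillings_bounds(2)[OF T that(1)] that(2) k c(3) by simp
    then show ?thesis using TD(1) that(1) c by (auto simp: bij_betw_def inj_on_def)
  qed
  obtain a b where ab: "c = (a, b)" by (cases c)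
  have "diagram (D - {c})"
    unfolding diagram_def
  proof (intro conjI allI impI)
    fix i j i' j' assume ij: "(i, j) \<in> D - {c}" "i' \<le> i" "j' \<le> j"
    have "(i', j') \<noteq> c"
    proof
      assume eq: "(i', j') = c"
      have "(i', j') \<in> D - Z" using c eq by simp
      \<comment> \<open>\<open>Z\<close> is down-closed and misses \<open>c\<close>, so the path
        from \<open>c\<close> along its row and then down a column stays in the skew shape, and the
        entries grow along it.\<close>
      have "(i', j) \<notin> Z" using diagramD[OF Z(1), of i' j i' j'] ij(3) c(2) eq by auto
      then have 1: "(i', j) \<in> D - Z" using diagramD[OF D, of i j i' j] ij by auto
      have "(i, j) \<notin> Z" using diagramD[OF Z(1), of i j i' j'] ij(2,3) c(2) eq by auto
      then have 2: "(i, j) \<in> D - Z" using ij(1) by auto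
      have "T (i', j') \<le> T (i', j)"
        using TD(3)[OF \<open>(i', j') \<in> D - Z\<close> 1] ij(3) by (cases "j' = j") auto
      also have "\<dots> \<le> T (i, j)"
        using TD(4)[OF 1 2] ij(2) by (cases "i' = i") auto
      finally have "(i, j) = c" using top[OF 2] c(3) eq by simp
      then show False using ij(1) by simp
    qed
    then show "(i', j') \<in> D - {c}" using diagramD[OF D, of i j] ij by auto
  qed (simp add: diagram_finite[OF D])
  then have cr: "c \<in> removable D - Z" using c by (simp add: removable_def)
  have sub: "D - {c} - Z = (D - Z) - {c}" by auto
  have ck: "card (D - {c} - Z) = k" unfolding sub using c k diagram_finite[OF D] by simp
  have "bij_betw T ((D - Z) - {c}) ({1..Suc k} - {T c})"
    using TD(1) k c by (intro bij_betw_DiffI) auto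
  moreover have "{1..Suc k} - {T c} = {1..k}" using c(3) by auto
  ultimately have "bij_betw T (D - {c} - Z) {1..k}" unfolding sub by simp
  then have "bij_betw (T(c := 0)) (D - {c} - Z) {1..card (D - {c} - Z)}"
    unfolding ck by (rule bij_betw_cong[THEN iffD1, rotated]) auto
  then have "T(c := 0) \<in> fillings (D - {c}) Z"
    unfolding fillings_def using TD(2-4) by auto
  moreover have "T = (T(c := 0))(c := Suc k)" using c(3) by auto
  ultimately show "T \<in> (\<Union>c\<in>removable D - Z. (\<lambda>T. T(c := Suc k)) ` fillings (D - {c}) Z)"
    using cr by blast
next
  fix T assume "T \<in> (\<Union>c\<in>removable D - Z. (\<lambda>T. T(c := Suc k)) ` fillings (D - {c}) Z)"
  then obtain c U where c: "c \<in> D" "diagram (D - {c})" "c \<notin> Z"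
    and U: "U \<in> fillings (D - {c}) Z" "T = U(c := Suc k)" by (auto simp: removable_def)
  note UD = fillingsD[OF U(1)]
  have sub: "D - {c} - Z = (D - Z) - {c}" by auto
  have ck: "card (D - {c} - Z) = k" unfolding sub using c k diagram_finite[OF D] by simp
  have bound: "U x < Suc k" if "x \<in> D - Z" "x \<noteq> c" for x
    using fillings_bounds(2)[OF U(1), of x] that ck by simp
  have "bij_betw T ({c} \<union> (D - {c} - Z)) ({Suc k} \<union> {1..k})"
  proof (rule bij_betw_combine)
    show "bij_betw T (D - {c} - Z) {1..k}"
      using UD(1) unfolding ck by (rule bij_betw_cong[THEN iffD1, rotated]) (simp add: U(2))
  qed (auto simp: U(2))
  moreover have "{c} \<union> (D - {c} - Z) = D - Z" using c by auto
  moreover have "{Suc k} \<union> {1..k} = {1..Suc k}" by auto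
  ultimately have bij: "bij_betw T (D - Z) {1..card (D - Z)}" by (simp add: k)
  have "T (i, j) < T (i', j')"
    if *: "(i, j) \<in> D - Z" "(i', j') \<in> D - Z" "(i, j) \<noteq> (i', j')" "i \<le> i'" "j \<le> j'"
      "(i, j) \<noteq> c \<Longrightarrow> (i', j') \<noteq> c \<Longrightarrow> U (i, j) < U (i', j')" for i j i' j'
  proof -
    \<comment> \<open>A removable cell has no other cell weakly below and to the right of it, so the
      new largest entry can only stand at the greater end of a comparison.\<close>
    have "(i, j) \<noteq> c"
    proof
      assume "(i, j) = c"
      then have "(i', j') \<in> D - {c}" using * by auto
      then show False using diagramD[OF c(2), of i' j' i j] *(4,5) \<open>(i, j) = c\<close> by auto
    qed
    then show ?thesis
      using bound[OF *(1)] *(6) by (auto simp: U(2))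
  qed
  then show "T \<in> fillings D Z"
    unfolding fillings_def using bij UD(2-4) c by (auto simp: U(2))
qed

lemma finite_fillings: "diagram D \<Longrightarrow> finite (fillings D Z)"
proof (rule finite_subset)
  assume "diagram D"
  then show "finite {T. \<forall>c. (c \<in> D - Z \<longrightarrow> T c \<in> {1..card (D - Z)}) \<and> (c \<notin> D - Z \<longrightarrow> T c = (0 :: nat))}"
    by (intro finite_set_of_finite_funs) (auto simp: diagram_finite)
  show "fillings D Z \<subseteq> {T. \<forall>c. (c \<in> D - Z \<longrightarrow> T c \<in> {1..card (D - Z)}) \<and> (c \<notin> D - Z \<longrightarrow> T c = 0)}"
    by (auto simp: fillings_def bij_betw_def)
qed

lemma removable_diagram: "c \<in> removable D \<Longrightarrow> diagram (D - {c})"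
  by (simp add: removable_def)

text \<open>The recursion for the number of standard skew tableaux: the place of the largest entry
  identifies the corner, so different corners contribute disjoint sets.\<close>

lemma card_fillings_step:
  assumes D: "diagram D" and Z: "diagram Z" "Z \<subset> D"
  shows "card (fillings D Z) = (\<Sum>c\<in>removable D - Z. card (fillings (D - {c}) Z))"
proof -
  have "card (D - Z) \<noteq> 0" using Z(2) diagram_finite[OF D] by auto
  then obtain k where k: "card (D - Z) = Suc k" using not0_implies_Suc by blast
  have fin: "finite (removable D - Z)"
    by (rule finite_subset[OF _ diagram_finite[OF D]]) (auto simp: removable_def)
  have ck: "card (D - {c} - Z) = k" if "c \<in> removable D - Z" for c
  proof -
    have "D - {c} - Z = (D - Z) - {c}" by auto
    then show ?thesis using that k diagram_finite[OF D] by (simp add: removable_def)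
  qed
  have inj: "inj_on (\<lambda>T. T(c := Suc k)) (fillings (D - {c}) Z)" for c
  proof (rule inj_onI)
    fix T U assume TU: "T \<in> fillings (D - {c}) Z" "U \<in> fillings (D - {c}) Z" "T(c := Suc k) = U(c := Suc k)"
    show "T = U"
    proof
      fix x
      show "T x = U x"
        using fun_cong[OF TU(3), of x] fillingsD(2)[OF TU(1), of c] fillingsD(2)[OF TU(2), of c]
        by (cases "x = c") auto
    qed
  qed
  have disj: "(\<lambda>T. T(c := Suc k)) ` fillings (D - {c}) Z \<inter> (\<lambda>T. T(d := Suc k)) ` fillings (D - {d}) Z = {}"
    if cd: "c \<in> removable D - Z" "d \<in> removable D - Z" "c \<noteq> d" for c d
  proof (rule ccontr)
    assume "\<not> ?thesis"
    then obtain T U where TU: "T \<in> fillings (D - {c}) Z" "T(c := Suc k) = U(d := Suc k)" by blast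
    have "T d = Suc k" using fun_cong[OF TU(2), of d] cd(3) by simp
    moreover have "T d \<le> k"
      using fillings_bounds(2)[OF TU(1), of d] cd ck[OF cd(1)] by (simp add: removable_def)
    ultimately show False by simp
  qed
  have "card (fillings D Z) = (\<Sum>c\<in>removable D - Z. card ((\<lambda>T. T(c := Suc k)) ` fillings (D - {c}) Z))"
    unfolding fillings_step[OF D Z(1) psubset_imp_subset[OF Z(2)] k]
    by (rule card_UN_disjoint[OF fin]) (use finite_fillings removable_diagram disj in blast)+
  also have "\<dots> = (\<Sum>c\<in>removable D - Z. card (fillings (D - {c}) Z))"
    by (simp add: card_image[OF inj])
  finally show ?thesis .
qed

lemma card_fillings_same: "card (fillings Z Z) = 1"
proof -
  have "fillings Z Z = {\<lambda>_. 0}" by (auto simp: fillings_def bij_betw_def)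
  then show ?thesis by simp
qed

lemma diagram_Int: "diagram D \<Longrightarrow> diagram E \<Longrightarrow> diagram (D \<inter> E)"
  unfolding diagram_def by blast

lemma diagram_Un: "diagram D \<Longrightarrow> diagram E \<Longrightarrow> diagram (D \<union> E)"
  unfolding diagram_def by blast

lemma diagram_row: "diagram ({0} \<times> {..<m})"
  by (auto simp: diagram_def)

text \<open>A row has its last cell as only corner, so the recursion never branches.\<close>

lemma card_fillings_row:
  assumes "b \<le> a"
  shows "card (fillings ({0} \<times> {..<a}) ({0} \<times> {..<b})) = 1"
  using assms
proof (induction a rule: dec_induct)
  case base
  show ?case by (rule card_fillings_same)
next
  case (step a)
  let ?R = "\<lambda>m :: nat. {0 :: nat} \<times> {..<m}"
  have del: "?R (Suc a) - {(0, a)} = ?R a" by auto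
  have "removable (?R (Suc a)) - ?R b = {(0, a)}"
  proof (intro equalityI subsetI)
    fix c assume c: "c \<in> removable (?R (Suc a)) - ?R b"
    then obtain j where j: "c = (0, j)" "j \<le> a" by (auto simp: removable_def)
    have "j = a"
    proof (rule ccontr)
      assume "j \<noteq> a"
      then have "(0, a) \<in> ?R (Suc a) - {c}" using j by auto
      then have "(0, j) \<in> ?R (Suc a) - {c}"
        using diagramD[of "?R (Suc a) - {c}" 0 a 0 j] c j by (auto simp: removable_def)
      then show False using j by simp
    qed
    then show "c \<in> {(0, a)}" using j by simp
  next
    fix c assume "c \<in> {(0 :: nat, a)}"
    then show "c \<in> removable (?R (Suc a)) - ?R b"
      using step diagram_row[of a] by (simp add: removable_def del)
  qed
  moreover have "?R b \<subset> ?R (Suc a)"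
  proof
    show "?R b \<subseteq> ?R (Suc a)" using step by auto
    have "(0, a) \<in> ?R (Suc a)" "(0, a) \<notin> ?R b" using step by auto
    then show "?R b \<noteq> ?R (Suc a)" by metis
  qed
  ultimately show ?case
    using card_fillings_step[OF diagram_row diagram_row, of b "Suc a"] step.IH by (simp add: del)
qed

lemma diagram_rows:
  assumes "diagram D"
  obtains r :: "nat \<Rightarrow> nat" where "\<And>i j. (i, j) \<in> D \<longleftrightarrow> j < r i" "antimono r"
proof
  define r where "r i = card {j. (i, j) \<in> D}" for i
  have fin: "finite {j. (i, j) \<in> D}" for i
  proof (rule finite_subset)
    show "{j. (i, j) \<in> D} \<subseteq> snd ` D" by force
  qed (simp add: diagram_finite[OF assms])
  have mem: "(i, j) \<in> D \<longleftrightarrow> j < r i" for i j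
  proof
    assume "(i, j) \<in> D"
    then have "{..j} \<subseteq> {j. (i, j) \<in> D}" using diagramD[OF assms] by auto
    then show "j < r i" using card_mono[OF fin, of "{..j}" i] by (simp add: r_def Suc_le_eq)
  next
    assume "j < r i"
    then have "j < card {j. (i, j) \<in> D}" by (simp add: r_def)
    moreover have "b \<in> {j. (i, j) \<in> D}" if "a \<in> {j. (i, j) \<in> D}" "b \<le> a" for a b
      using diagramD[OF assms, of i a i b] that by simp
    ultimately have "j \<in> {j. (i, j) \<in> D}"
      using down_closed_nat_mem[OF fin] by metis
    then show "(i, j) \<in> D" by simp
  qed
  then show "(i, j) \<in> D \<longleftrightarrow> j < r i" for i j .
  show "antimono r"
  proof (rule antimonoI)
    fix i i' :: nat assume "i \<le> i'"
    then have "{j. (i', j) \<in> D} \<subseteq> {j. (i, j) \<in> D}" using diagramD[OF assms] by auto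
    then show "r i' \<le> r i" unfolding r_def by (rule card_mono[OF fin])
  qed
qed

text \<open>In terms of row lengths, a descent \<open>r (Suc i) < r i\<close> gives a removable cell
  in row \<open>i\<close> and an addable cell in row \<open>Suc i\<close>; row 0 has one more
  addable cell. This surplus is the diagonal part of the commutation relation in Young's
  lattice.\<close>

lemma card_addable:
  assumes D: "diagram D"
  shows "card (addable D) = Suc (card (removable D))"
proof -
  obtain r where r: "\<And>i j. (i, j) \<in> D \<longleftrightarrow> j < r i" and anti: "antimono r"
    using diagram_rows[OF D] by metis
  note mono = antimonoD[OF anti]
  let ?I = "{i. r (Suc i) < r i}"
  have rem: "removable D = (\<lambda>i. (i, r i - 1)) ` ?I"
  proof (intro equalityI subsetI)
    fix c assume "c \<in> removable D"
    then obtain i j where c: "c = (i, j)" "(i, j) \<in> D" "diagram (D - {(i, j)})"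
      by (cases c) (auto simp: removable_def)
    have "(i, Suc j) \<notin> D" "(Suc i, j) \<notin> D"
      using diagramD[OF c(3), of i "Suc j" i j] diagramD[OF c(3), of "Suc i" j i j] by auto
    then show "c \<in> (\<lambda>i. (i, r i - 1)) ` ?I"
      using c(1,2) r by (intro image_eqI[of _ _ i]) auto
  next
    fix c assume "c \<in> (\<lambda>i. (i, r i - 1)) ` ?I"
    then obtain i where i: "c = (i, r i - 1)" "r (Suc i) < r i" by auto
    have "diagram (D - {c})"
      unfolding diagram_def
    proof (intro conjI allI impI)
      fix a b a' b' assume ab: "(a, b) \<in> D - {c}" "a' \<le> a" "b' \<le> b"
      have "(a', b') \<noteq> c"
      proof
        assume eq: "(a', b') = c"
        then have a: "a' = i" "b' = r i - 1" using i by auto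
        have b: "b < r a" using ab(1) r by simp
        show False
        proof (cases "a = i")
          case True
          then have "b = r i - 1" using b ab(3) a by simp
          then show ?thesis using ab(1) True i by simp
        next
          case False
          then have "r a \<le> r (Suc i)" using ab(2) a by (intro mono) simp
          then show ?thesis using b ab(3) a(2) i(2) by simp
        qed
      qed
      then show "(a', b') \<in> D - {c}" using diagramD[OF D, of a b] ab by auto
    qed (simp add: diagram_finite[OF D])
    then show "c \<in> removable D" using i r by (auto simp: removable_def)
  qed
  have add: "addable D = (\<lambda>i. (i, r i)) ` (insert 0 (Suc ` ?I))"
  proof (intro equalityI subsetI)
    fix c assume "c \<in> addable D"
    then obtain i j where c: "c = (i, j)" "(i, j) \<notin> D" "diagram (insert (i, j) D)"
      by (cases c) (auto simp: addable_def)
    have "j' < r i" if "j' < j" for j'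
      using diagramD[OF c(3), of i j i j'] that r by auto
    then have j: "j = r i" using c(2) r by (meson linorder_neqE_nat less_irrefl)
    have "i = 0 \<or> i \<in> Suc ` ?I"
    proof (cases i)
      case (Suc a)
      have "(a, j) \<in> D" using diagramD[OF c(3), of i j a j] Suc by auto
      then show ?thesis using r Suc j by auto
    qed simp
    then show "c \<in> (\<lambda>i. (i, r i)) ` (insert 0 (Suc ` ?I))" using c(1) j by auto
  next
    fix c assume "c \<in> (\<lambda>i. (i, r i)) ` (insert 0 (Suc ` ?I))"
    then obtain i where i: "c = (i, r i)" "i = 0 \<or> i \<in> Suc ` ?I" by auto
    have "diagram (insert c D)"
      unfolding diagram_def
    proof (intro conjI allI impI)
      fix a b a' b' assume ab: "(a, b) \<in> insert c D" "a' \<le> a" "b' \<le> b"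
      show "(a', b') \<in> insert c D"
      proof (cases "(a, b) = c")
        case False
        then show ?thesis using diagramD[OF D, of a b] ab by auto
      next
        case True
        then have ab': "a = i" "b = r i" using i(1) by auto
        show ?thesis
        proof (cases "a' = i")
          case True
          then show ?thesis using ab(3) ab' i(1) r by auto
        next
          case False
          then obtain p where p: "i = Suc p" "r (Suc p) < r p" "a' \<le> p"
            using i(2) ab(2) ab'(1) by auto
          then have "b' < r a'" using ab(3) ab'(2) mono[OF p(3)] by simp
          then show ?thesis using r by simp
        qed
      qed
    qed (simp add: diagram_finite[OF D])
    then show "c \<in> addable D" using i(1) r by (simp add: addable_def)
  qed
  have fr: "finite (removable D)"
    by (rule finite_subset[OF _ diagram_finite[OF D]]) (auto simp: removable_def)
  have inj1: "inj_on (\<lambda>i. (i, r i - 1)) ?I" and inj2: "inj_on (\<lambda>i. (i, r i)) A" for A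
    by (auto simp: inj_on_def)
  have fI: "finite ?I" using fr unfolding rem by (rule finite_imageD) (rule inj1)
  have "card (addable D) = card (insert 0 (Suc ` ?I))"
    unfolding add by (rule card_image[OF inj2])
  also have "\<dots> = Suc (card ?I)" using fI by (simp add: card_image)
  also have "card ?I = card (removable D)" unfolding rem by (rule card_image[OF inj1, symmetric])
  finally show ?thesis .
qed

lemma finite_removable: "diagram D \<Longrightarrow> finite (removable D)"
  by (rule finite_subset[OF _ diagram_finite]) (auto simp: removable_def)

lemma finite_addable: "diagram D \<Longrightarrow> finite (addable D)"
  using card_addable[of D] card.infinite[of "addable D"] by fastforce

text \<open>The commutation relation between adding and removing cells, applied to the number of standard
  fillings.\<close>

lemma sum_addable:
  assumes "diagram D"
  shows "(\<Sum>c\<in>addable D. card (fillings (insert c D) {})) = Suc (card D) * card (fillings D {})"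
  using assms
proof (induction "card D" arbitrary: D)
  case 0
  then have D: "D = {}" by (simp add: diagram_finite)
  have "addable {} = {(0, 0)}"
  proof (intro equalityI subsetI)
    fix c assume "c \<in> addable {}"
    then have "diagram {c}" by (simp add: addable_def)
    then show "c \<in> {(0, 0)}" using diagramD[of "{c}" "fst c" "snd c" 0 0] by simp
  qed (auto simp: addable_def diagram_def)
  then show ?case
    using card_fillings_row[of 0 1] card_fillings_same[of "{}"] by (simp add: D insert_absorb lessThan_Suc)
next
  case (Suc n)
  note D = Suc.prems
  let ?f = "\<lambda>D. card (fillings D {})"
  have e: "diagram {}" by (simp add: diagram_def)
  have fD: "finite D" by (rule diagram_finite[OF D])
  \<comment> \<open>Removing a corner of \<open>insert c D\<close> either returns \<open>D\<close>
    or removes a corner \<open>d\<close> of \<open>D\<close> while keeping \<open>c\<close>; the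
    latter is possible exactly if \<open>c\<close> is addable to \<open>D - {d}\<close>.\<close>
  have split: "?f (insert c D) = ?f D + (\<Sum>d\<in>{d \<in> removable D. c \<in> addable (D - {d})}. ?f (insert c (D - {d})))"
    if c: "c \<in> addable D" for c
  proof -
    have c': "c \<notin> D" "diagram (insert c D)" using c by (auto simp: addable_def)
    have "removable (insert c D) = insert c {d \<in> removable D. c \<in> addable (D - {d})}"
    proof (intro equalityI subsetI)
      fix d assume d: "d \<in> removable (insert c D)"
      show "d \<in> insert c {d \<in> removable D. c \<in> addable (D - {d})}"
      proof (cases "d = c")
        case False
        then have d': "d \<in> D" "diagram (insert c D - {d})" using d by (auto simp: removable_def)
        have "diagram (D \<inter> (insert c D - {d}))" by (rule diagram_Int[OF D d'(2)])
        moreover have "D \<inter> (insert c D - {d}) = D - {d}" by auto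
        moreover have "insert c D - {d} = insert c (D - {d})" using False by auto
        ultimately show ?thesis using d' c'(1) by (auto simp: removable_def addable_def)
      qed simp
    next
      fix d assume d: "d \<in> insert c {d \<in> removable D. c \<in> addable (D - {d})}"
      show "d \<in> removable (insert c D)"
      proof (cases "d = c")
        case True
        then show ?thesis using c' D by (simp add: removable_def)
      next
        case False
        then have "insert c D - {d} = insert c (D - {d})" by auto
        then show ?thesis using d False by (auto simp: removable_def addable_def)
      qed
    qed
    moreover have "c \<notin> {d \<in> removable D. c \<in> addable (D - {d})}"
      using c'(1) by (simp add: removable_def)
    moreover have "insert c D - {d} = insert c (D - {d})"
      if "d \<in> {d \<in> removable D. c \<in> addable (D - {d})}" for d
      using that c'(1) by (auto simp: removable_def)
    moreover have "{} \<subset> insert c D" by auto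
    ultimately show ?thesis
      using card_fillings_step[OF c'(2) e] finite_removable[OF D] c'(1) by simp
  qed
  have pairs: "c \<in> addable D" if "d \<in> removable D" "c \<in> addable (D - {d})" "c \<noteq> d" for c d
  proof -
    have "diagram (D \<union> insert c (D - {d}))"
      using that D by (intro diagram_Un) (auto simp: addable_def)
    moreover have "D \<union> insert c (D - {d}) = insert c D" using that(1) by (auto simp: removable_def)
    ultimately show ?thesis using that by (simp add: addable_def)
  qed
  \<comment> \<open>The induction hypothesis for \<open>D - {d}\<close>: the cells addable there are
    \<open>d\<close> itself, which gives back \<open>D\<close>, and cells that are addable to
    \<open>D\<close> as well.\<close>
  have inner: "(\<Sum>c\<in>{c \<in> addable D. c \<in> addable (D - {d})}. ?f (insert c (D - {d}))) + ?f D = card D * ?f (D - {d})"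
    if d: "d \<in> removable D" for d
  proof -
    have d': "d \<in> D" "diagram (D - {d})" using d by (auto simp: removable_def)
    have cd: "card (D - {d}) = n" using Suc.hyps(2) d'(1) fD by simp
    have da: "d \<in> addable (D - {d})" using d' D by (simp add: addable_def insert_absorb)
    have eq: "addable (D - {d}) = insert d {c \<in> addable D. c \<in> addable (D - {d})}"
      using pairs[OF d] da by blast
    have "d \<notin> {c \<in> addable D. c \<in> addable (D - {d})}" using d'(1) by (simp add: addable_def)
    then have "(\<Sum>c\<in>addable (D - {d}). ?f (insert c (D - {d}))) =
        ?f (insert d (D - {d})) + (\<Sum>c\<in>{c \<in> addable D. c \<in> addable (D - {d})}. ?f (insert c (D - {d})))"
      using finite_addable[OF D] by (subst eq) simp
    then show ?thesis
      using Suc.hyps(1)[OF cd[symmetric] d'(2)] d'(1) Suc.hyps(2) cd by (simp add: insert_absorb)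
  qed
  have D0: "{} \<subset> D" using Suc.hyps(2) by auto
  have step: "?f D = (\<Sum>d\<in>removable D. ?f (D - {d}))"
    using card_fillings_step[OF D e D0] by simp
  let ?S = "\<lambda>c d. ?f (insert c (D - {d}))"
  have "(\<Sum>c\<in>addable D. ?f (insert c D)) =
      card (addable D) * ?f D + (\<Sum>c\<in>addable D. \<Sum>d\<in>{d \<in> removable D. c \<in> addable (D - {d})}. ?S c d)"
    by (simp add: split sum.distrib)
  also have "(\<Sum>c\<in>addable D. \<Sum>d\<in>{d \<in> removable D. c \<in> addable (D - {d})}. ?S c d) =
      (\<Sum>d\<in>removable D. \<Sum>c\<in>{c \<in> addable D. c \<in> addable (D - {d})}. ?S c d)"
    by (rule sum.swap_restrict[OF finite_addable[OF D] finite_removable[OF D]])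
  \<comment> \<open>One copy of \<open>?f D\<close> goes to each removable \<open>d\<close> and
    completes the inner sum; by \<open>card_addable\<close> exactly one copy remains.\<close>
  also have "card (addable D) * ?f D + \<dots> = ?f D +
      (\<Sum>d\<in>removable D. (\<Sum>c\<in>{c \<in> addable D. c \<in> addable (D - {d})}. ?S c d) + ?f D)"
    by (simp add: card_addable[OF D] sum.distrib)
  also have "(\<Sum>d\<in>removable D. (\<Sum>c\<in>{c \<in> addable D. c \<in> addable (D - {d})}. ?S c d) + ?f D) =
      (\<Sum>d\<in>removable D. card D * ?f (D - {d}))"
    by (rule sum.cong[OF refl]) (rule inner)
  also have "\<dots> = card D * ?f D"
    by (simp only: step sum_distrib_left)
  finally show ?case by simp
qed

section \<open>Summation over all diagrams of a given size\<close>

lemma finite_diagrams: "finite (diagrams n)"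
proof (rule finite_subset)
  show "diagrams n \<subseteq> Pow ({..<n} \<times> {..<n})"
  proof (intro subsetI PowI)
    fix D c assume D: "D \<in> diagrams n" and c: "c \<in> D"
    obtain i j where ij: "c = (i, j)" by (cases c)
    have d: "diagram D" "card D = n" using D by (auto simp: diagrams_def)
    have "(\<lambda>a. (a, j)) ` {..i} \<subseteq> D" "(\<lambda>b. (i, b)) ` {..j} \<subseteq> D"
      using diagramD[OF d(1), of i j] c ij by auto
    then have "card ((\<lambda>a. (a, j)) ` {..i}) \<le> n" "card ((\<lambda>b. (i, b)) ` {..j}) \<le> n"
      using card_mono[OF diagram_finite[OF d(1)]] d(2) by blast+
    then show "c \<in> {..<n} \<times> {..<n}" using ij by (simp add: card_image inj_on_def)
  qed
qed simp

text \<open>For empty \<open>Z\<close> this says that the squares of the numbers of standard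
  tableaux add up to n!. In the induction step a corner removed on the higher level is a cell added
  on the lower one, and \<open>sum_addable\<close> evaluates the sum over added cells.\<close>

theorem sum_fillings:
  assumes Z: "diagram Z" "card Z = m" and n: "m \<le> n"
  shows "fact m * (\<Sum>D\<in>{D \<in> diagrams n. Z \<subseteq> D}. card (fillings D Z) * card (fillings D {})) =
    fact n * card (fillings Z {})"
  using n
proof (induction n rule: dec_induct)
  case base
  have "Z = D" if "D \<in> diagrams m" "Z \<subseteq> D" for D
    using that Z by (intro card_subset_eq) (auto simp: diagrams_def diagram_finite)
  then have "{D \<in> diagrams m. Z \<subseteq> D} = {Z}"
    using Z by (auto simp: diagrams_def simp del: split_paired_All)
  then show ?case by (simp add: card_fillings_same)
next
  case (step n)
  let ?f = "\<lambda>D. card (fillings D {})" and ?g = "\<lambda>D. card (fillings D Z)"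
  let ?P = "\<lambda>n. {D \<in> diagrams n. Z \<subseteq> D}"
  have fin: "finite (?P n)" for n using finite_diagrams by simp
  have "(\<Sum>D\<in>?P (Suc n). ?g D * ?f D) = (\<Sum>D\<in>?P (Suc n). \<Sum>c\<in>removable D - Z. ?g (D - {c}) * ?f D)"
  proof (rule sum.cong[OF refl])
    fix D assume "D \<in> ?P (Suc n)"
    then have D: "diagram D" "card D = Suc n" "Z \<subseteq> D" by (auto simp: diagrams_def)
    then have "Z \<subset> D" using Z(2) step(1) by auto
    then show "?g D * ?f D = (\<Sum>c\<in>removable D - Z. ?g (D - {c}) * ?f D)"
      using card_fillings_step[OF D(1) Z(1)] by (simp add: sum_distrib_right)
  qed
  also have "\<dots> = (\<Sum>(D, c)\<in>Sigma (?P (Suc n)) (\<lambda>D. removable D - Z). ?g (D - {c}) * ?f D)"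
    by (rule sum.Sigma[OF fin]) (auto simp: diagrams_def finite_removable)
  also have "\<dots> = (\<Sum>(D, c)\<in>Sigma (?P n) addable. ?g D * ?f (insert c D))"
  proof (rule sum.reindex_bij_witness[of _ "\<lambda>(D, c). (insert c D, c)" "\<lambda>(D, c). (D - {c}, c)"])
    fix p assume "p \<in> Sigma (?P (Suc n)) (\<lambda>D. removable D - Z)"
    then obtain D c where p: "p = (D, c)" "diagram D" "card D = Suc n" "Z \<subseteq> D" "c \<in> D" "diagram (D - {c})" "c \<notin> Z"
      by (auto simp: diagrams_def removable_def)
    show "(case (case p of (D, c) \<Rightarrow> (D - {c}, c)) of (D, c) \<Rightarrow> (insert c D, c)) = p"
      using p by auto
    show "(case p of (D, c) \<Rightarrow> (D - {c}, c)) \<in> Sigma (?P n) addable"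
      using p by (auto simp: diagrams_def addable_def insert_absorb diagram_finite)
    show "(case (case p of (D, c) \<Rightarrow> (D - {c}, c)) of (D, c) \<Rightarrow> ?g D * ?f (insert c D)) =
        (case p of (D, c) \<Rightarrow> ?g (D - {c}) * ?f D)"
      using p by (simp add: insert_absorb)
  next
    fix p assume "p \<in> Sigma (?P n) addable"
    then obtain D c where p: "p = (D, c)" "diagram D" "card D = n" "Z \<subseteq> D" "c \<notin> D" "diagram (insert c D)"
      by (auto simp: diagrams_def addable_def)
    then have "insert c D - {c} = D" by auto
    then show "(case (case p of (D, c) \<Rightarrow> (insert c D, c)) of (D, c) \<Rightarrow> (D - {c}, c)) = p"
      "(case p of (D, c) \<Rightarrow> (insert c D, c)) \<in> Sigma (?P (Suc n)) (\<lambda>D. removable D - Z)"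
      using p by (auto simp: diagrams_def removable_def diagram_finite)
  qed
  also have "\<dots> = (\<Sum>D\<in>?P n. \<Sum>c\<in>addable D. ?g D * ?f (insert c D))"
    by (rule sum.Sigma[OF fin, symmetric]) (auto simp: diagrams_def finite_addable)
  also have "\<dots> = (\<Sum>D\<in>?P n. ?g D * (Suc n * ?f D))"
    by (rule sum.cong[OF refl]) (auto simp: sum_addable diagrams_def simp flip: sum_distrib_left)
  also have "\<dots> = Suc n * (\<Sum>D\<in>?P n. ?g D * ?f D)"
    unfolding sum_distrib_left by (rule sum.cong[OF refl]) (simp only: mult_ac)
  finally show ?case
    using step.IH by (simp add: algebra_simps)
qed

lemma diagram_young:
  assumes D: "diagram D"
  shows "\<exists>l. is_partition l (card D) \<and> young l = D"
proof -
  obtain r where r: "\<And>i j. (i, j) \<in> D \<longleftrightarrow> j < r i" and anti: "antimono r"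
    using diagram_rows[OF D] by metis
  define h where "h = card {i. 0 < r i}"
  have "{i. 0 < r i} \<subseteq> fst ` D" using r by force
  then have fin: "finite {i. 0 < r i}" using diagram_finite[OF D] by (meson finite_imageI finite_subset)
  have dc: "0 < r a" if "0 < r i" "a \<le> i" for i a
    using antimonoD[OF anti that(2)] that(1) by simp
  have h: "i < h \<longleftrightarrow> 0 < r i" for i
  proof
    assume "i < h"
    then have "i < card {i. 0 < r i}" by (simp add: h_def)
    moreover have "b \<in> {i. 0 < r i}" if "a \<in> {i. 0 < r i}" "b \<le> a" for a b
      using dc[of a b] that by simp
    ultimately have "i \<in> {i. 0 < r i}"
      using down_closed_nat_mem[OF fin] by metis
    then show "0 < r i" by simp
  next
    assume "0 < r i"
    then have "{..i} \<subseteq> {i. 0 < r i}" using dc by auto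
    then show "i < h" using card_mono[OF fin, of "{..i}"] by (simp add: h_def Suc_le_eq)
  qed
  let ?l = "map r [0..<h]"
  have y: "young ?l = D"
    using r h by (auto simp: young_def)
  have "sorted_wrt (\<ge>) ?l"
    by (auto simp: sorted_wrt_iff_nth_less intro!: antimonoD[OF anti])
  moreover have "r i \<noteq> 0" if "i < h" for i using h[of i] that by simp
  then have "0 \<notin> set ?l" by fastforce
  moreover have "sum_list ?l = card D" using card_young[of ?l] y by simp
  ultimately show ?thesis using y by (auto simp: is_partition_def)
qed

section \<open>Set partitions and falling factorials\<close>

text \<open>The recursion of the Stirling numbers: a new element is a block of its own or joins one
  of the blocks of a partition that already has \<open>t\<close> of them.\<close>

lemma card_partition_on:
  assumes "finite A"
  shows "card {P. partition_on A P \<and> card P = t} = Stirling (card A) t"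
  using assms
proof (induction A arbitrary: t rule: finite_induct)
  case empty
  have "{P :: 'a set set. partition_on {} P \<and> card P = t} = (if t = 0 then {{}} else {})"
    by (auto simp: partition_on_empty)
  then show ?case by (simp only:) (cases t; simp)
next
  case (insert a A)
  let ?Q = "\<lambda>A t. {P. partition_on A P \<and> card P = t}"
  have fin: "finite (?Q B t)" if "finite B" for B :: "'a set" and t
    by (rule finite_subset[OF _ finitely_many_partition_on[OF that]]) auto
  have finP: "finite P" if "partition_on A P" for P
    by (rule finite_elements[OF insert(1) that])
  show ?case
  proof (cases t)
    case 0
    have "card P \<noteq> 0" if P: "partition_on (insert a A) P" for P
    proof -
      have "finite P" using finite_elements[OF _ P] insert(1) by simp
      then show ?thesis using P by (auto simp: partition_on_def)
    qed
    then have "?Q (insert a A) 0 = {}" by auto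
    then show ?thesis using insert(1,2) 0 by (simp only:) simp
  next
    case (Suc k)
    let ?new = "(\<lambda>P. insert {a} P) ` ?Q A k"
    let ?ext = "\<lambda>P. (\<lambda>p. insert (insert a p) (P - {p})) ` P"
    have a_notin: "a \<notin> p" if "partition_on A P" "p \<in> P" for P p
      using that insert(2) by (auto simp: partition_on_def)
    have new: "insert {a} P \<in> ?Q (insert a A) (Suc k)" if "P \<in> ?Q A k" for P
    proof -
      have P: "partition_on A P" "card P = k" using that by auto
      have "{a} \<notin> P" using a_notin[OF P(1)] by blast
      moreover have "partition_on (insert a A) (insert {a} P)"
        using P(1) insert(2) by (subst partition_on_insert) (auto simp: partition_on_def disjnt_def)
      ultimately show ?thesis using P(2) finP[OF P(1)] by simp
    qed
    have ext: "insert (insert a p) (P - {p}) \<in> ?Q (insert a A) (Suc k)"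
      if "P \<in> ?Q A (Suc k)" "p \<in> P" for P p
    proof -
      have P: "partition_on A P" "card P = Suc k" using that by auto
      have Pp: "partition_on (A - p) (P - {p})" "p \<subseteq> A"
        using P(1) that(2) partition_on_insert[of p "P - {p}" A]
        by (auto simp: insert_absorb partition_on_def disjoint_def disjnt_def)
      have "insert a p \<notin> P - {p}" using a_notin[OF P(1)] by blast
      moreover have "insert a A - insert a p = A - p" using insert(2) by auto
      then have "partition_on (insert a A) (insert (insert a p) (P - {p}))"
        using Pp insert(2) by (subst partition_on_insert) (auto simp: partition_on_def disjnt_def)
      ultimately show ?thesis using P(2) finP[OF P(1)] that(2) by simp
    qed
    have eq: "?Q (insert a A) (Suc k) = ?new \<union> (\<Union>P\<in>?Q A (Suc k). ?ext P)"
    proof (intro equalityI subsetI)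
      fix Q assume "Q \<in> ?Q (insert a A) (Suc k)"
      then have Q: "partition_on (insert a A) Q" "card Q = Suc k" by auto
      have fQ: "finite Q" using finite_elements[OF _ Q(1)] insert(1) by simp
      obtain q where q: "q \<in> Q" "a \<in> q" using Q(1) by (auto simp: partition_on_def)
      have Qq: "partition_on (insert a A - q) (Q - {q})" "q \<subseteq> insert a A"
        using Q(1) q(1) partition_on_insert[of q "Q - {q}" "insert a A"]
        by (auto simp: insert_absorb partition_on_def disjoint_def disjnt_def)
      have cQ: "card (Q - {q}) = k" using Q(2) q(1) fQ by simp
      show "Q \<in> ?new \<union> (\<Union>P\<in>?Q A (Suc k). ?ext P)"
      proof (cases "q = {a}")
        case True
        then have "insert a A - q = A" using insert(2) by auto
        then have "Q - {q} \<in> ?Q A k" using Qq(1) cQ by simp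
        moreover have "Q = insert {a} (Q - {q})" using q True by auto
        ultimately show ?thesis by blast
      next
        case False
        define p where "p = q - {a}"
        have p: "p \<noteq> {}" "p \<subseteq> A" "insert a p = q" using False q Qq(2) by (auto simp: p_def)
        have disj: "x \<inter> q = {}" if "x \<in> Q - {q}" for x
          using Q(1) q(1) that by (auto simp: partition_on_def disjoint_def)
        have pn: "p \<notin> Q - {q}" using disj[of p] p by auto
        have "A - p = insert a A - q" using insert(2) p by auto
        then have "partition_on A (insert p (Q - {q}))"
          using Qq(1) p disj by (subst partition_on_insert) (auto simp: disjnt_def)
        moreover have "card (insert p (Q - {q})) = Suc k" using pn cQ fQ by simp
        moreover have "Q = insert (insert a p) (insert p (Q - {q}) - {p})"
          using pn p(3) q(1) by auto
        ultimately show ?thesis by blast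
      qed
    next
      fix Q assume "Q \<in> ?new \<union> (\<Union>P\<in>?Q A (Suc k). ?ext P)"
      then show "Q \<in> ?Q (insert a A) (Suc k)" using new ext by blast
    qed
    have inj_new: "inj_on (\<lambda>P. insert {a} P) (?Q A k)"
    proof (rule inj_onI)
      fix P R assume PR: "P \<in> ?Q A k" "R \<in> ?Q A k" "insert {a} P = insert {a} R"
      have "{a} \<notin> P" "{a} \<notin> R" using PR a_notin by blast+
      then show "P = R" using PR(3) by (metis Diff_insert_absorb)
    qed
    \<comment> \<open>The block that contains \<open>a\<close> tells which block was enlarged, so
      \<open>P\<close> and \<open>p\<close> can be read off from the result.\<close>
    have recover: "P = insert p (Q - {q}) \<and> p = q - {a}"
      if "partition_on A P" "p \<in> P" "Q = insert (insert a p) (P - {p})" "q \<in> Q" "a \<in> q" for P p Q q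
    proof -
      have "q = insert a p" using that(3-5) a_notin[OF that(1)] by blast
      moreover have "insert a p \<notin> P" using a_notin[OF that(1)] by blast
      then have "Q - {insert a p} = P - {p}" using that(3) by blast
      ultimately show ?thesis using that(2) a_notin[OF that(1,2)] by auto
    qed
    have inj_ext: "inj_on (\<lambda>p. insert (insert a p) (P - {p})) P" if "partition_on A P" for P
    proof (rule inj_onI)
      fix p r assume pr: "p \<in> P" "r \<in> P" "insert (insert a p) (P - {p}) = insert (insert a r) (P - {r})"
      show "p = r"
        using recover[OF that pr(1) refl, of "insert a p"] recover[OF that pr(2,3), of "insert a p"]
        by simp
    qed
    have disj_ext: "?ext P \<inter> ?ext R = {}" if "partition_on A P" "partition_on A R" "P \<noteq> R" for P R
    proof (rule equals0I)
      fix Q assume "Q \<in> ?ext P \<inter> ?ext R"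
      then have Q: "Q \<in> ?ext P" "Q \<in> ?ext R" by (simp_all only: Int_iff)
      obtain p where p: "Q = insert (insert a p) (P - {p})" "p \<in> P" using Q(1) by (rule imageE)
      obtain r where r: "Q = insert (insert a r) (R - {r})" "r \<in> R" using Q(2) by (rule imageE)
      note pr = p(2) r(2) p(1) r(1)
      have q: "insert a p \<in> Q" "a \<in> insert a p" using pr(3) by auto
      show False
        using recover[OF that(1) pr(1,3) q] recover[OF that(2) pr(2,4) q] that(3) by metis
    qed
    have disj: "?new \<inter> (\<Union>P\<in>?Q A (Suc k). ?ext P) = {}"
    proof (rule ccontr)
      assume "\<not> ?thesis"
      then obtain P R p where P: "partition_on A P" "p \<in> P" "insert {a} R = insert (insert a p) (P - {p})"
        by blast
      have "{a} = insert a p" using P a_notin[OF P(1)] by blast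
      then have "p = {}" using a_notin[OF P(1,2)] by auto
      then show False using P(1,2) by (simp add: partition_on_def)
    qed
    have "card (?Q (insert a A) (Suc k)) = card ?new + card (\<Union>P\<in>?Q A (Suc k). ?ext P)"
      unfolding eq by (rule card_Un_disjoint) (use fin[OF insert(1)] finP disj in auto)
    also have "card ?new = Stirling (card A) k"
      using insert.IH by (simp add: card_image[OF inj_new])
    also have "card (\<Union>P\<in>?Q A (Suc k). ?ext P) = (\<Sum>P\<in>?Q A (Suc k). card (?ext P))"
      by (rule card_UN_disjoint[OF fin[OF insert(1)]]) (use finP disj_ext in auto)
    also have "\<dots> = (\<Sum>P\<in>?Q A (Suc k). Suc k)"
      by (rule sum.cong) (auto simp: card_image[OF inj_ext])
    also have "\<dots> = Suc k * Stirling (card A) (Suc k)"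
      using insert.IH by simp
    finally show ?thesis using insert(1,2) Suc by simp
  qed
qed

lemma bell_le_eq: "bell_le l n = (\<Sum>t\<le>n. Stirling l t)"
proof -
  have fin: "finite {P. partition_on {1..l} P \<and> card P = t}" for t
    by (rule finite_subset[OF _ finitely_many_partition_on[of "{1..l}"]]) auto
  have "{P. partition_on {1..l} P \<and> card P \<le> n} = (\<Union>t\<le>n. {P. partition_on {1..l} P \<and> card P = t})" by auto
  then have "bell_le l n = (\<Sum>t\<le>n. card {P. partition_on {1..l} P \<and> card P = t})"
    unfolding bell_le_def by (simp only:) (rule card_UN_disjoint; use fin in auto)
  then show ?thesis using card_partition_on[of "{1..l}"] by simp
qed

lemma bell_le_eq_bell:
  assumes "l \<le> n"
  shows "bell_le l n = bell l"
proof -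
  have "card P \<le> n" if P: "partition_on {1..l} P" for P
  proof (rule ccontr)
    assume "\<not> card P \<le> n"
    then have "card {Q. partition_on {1..l} Q \<and> card Q = card P} = 0"
      using assms card_partition_on[of "{1..l}" "card P"] by simp
    moreover have "finite {Q. partition_on {1..l} Q \<and> card Q = card P}"
      by (rule finite_subset[OF _ finitely_many_partition_on[of "{1..l}"]]) auto
    ultimately show False using P by auto
  qed
  then have "{P. partition_on {1..l} P \<and> card P \<le> n} = {P. partition_on {1..l} P}" by auto
  then show ?thesis by (simp add: bell_def bell_le_def)
qed

text \<open>Truncated subtraction does no harm: for \<open>x < t\<close> the factor with
  \<open>i = x\<close> is 0.\<close>

definition falling :: "nat \<Rightarrow> nat \<Rightarrow> nat"
  where "falling x t = (\<Prod>i<t. x - i)"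

lemma falling_Suc: "falling x (Suc t) = falling x t * (x - t)"
  by (simp add: falling_def)

lemma falling_eq_0: "x < t \<Longrightarrow> falling x t = 0"
  unfolding falling_def by (rule prod_zero) auto

lemma falling_Suc_Suc: "falling (Suc x) (Suc t) = Suc x * falling x t"
  unfolding falling_def by (subst prod.lessThan_Suc_shift) simp

lemma mult_falling: "x * falling x t = falling x (Suc t) + t * falling x t"
proof (cases "t \<le> x")
  case True
  then obtain d where "x = t + d" using le_Suc_ex by blast
  then show ?thesis by (simp add: falling_Suc algebra_simps)
qed (simp add: falling_eq_0)

lemma card_distinct_lists:
  assumes "finite A"
  shows "card {w. length w = t \<and> distinct w \<and> set w \<subseteq> A} = falling (card A) t"
proof (cases "t \<le> card A")
  case True
  have "\<Prod>{card A - t + 1..card A} = (\<Prod>i<t. card A - i)"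
    by (rule prod.reindex_bij_witness[of _ "\<lambda>i. card A - i" "\<lambda>i. card A - i"]) (use True in auto)
  then show ?thesis using card_lists_distinct_length_eq[OF assms True] by (simp add: falling_def)
next
  case False
  have "length w \<le> card A" if "distinct w" "set w \<subseteq> A" for w
    using card_mono[OF assms that(2)] distinct_card[OF that(1)] by simp
  then have "{w. length w = t \<and> distinct w \<and> set w \<subseteq> A} = {}" using False by auto
  then show ?thesis using False by (simp only:) (simp add: falling_eq_0)
qed

lemma falling_fact: "m \<le> n \<Longrightarrow> fact m * falling n (n - m) = fact n"
proof (induction n rule: dec_induct)
  case (step n)
  then have "Suc n - m = Suc (n - m)" by simp
  then show ?case using step by (simp add: falling_Suc_Suc algebra_simps)
qed (simp add: falling_def)

text \<open>Powers in the basis of falling factorials. Cutting the sum at a common bound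
  \<open>M\<close> gives one range of summation for the fixed point counts of all
  permutations.\<close>

lemma power_Stirling:
  assumes "x \<le> M"
  shows "x ^ k = (\<Sum>t\<le>M. Stirling k t * falling x t)"
proof (induction k)
  case 0
  have "(\<Sum>t\<le>M. Stirling 0 t * falling x t) = (\<Sum>t\<le>M. if t = 0 then 1 else 0)"
    by (rule sum.cong) (auto simp: falling_def gr0_conv_Suc)
  then show ?case by simp
next
  case (Suc k)
  have "x ^ Suc k = (\<Sum>t\<le>M. Stirling k t * (x * falling x t))"
    by (simp add: Suc sum_distrib_left mult_ac)
  also have "\<dots> = (\<Sum>t\<le>M. Stirling k t * falling x (Suc t)) + (\<Sum>t\<le>M. t * Stirling k t * falling x t)"
    unfolding sum.distrib[symmetric] by (rule sum.cong) (simp_all add: mult_falling algebra_simps)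
  also have "\<dots> = (\<Sum>t\<le>Suc M. Stirling (Suc k) t * falling x t)"
  proof -
    \<comment> \<open>The term at \<open>Suc M\<close> vanishes because \<open>x\<close> is at most
      \<open>M\<close>; adding it allows the shift by one.\<close>
    have "(\<Sum>t\<le>M. t * Stirling k t * falling x t) = (\<Sum>t\<le>Suc M. t * Stirling k t * falling x t)"
      using assms by (simp add: falling_eq_0)
    also have "\<dots> = (\<Sum>t\<le>M. Suc t * Stirling k (Suc t) * falling x (Suc t))"
      by (subst sum.atMost_Suc_shift) simp
    finally have "(\<Sum>t\<le>M. t * Stirling k t * falling x t) =
        (\<Sum>t\<le>M. Suc t * Stirling k (Suc t) * falling x (Suc t))" .
    moreover have "(\<Sum>t\<le>Suc M. Stirling (Suc k) t * falling x t) =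
        (\<Sum>t\<le>M. Stirling (Suc k) (Suc t) * falling x (Suc t))"
      by (subst sum.atMost_Suc_shift) simp
    ultimately show ?thesis by (simp add: sum.distrib algebra_simps)
  qed
  also have "\<dots> = (\<Sum>t\<le>M. Stirling (Suc k) t * falling x t)"
    using assms by (simp add: falling_eq_0)
  finally show ?case .
qed

text \<open>The expansion of the next power of \<open>Suc x\<close> has no constant term, and all
  its other terms contain the factor \<open>Suc x\<close>, which is cancelled. This is the origin of
  the shifted indices \<open>k + 1\<close> and \<open>t + 1\<close>.\<close>

lemma Suc_power_Stirling:
  assumes "x \<le> M"
  shows "Suc x ^ k = (\<Sum>t\<le>M. Stirling (Suc k) (Suc t) * falling x t)"
proof -
  have "Suc x ^ Suc k = (\<Sum>t\<le>Suc M. Stirling (Suc k) t * falling (Suc x) t)"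
    by (rule power_Stirling) (use assms in simp)
  also have "\<dots> = (\<Sum>t\<le>M. Stirling (Suc k) (Suc t) * falling (Suc x) (Suc t))"
    by (subst sum.atMost_Suc_shift) simp
  also have "\<dots> = Suc x * (\<Sum>t\<le>M. Stirling (Suc k) (Suc t) * falling x t)"
    by (simp only: falling_Suc_Suc sum_distrib_left mult_ac)
  finally have "Suc x * Suc x ^ k = Suc x * (\<Sum>t\<le>M. Stirling (Suc k) (Suc t) * falling x t)"
    by (simp only: power_Suc)
  then show ?thesis by (simp only: Suc_mult_cancel1)
qed

section \<open>Dimensions of homomorphism spaces\<close>

lemma is_partitionD:
  assumes "is_partition l n"
  shows "sorted_wrt (\<ge>) l" "0 \<notin> set l" "sum_list l = n"
  using assms by (auto simp: is_partition_def)

lemma finite_partitions: "finite {l. is_partition l n}"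
proof (rule finite_subset)
  have "length l \<le> sum_list l" if "0 \<notin> set l" for l :: "nat list"
    using that by (induction l) auto
  moreover have "x \<le> sum_list l" if "x \<in> set l" for x and l :: "nat list"
    using that by (intro member_le_sum_list) auto
  ultimately show "{l. is_partition l n} \<subseteq> {l. set l \<subseteq> {..n} \<and> length l \<le> n}"
    unfolding is_partition_def by auto
qed (rule finite_lists_length_le, simp)

text \<open>\<open>num_std\<close> sees only the difference of the two shapes, so containment of the
  row in \<open>l\<close> has to be imposed separately.\<close>

definition skew_count :: "nat list \<Rightarrow> nat \<Rightarrow> nat"
  where "skew_count l m = (if young (one_part m) \<subseteq> young l then num_std l (one_part m) else 0)"

lemma num_std_one_part: "m \<le> n \<Longrightarrow> num_std (one_part n) (one_part m) = 1"
  by (simp add: num_std_eq young_one_part card_fillings_row)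

text \<open>\<open>sum_fillings\<close> for a one-row shape, which has a single standard
  tableau.\<close>

lemma sum_skew_count:
  assumes "m \<le> n"
  shows "fact n \<le> fact m * (\<Sum>l\<in>{l. is_partition l n}. skew_count l m * num_std l [])"
proof -
  let ?Z = "{0 :: nat} \<times> {..<m}" and ?P = "{l. is_partition l n}"
  let ?h = "\<lambda>D. if ?Z \<subseteq> D then card (fillings D ?Z) * card (fillings D {}) else 0"
  have Z: "young (one_part 0) = {}" "young [] = {}" by (auto simp: young_def one_part_def)
  have "card (fillings ?Z {}) = 1" using card_fillings_row[of 0 m] by simp
  then have "fact n = fact m * (\<Sum>D\<in>{D \<in> diagrams n. ?Z \<subseteq> D}. card (fillings D ?Z) * card (fillings D {}))"
    using sum_fillings[OF diagram_row _ assms, of m] by simp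
  also have "(\<Sum>D\<in>{D \<in> diagrams n. ?Z \<subseteq> D}. card (fillings D ?Z) * card (fillings D {})) = (\<Sum>D\<in>diagrams n. ?h D)"
    using finite_diagrams by (simp add: sum.inter_filter)
  also have "\<dots> \<le> (\<Sum>D\<in>young ` ?P. ?h D)"
  \<comment> \<open>Passing from diagrams to the image of \<open>young\<close> and from there to
    lists can only enlarge a sum of natural numbers, which is the direction wanted.\<close>
  proof (rule sum_mono2)
    show "diagrams n \<subseteq> young ` ?P"
      using diagram_young by (fastforce simp: diagrams_def)
  qed (auto simp: finite_partitions)
  also have "\<dots> \<le> (\<Sum>l\<in>?P. (?h \<circ> young) l)"
    by (rule sum_image_le) (auto simp: finite_partitions)
  also have "\<dots> = (\<Sum>l\<in>?P. skew_count l m * num_std l [])"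
    by (rule sum.cong[OF refl]) (auto simp: skew_count_def num_std_eq young_one_part Z)
  finally show ?thesis by simp
qed

lemma iso_mod_meet:
  assumes S: "is_module G \<rho> S" and T: "is_module G \<tau> T" and U: "is_module G \<kappa> U"
    and iso: "iso_mod G \<rho> S \<kappa> U" "iso_mod G \<tau> T \<kappa> U"
  shows "iso_mod G \<rho> S \<tau> T"
proof -
  obtain f g where f: "f \<in> Hom_mod G \<rho> S \<kappa> U" "bij_betw f S U" and g: "g \<in> Hom_mod G \<tau> T \<kappa> U" "bij_betw g T U"
    using iso by (auto simp: iso_mod_def)
  let ?h = "\<lambda>w. if w \<in> U then inv_into T g w else 0"
  have h: "?h \<in> Hom_mod G \<kappa> U \<tau> T" by (rule Hom_mod_inverse[OF T U g])
  have "bij_betw ?h U T"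
    using bij_betw_inv_into[OF g(2)] by (rule bij_betw_cong[THEN iffD1, rotated]) simp
  then have "bij_betw (?h \<circ> f) S T" by (rule bij_betw_trans[OF f(2)])
  then have "bij_betw (\<lambda>v. if v \<in> S then ?h (f v) else 0) S T"
    by (rule bij_betw_cong[THEN iffD1, rotated]) simp
  then show ?thesis
    unfolding iso_mod_def using Hom_mod_comp[OF S f(1) h] by blast
qed

text \<open>A shape claims as many summands of a decomposition as its Hom space has dimensions, each
  of the dimension of its Specht module; different shapes claim different summands, and all summands
  together have dimension \<open>card X\<close>.\<close>

lemma sum_dim_Hom_specht:
  fixes act :: "(nat \<Rightarrow> nat) \<Rightarrow> 'x \<Rightarrow> 'x"
  assumes "perm_set n act X"
  shows "(\<Sum>l\<in>{l. is_partition l n}. hs.dim (Hom_mod (Sym n) tabloid_action (specht l) (perm_action act)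
      (supported X :: ('x \<Rightarrow> 'a::field_char_0) set)) * fs.dim (specht l :: (nat set list \<Rightarrow> 'a) set)) \<le> card X"
proof -
  interpret perm_set n act X by fact
  let ?a = "perm_action act :: ('x, 'a) action"
  let ?S = "\<lambda>l. specht l :: (nat set list \<Rightarrow> 'a) set" and ?P = "{l. is_partition l n}"
  obtain D where D: "irreducible_decomposition (Sym n) ?a (supported X) D"
    using decomposition_exists[OF module_supported] by auto
  interpret D: decomposed_module "Sym n" act "supported X :: ('x \<Rightarrow> 'a) set" D
    by unfold_locales fact
  let ?I = "\<lambda>l. {U \<in> D. iso_mod (Sym n) tabloid_action (?S l) ?a U}"
  have "hs.dim (Hom_mod (Sym n) tabloid_action (?S l) ?a (supported X)) * fs.dim (?S l) = (\<Sum>U\<in>?I l. fs.dim U)"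
    if "l \<in> ?P" for l
  proof -
    have l: "sorted_wrt (\<ge>) l" "0 \<notin> set l" "sum_list l = n" using that is_partitionD by auto
    have "hs.dim (Hom_mod (Sym n) tabloid_action (?S l) ?a (supported X)) = card (?I l)"
      unfolding tabloid_action_def
      by (rule D.dim_Hom_eq_card[OF specht_irreducible[OF l(1,2), unfolded l(3) tabloid_action_def]])
         (rule specht_Hom_scalar[OF l(1,2), unfolded l(3) tabloid_action_def])
    moreover have "fs.dim U = fs.dim (?S l)" if "U \<in> ?I l" for U
      using that D.module_D
      by (intro iso_mod_dim[OF perm_set_tabloids[of l, unfolded l(3)]
            specht_module[of l, unfolded l(3) tabloid_action_def] specht_subset])
         (auto simp: tabloid_action_def)
    ultimately show ?thesis by simp
  qed
  then have "(\<Sum>l\<in>?P. hs.dim (Hom_mod (Sym n) tabloid_action (?S l) ?a (supported X)) * fs.dim (?S l)) =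
      (\<Sum>l\<in>?P. \<Sum>U\<in>?I l. fs.dim U)" by simp
  also have "\<dots> = (\<Sum>U\<in>(\<Union>l\<in>?P. ?I l). fs.dim U)"
  proof (rule sum.UNION_disjoint[symmetric, OF finite_partitions])
    show "\<forall>l\<in>?P. finite (?I l)" using D.finite_D by simp
    show "\<forall>l\<in>?P. \<forall>m\<in>?P. l \<noteq> m \<longrightarrow> ?I l \<inter> ?I m = {}"
    proof (intro ballI impI equals0I)
      fix l m U assume lm: "l \<in> ?P" "m \<in> ?P" "l \<noteq> m" and "U \<in> ?I l \<inter> ?I m"
      then have U: "U \<in> D" "iso_mod (Sym n) tabloid_action (?S l) ?a U" "iso_mod (Sym n) tabloid_action (?S m) ?a U"
        by auto
      have l: "sorted_wrt (\<ge>) l" "0 \<notin> set l" "sum_list l = n"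
        and m: "sorted_wrt (\<ge>) m" "0 \<notin> set m" "sum_list m = n" using lm is_partitionD by auto
      have "iso_mod (Sym n) tabloid_action (?S l) tabloid_action (?S m)"
        by (rule iso_mod_meet[OF specht_module[of l, unfolded l(3)] specht_module[of m, unfolded m(3)]
              D.module_D[OF U(1)] U(2,3)])
      then have "l = m"
        using specht_iso_imp_eq[OF l(1,2) m(1,2)] l(3) m(3) by metis
      then show False using lm(3) by simp
    qed
  qed
  also have "\<dots> \<le> (\<Sum>U\<in>D. fs.dim U)"
    by (rule sum_mono2) (auto simp: D.finite_D)
  also have "\<dots> = card X" by (rule sum_dim_decomposition[OF D])
  finally show ?thesis .
qed

text \<open>Allows the dimension to be cancelled from an inequality between products.\<close>

lemma dim_specht_pos:
  assumes "sorted_wrt (\<ge>) l" "0 \<notin> set l"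
  shows "0 < fs.dim (specht l :: (nat set list \<Rightarrow> 'a::field_char_0) set)"
proof -
  interpret perm_set "sum_list l" "\<lambda>\<sigma>. map ((`) \<sigma>)" "tabloids l"
    by (rule perm_set_tabloids)
  obtain t where t: "tableau l t" using tableau_exists by auto
  have "polytabloid l t \<noteq> (0 :: nat set list \<Rightarrow> 'a)"
    using polytabloid_diagonal[OF t, where ?'a = 'a] by auto
  then have "card {polytabloid l t :: nat set list \<Rightarrow> 'a} \<le> fs.dim (specht l :: (nat set list \<Rightarrow> 'a) set)"
    using polytabloid_in_specht[OF t]
    by (intro fs.card_le_dim[of _ _ "delta ` tabloids l"])
       (auto intro: subsetD[OF supported_subset_span[OF finite_X]] subsetD[OF specht_subset])
  then show ?thesis by simp
qed

text \<open>The lower bounds for the multiplicities and for the dimensions of the Specht modules are all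
  attained, because they already add up to the dimension of the permutation module.\<close>

theorem dim_Hom_inj_words:
  assumes l: "is_partition l n" and t: "t \<le> n"
  shows "hs.dim (Hom_mod (Sym n) tabloid_action (specht l :: (nat set list \<Rightarrow> 'a::field_char_0) set)
    tensor_action (supported (inj_words n t))) = skew_count l (n - t)"
proof -
  let ?P = "{l. is_partition l n}"
  define d where "d l = hs.dim (Hom_mod (Sym n) tabloid_action (specht l :: (nat set list \<Rightarrow> 'a) set)
    tensor_action (supported (inj_words n t)))" for l
  define s where "s l = fs.dim (specht l :: (nat set list \<Rightarrow> 'a) set)" for l
  define b where "b l = skew_count l (n - t)" for l
  have bd: "b l \<le> d l" if "l \<in> ?P" for l
  proof (cases "young (one_part (n - t)) \<subseteq> young l")
    case True
    then show ?thesis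
      using num_std_le_dim_Hom[OF True, where ?'a = 'a] is_partitionD(3)[of l n] that t
      by (simp add: b_def d_def skew_count_def)
  qed (simp add: b_def skew_count_def)
  have fs': "num_std l [] \<le> s l" for l
    unfolding s_def by (rule num_std_le_dim_specht)
  have sp: "0 < s l" if "l \<in> ?P" for l
    using dim_specht_pos is_partitionD that unfolding s_def by blast
  have card_X: "card (inj_words n t) = falling n t"
    using card_distinct_lists[of "{1..n}" t] by (simp add: inj_words_def)
  \<comment> \<open>The decomposition bounds the left side by the number of injective words, and
    Young's lattice bounds that number by the tableau counts.\<close>
  have "fact (n - t) * (\<Sum>l\<in>?P. d l * s l) \<le> fact (n - t) * falling n t"
    using sum_dim_Hom_specht[OF perm_set_inj_words, of n t, where ?'a = 'a, folded tensor_action_def]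
    by (simp add: card_X d_def s_def)
  also have "\<dots> = fact n"
    using falling_fact[of "n - t" n] t by simp
  also have "\<dots> \<le> fact (n - t) * (\<Sum>l\<in>?P. b l * num_std l [])"
    unfolding b_def by (rule sum_skew_count) simp
  finally have le: "(\<Sum>l\<in>?P. d l * s l) \<le> (\<Sum>l\<in>?P. b l * num_std l [])" by simp
  have mono: "b l * num_std l [] \<le> d l * s l" if "l \<in> ?P" for l
    using bd[OF that] fs' by (rule mult_le_mono)
  have "b l * num_std l [] = d l * s l"
  proof (rule sum_mono_inv[where f = "\<lambda>l. b l * num_std l []" and g = "\<lambda>l. d l * s l" and I = ?P and i = l])
    show "(\<Sum>l\<in>?P. b l * num_std l []) = (\<Sum>l\<in>?P. d l * s l)"
      by (rule antisym[OF sum_mono[OF mono] le])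
  qed (use mono l finite_partitions in auto)
  \<comment> \<open>Replacing the tableau count by \<open>s l\<close> gives both products the same
    positive factor.\<close>
  moreover have "b l * num_std l [] \<le> b l * s l" using fs' by simp
  ultimately have "d l * s l \<le> b l * s l" by simp
  then have "d l \<le> b l" using sp[of l] l by simp
  then show ?thesis using bd[of l] l unfolding b_def d_def by simp
qed

text \<open>The points beyond \<open>N\<close> are all fixed. In the half-integer case
  \<open>n - N\<close> is 1, which is the summand 1 next to the fixed point count.\<close>

lemma Sym_fixed:
  assumes \<sigma>: "\<sigma> \<in> Sym N" and N: "N \<le> n"
  shows "card {i \<in> {1..n}. \<sigma> i = i} = fixpts N \<sigma> + (n - N)"
proof -
  have "{i \<in> {1..n}. \<sigma> i = i} = {i \<in> {1..N}. \<sigma> i = i} \<union> {N + 1..n}"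
    using \<sigma> N by (auto simp: Sym_def permutes_def)
  also have "card \<dots> = card {i \<in> {1..N}. \<sigma> i = i} + card {N + 1..n}"
    by (rule card_Un_disjoint) auto
  finally show ?thesis by (simp add: fixpts_def)
qed

section \<open>Fixed words and tensor powers\<close>

lemma map_eq_self_iff: "map \<sigma> w = w \<longleftrightarrow> (\<forall>x\<in>set w. \<sigma> x = x)"
  by (induction w) auto

definition words :: "nat \<Rightarrow> nat \<Rightarrow> nat list set"
  where "words n k = {w. length w = k \<and> set w \<subseteq> {1..n}}"

lemma tensor_power_eq: "tensor_power n k = supported (words n k)"
  by (simp add: tensor_power_def supported_def words_def)

lemma perm_set_words:
  assumes "N \<le> n"
  shows "perm_set N map (words n k)"
proof
  show "finite (words n k)"
    using finite_lists_length_eq[of "{1..n}" k] by (simp add: words_def conj_commute)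
  fix \<sigma> w assume "\<sigma> \<in> Sym N" "w \<in> words n k"
  moreover from this(1) have "\<sigma> permutes {1..n}"
    using assms permutes_subset[of \<sigma> "{1..N}" "{1..n}"] by (simp add: Sym_def)
  ultimately show "map \<sigma> w \<in> words n k"
    using permutes_in_image[of \<sigma> "{1..n}"] by (auto simp: words_def simp del: atLeastAtMost_iff)
qed auto

lemma card_fixed_words:
  assumes "\<sigma> \<in> Sym N" "N \<le> n"
  shows "card {w \<in> words n k. map \<sigma> w = w} = (fixpts N \<sigma> + (n - N)) ^ k"
proof -
  have "{w \<in> words n k. map \<sigma> w = w} = {w. set w \<subseteq> {i \<in> {1..n}. \<sigma> i = i} \<and> length w = k}"
    by (auto simp: words_def map_eq_self_iff)
  then show ?thesis
    using card_lists_length_eq[of "{i \<in> {1..n}. \<sigma> i = i}" k] Sym_fixed[OF assms] by simp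
qed

text \<open>A word is fixed exactly if all its letters are, so the fixed injective words are those
  over the fixed points.\<close>

lemma card_fixed_inj_words:
  "card {w \<in> inj_words N t. map \<sigma> w = w} = falling (fixpts N \<sigma>) t"
proof -
  have "{w \<in> inj_words N t. map \<sigma> w = w} = {w. length w = t \<and> distinct w \<and> set w \<subseteq> {i \<in> {1..N}. \<sigma> i = i}}"
    by (auto simp: inj_words_def map_eq_self_iff)
  then show ?thesis
    using card_distinct_lists[of "{i \<in> {1..N}. \<sigma> i = i}" t] by (simp add: fixpts_def)
qed

lemma fixpts_le: "fixpts N \<sigma> \<le> N"
proof -
  have "card {i \<in> {1..N}. \<sigma> i = i} \<le> card {1..N}" by (rule card_mono) auto
  then show ?thesis by (simp add: fixpts_def)
qed

abbreviation Hom_specht :: "nat \<Rightarrow> nat list \<Rightarrow> nat list set \<Rightarrow> ((nat set list \<Rightarrow> 'a::field) \<Rightarrow> nat list \<Rightarrow> 'a) set"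
  where "Hom_specht N l X \<equiv> Hom_mod (Sym N) tabloid_action (specht l) tensor_action (supported X)"

lemma dim_Hom_specht:
  assumes l: "is_partition l N" and X: "perm_set N map X"
  shows "(of_nat (hs.dim (Hom_specht N l X :: ((nat set list \<Rightarrow> 'a::field_char_0) \<Rightarrow> nat list \<Rightarrow> 'a) set)) :: 'a)
    = (1 / fact N) * (\<Sum>\<sigma>\<in>Sym N. of_nat (card {w \<in> X. map \<sigma> w = w}) * specht_char l \<sigma>)"
  using dim_Hom_mod(1)[OF perm_set_tabloids[of l] X[folded is_partitionD(3)[OF l]]
      specht_module[unfolded tabloid_action_def] specht_subset, where ?'a = 'a]
  by (simp add: is_partitionD(3)[OF l] specht_char_def tabloid_action_def tensor_action_def)

text \<open>The coefficients \<open>c\<close> expand the fixed point character of the words in those of the injective words.\<close>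

lemma dim_Hom_words:
  assumes l: "is_partition l N" and N: "N \<le> n"
    and c: "\<And>x. x \<le> N \<Longrightarrow> (x + (n - N)) ^ k = (\<Sum>t\<le>N. c t * falling x t)"
  shows "hs.dim (Hom_specht N l (words n k) :: ((nat set list \<Rightarrow> 'a::field_char_0) \<Rightarrow> nat list \<Rightarrow> 'a) set)
      = (\<Sum>t\<le>N. c t * skew_count l (N - t))"
proof -
  let ?\<chi> = "specht_char l :: (nat \<Rightarrow> nat) \<Rightarrow> 'a"
  have "(of_nat (hs.dim (Hom_specht N l (words n k) :: ((nat set list \<Rightarrow> 'a) \<Rightarrow> nat list \<Rightarrow> 'a) set)) :: 'a)
    = (1 / fact N) * (\<Sum>\<sigma>\<in>Sym N. of_nat (\<Sum>t\<le>N. c t * falling (fixpts N \<sigma>) t) * ?\<chi> \<sigma>)"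
    unfolding dim_Hom_specht[OF l perm_set_words[OF N]]
    by (intro arg_cong[of _ _ "\<lambda>x. _ * x"] sum.cong refl)
       (simp only: card_fixed_words[OF _ N] c[OF fixpts_le])
  also have "\<dots> = (1 / fact N) * (\<Sum>\<sigma>\<in>Sym N. \<Sum>t\<le>N. of_nat (c t) * (of_nat (falling (fixpts N \<sigma>) t) * ?\<chi> \<sigma>))"
    by (simp add: sum_distrib_right mult.assoc)
  \<comment> \<open>For each \<open>t\<close> the inner average is again the dimension of a Hom
    space, the one for injective words of length \<open>t\<close>.\<close>
  also have "\<dots> = (\<Sum>t\<le>N. of_nat (c t) * ((1 / fact N) * (\<Sum>\<sigma>\<in>Sym N. of_nat (falling (fixpts N \<sigma>) t) * ?\<chi> \<sigma>)))"
    by (subst sum.swap) (simp add: sum_distrib_left mult_ac)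
  also have "\<dots> = (\<Sum>t\<le>N. of_nat (c t) * of_nat (skew_count l (N - t)))"
    using dim_Hom_specht[OF l perm_set_inj_words, where ?'a = 'a, symmetric]
    by (intro sum.cong refl) (simp add: dim_Hom_inj_words[OF l] card_fixed_inj_words)
  finally have "of_nat (hs.dim (Hom_specht N l (words n k) :: ((nat set list \<Rightarrow> 'a) \<Rightarrow> nat list \<Rightarrow> 'a) set)) =
      (of_nat (\<Sum>t\<le>N. c t * skew_count l (N - t)) :: 'a)" by simp
  then show ?thesis by (simp only: of_nat_eq_iff)
qed

text \<open>A row of length \<open>N - t\<close> fits into \<open>l\<close> exactly if it does not
  exceed the largest part, that is, if \<open>t\<close> is at least the sum of the other
  parts.\<close>

lemma sum_skew_count_eq:
  assumes l: "is_partition l N"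
  shows "(\<Sum>t\<le>N. c t * skew_count l (N - t)) = (\<Sum>t = sum_list (sharp l)..N. c t * num_std l (one_part (N - t)))"
proof -
  have sub: "young (one_part (N - t)) \<subseteq> young l \<longleftrightarrow> sum_list (sharp l) \<le> t" if "t \<le> N" for t
  proof (cases l)
    case Nil
    then show ?thesis using is_partitionD(3)[OF l] that by (simp add: young_one_part sharp_def)
  next
    case (Cons a m)
    then have N: "N = a + sum_list m" using is_partitionD(3)[OF l] by simp
    have "young (one_part (N - t)) \<subseteq> young l \<longleftrightarrow> N - t \<le> a"
      unfolding young_one_part using Cons
      by (auto simp: young_def subset_iff) (metis less_irrefl not_le)
    then show ?thesis using N Cons that by (auto simp: sharp_def)
  qed
  have "(\<Sum>t\<le>N. c t * skew_count l (N - t)) = (\<Sum>t = sum_list (sharp l)..N. c t * skew_count l (N - t))"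
    by (rule sum.mono_neutral_right) (auto simp: skew_count_def sub)
  also have "\<dots> = (\<Sum>t = sum_list (sharp l)..N. c t * num_std l (one_part (N - t)))"
    by (rule sum.cong) (auto simp: skew_count_def sub)
  finally show ?thesis .
qed

lemma is_partition_one_part: "is_partition (one_part N) N"
  by (simp add: is_partition_def one_part_def)

lemma sum_skew_count_one_part: "(\<Sum>t\<le>N. c t * skew_count (one_part N) (N - t)) = (\<Sum>t\<le>N. c t)"
  by (rule sum.cong) (auto simp: skew_count_def young_one_part num_std_one_part)

text \<open>Columns have height at most one and there is a single tabloid, so the Specht module is a
  line fixed pointwise, and its trace is its dimension. Size 0 is included, with the empty list as
  shape.\<close>

lemma specht_char_one_part:
  assumes \<sigma>: "\<sigma> \<in> Sym N"
  shows "specht_char (one_part N) \<sigma> = (1 :: 'a::field_char_0)"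
proof -
  let ?l = "one_part N"
  have row: "row_of ?l t x = 0" if "tableau ?l t" "x \<in> {1..N}" for t x
    using tableau_cell(1)[OF that(1), of x] that(2) by (simp add: young_one_part)
  have C: "column_stabilizer ?l t = {id}" if t: "tableau ?l t" for t
  proof -
    have "\<tau> = id" if \<tau>: "\<tau> \<in> column_stabilizer ?l t" for \<tau>
    proof
      fix x
      have S: "\<tau> \<in> Sym N" using column_stabilizer_Sym[OF \<tau>] by simp
      show "\<tau> x = id x"
      proof (cases "x \<in> {1..N}")
        case True
        then have "\<tau> x \<in> {1..N}" using Sym_in[OF S] by blast
        then have "\<tau> x = x"
          using tableau_eqI[OF t, of "\<tau> x" x] row[OF t] True \<tau> column_stabilizer_iff[OF t] by simp
        then show ?thesis by simp
      next
        case False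
        then show ?thesis using S by (auto simp: Sym_def permutes_def)
      qed
    qed
    then show ?thesis using column_stabilizer_group(1)[OF t] by auto
  qed
  obtain t where t: "tableau ?l t" using tableau_exists by auto
  let ?e = "polytabloid ?l t :: nat set list \<Rightarrow> 'a"
  have e: "polytabloid ?l s = ?e" if s: "tableau ?l s" for s
    using tabloid_eq_iff[OF s t] row[OF s] row[OF t] by (simp add: polytabloid_def C[OF s] C[OF t])
  have sp: "specht ?l = fs.span {?e}"
  proof -
    have "{polytabloid ?l t |t. tableau ?l t} = {?e}" using e t by blast
    then show ?thesis by (simp add: specht_def)
  qed
  have "?e \<noteq> 0" using polytabloid_diagonal[OF t, where ?'a = 'a] by auto
  then have dim: "fs.dim (specht ?l :: (nat set list \<Rightarrow> 'a) set) = 1"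
    unfolding sp by (subst fs.dim_span_eq_card_independent) auto
  have inv: "tabloid_action \<sigma> v = v" if "v \<in> specht ?l" for v :: "nat set list \<Rightarrow> 'a"
  proof -
    obtain c where "v = fscale c ?e" using \<open>v \<in> specht ?l\<close> unfolding sp by (auto simp: fs.span_singleton)
    moreover have "tabloid_action \<sigma> ?e = ?e"
      using polytabloid_action[OF t, of \<sigma>, where ?'a = 'a] e[OF tableau_comp[OF t, of \<sigma>]] \<sigma> by simp
    ultimately show ?thesis by (simp add: tabloid_action_def)
  qed
  let ?V = "specht ?l :: (nat set list \<Rightarrow> 'a) set"
  interpret perm_set N "\<lambda>\<sigma>. map ((`) \<sigma>)" "tabloids ?l"
    using perm_set_tabloids[of ?l] by simp
  have mV: "is_module (Sym N) tabloid_action ?V" using specht_module[of ?l] by simp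
  obtain p where p: "lin_on fscale fscale UNIV p" "\<And>v. p v \<in> ?V" "\<And>v. v \<in> ?V \<Longrightarrow> p v = v"
    using maschke[OF mV[unfolded tabloid_action_def]] by metis
  have p': "lin_on fscale fscale (supported (tabloids ?l)) p" using p(1) lin_on_subset by blast
  have "specht_char ?l \<sigma> = (\<Sum>y\<in>tabloids ?l. tabloid_action \<sigma> (p (delta y)) y)"
    unfolding specht_char_def
    by (rule projection_trace[OF finite_X is_moduleD(1)[OF mV] specht_subset p' p(3,2)])
       (simp_all add: tabloid_action_def is_moduleD(2)[OF mV \<sigma>, unfolded tabloid_action_def])
  also have "\<dots> = of_nat (fs.dim ?V)"
    by (simp add: projection_dim[OF finite_X is_moduleD(1)[OF mV] specht_subset p' p(3,2)] inv p(2))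
  finally show ?thesis by (simp add: dim)
qed

text \<open>Both dimensions average the power \<open>2 * k\<close> of the number of fixed points:
  once as the character of the target times that of the source, once as the character of the larger
  tensor power times the trivial one.\<close>

lemma dim_End_words:
  assumes N: "N \<le> n"
  shows "hs.dim (Hom_mod (Sym N) tensor_action (supported (words n k)) tensor_action
      (supported (words n k)) :: ((nat list \<Rightarrow> 'a::field_char_0) \<Rightarrow> nat list \<Rightarrow> 'a) set)
    = hs.dim (Hom_specht N (one_part N) (words n (2 * k)) :: ((nat set list \<Rightarrow> 'a) \<Rightarrow> nat list \<Rightarrow> 'a) set)"
proof -
  interpret perm_set N map "words n k" by (rule perm_set_words[OF N])
  have tr: "trace_on (supported (words n k)) (perm_action map \<sigma>) =
      (of_nat ((fixpts N \<sigma> + (n - N)) ^ k) :: 'a)" if s: "\<sigma> \<in> Sym N" for \<sigma>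
  proof -
    have "trace_on (supported (words n k)) (perm_action map \<sigma>) = (\<Sum>w\<in>words n k. perm_action map \<sigma> (delta w) w :: 'a)"
      by (rule projection_trace[where p = "\<lambda>v. v"]) (auto simp: lin_on_def perm_action_supported s)
    also have "\<dots> = (\<Sum>w\<in>words n k. if map \<sigma> w = w then 1 else 0)"
      by (rule sum.cong[OF refl], simp only: perm_action_delta[OF s]) (simp add: delta_def eq_commute)
    also have "\<dots> = of_nat (card {w \<in> words n k. map \<sigma> w = w})"
      by (simp add: sum.If_cases Int_def)
    finally show ?thesis by (simp only: card_fixed_words[OF s N])
  qed
  have "(of_nat (hs.dim (Hom_mod (Sym N) tensor_action (supported (words n k)) tensor_action
      (supported (words n k)) :: ((nat list \<Rightarrow> 'a) \<Rightarrow> nat list \<Rightarrow> 'a) set)) :: 'a) =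
      (1 / fact N) * (\<Sum>\<sigma>\<in>Sym N. of_nat (card {w \<in> words n k. map \<sigma> w = w}) *
        trace_on (supported (words n k)) (perm_action map \<sigma>))"
    unfolding tensor_action_def
    by (rule dim_Hom_mod(1)[OF perm_set_words[OF N] perm_set_words[OF N] module_supported order_refl])
  also have "\<dots> = (1 / fact N) * (\<Sum>\<sigma>\<in>Sym N. of_nat (card {w \<in> words n (2 * k). map \<sigma> w = w}) * specht_char (one_part N) \<sigma>)"
    by (intro arg_cong[of _ _ "\<lambda>x. _ * x"] sum.cong refl)
       (simp add: tr card_fixed_words[OF _ N] specht_char_one_part power_mult power2_eq_square power_mult_distrib)
  also have "\<dots> = of_nat (hs.dim (Hom_specht N (one_part N) (words n (2 * k)) ::
      ((nat set list \<Rightarrow> 'a) \<Rightarrow> nat list \<Rightarrow> 'a) set))"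
    by (rule dim_Hom_specht[OF is_partition_one_part perm_set_words[OF N], symmetric])
  finally show ?thesis by (simp only: of_nat_eq_iff)
qed

lemma tensor_mult_eq_dim:
  assumes "is_partition l n"
  shows "tensor_mult TYPE('a::field_char_0) k n l =
    hs.dim (Z_irr k n l :: ((nat set list \<Rightarrow> 'a) \<Rightarrow> nat list \<Rightarrow> 'a) set)"
proof -
  note l = is_partitionD[OF assms]
  interpret perm_set n map "words n k" by (rule perm_set_words) simp
  show ?thesis
    unfolding tensor_mult_def Z_irr_def tensor_power_eq tensor_action_def tabloid_action_def
    by (rule multiplicity_eq_dim_Hom[OF specht_irreducible[OF l(1,2), unfolded l(3) tabloid_action_def]])
       (rule specht_Hom_scalar[OF l(1,2), unfolded l(3) tabloid_action_def])
qed

section \<open>Irreducible modules of the centralizer algebras\<close>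

lemma Z_irr_eq: "Z_irr k n l = Hom_specht n l (words n k)"
  by (simp add: Z_irr_def tensor_power_eq)

lemma Z_half_irr_eq: "Z_half_irr k n l = Hom_specht (n - 1) l (words n k)"
  by (simp add: Z_half_irr_def tensor_power_eq)

lemma dim_Z_irr:
  fixes l :: "nat list" and n :: nat
  defines "Z \<equiv> \<lambda>k. Z_irr k n l :: ((nat set list \<Rightarrow> 'a::field_char_0) \<Rightarrow> nat list \<Rightarrow> 'a) set"
  assumes l: "is_partition l n"
  shows "hs.dim (Z k) = (\<Sum>t\<le>n. Stirling k t * skew_count l (n - t))"
    and "of_nat (hs.dim (Z k)) = (1 / fact n) * (\<Sum>\<sigma>\<in>Sym n. of_nat (fixpts n \<sigma>) ^ k * specht_char l \<sigma> :: 'a)"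
proof -
  show "hs.dim (Z k) = (\<Sum>t\<le>n. Stirling k t * skew_count l (n - t))"
    unfolding Z_def Z_irr_eq by (rule dim_Hom_words[OF l]) (simp_all add: power_Stirling)
  show "of_nat (hs.dim (Z k)) = (1 / fact n) * (\<Sum>\<sigma>\<in>Sym n. of_nat (fixpts n \<sigma>) ^ k * specht_char l \<sigma> :: 'a)"
    unfolding Z_def Z_irr_eq dim_Hom_specht[OF l perm_set_words[OF order_refl]]
    by (intro arg_cong[of _ _ "\<lambda>x. _ * x"] sum.cong refl) (simp add: card_fixed_words[OF _ order_refl])
qed

lemma dim_Z_half_irr:
  fixes l :: "nat list" and n :: nat
  defines "Z \<equiv> \<lambda>k. Z_half_irr k n l :: ((nat set list \<Rightarrow> 'a::field_char_0) \<Rightarrow> nat list \<Rightarrow> 'a) set"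
  assumes l: "is_partition l (n - 1)" and n: "n \<ge> 1"
  shows "hs.dim (Z k) = (\<Sum>t\<le>n - 1. Stirling (k + 1) (t + 1) * skew_count l (n - 1 - t))"
    and "of_nat (hs.dim (Z k)) = (1 / fact (n - 1)) *
      (\<Sum>\<sigma>\<in>Sym (n - 1). (of_nat (fixpts (n - 1) \<sigma>) + 1) ^ k * specht_char l \<sigma> :: 'a)"
proof -
  \<comment> \<open>Exactly one point lies outside the range of the subgroup, and it turns the count
    \<open>x\<close> into \<open>x + 1\<close>.\<close>
  have le: "n - 1 \<le> n" and one: "n - (n - 1) = 1" using n by auto
  show "hs.dim (Z k) = (\<Sum>t\<le>n - 1. Stirling (k + 1) (t + 1) * skew_count l (n - 1 - t))"
    unfolding Z_def Z_half_irr_eq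
  proof (rule dim_Hom_words[OF l le])
    show "(x + (n - (n - 1))) ^ k = (\<Sum>t\<le>n - 1. Stirling (k + 1) (t + 1) * falling x t)" if "x \<le> n - 1" for x
      using Suc_power_Stirling[OF that, of k] by (simp only: one) simp
  qed
  show "of_nat (hs.dim (Z k)) = (1 / fact (n - 1)) *
      (\<Sum>\<sigma>\<in>Sym (n - 1). (of_nat (fixpts (n - 1) \<sigma>) + 1) ^ k * specht_char l \<sigma> :: 'a)"
    unfolding Z_def Z_half_irr_eq dim_Hom_specht[OF l perm_set_words[OF le]]
    by (intro arg_cong[of _ _ "\<lambda>x. _ * x"] sum.cong refl)
       (simp only: card_fixed_words[OF _ le] one of_nat_power of_nat_add of_nat_1)
qed

theorem theorem3p6:
  fixes k n :: nat
  assumes "n \<ge> 1"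
  shows
    "(\<forall>l \<in> Lam TYPE('a::field_char_0) k n.
       (1 / fact n) * (\<Sum>\<sigma>\<in>Sym n. of_nat (fixpts n \<sigma>) ^ k * specht_char l \<sigma>)
         = (of_nat (hs.dim (Z_irr k n l :: ((nat set list \<Rightarrow> 'a) \<Rightarrow> nat list \<Rightarrow> 'a) set)) :: 'a) \<and>
       hs.dim (Z_irr k n l :: ((nat set list \<Rightarrow> 'a) \<Rightarrow> nat list \<Rightarrow> 'a) set) = tensor_mult TYPE('a) k n l \<and>
       tensor_mult TYPE('a) k n l
         = (\<Sum>t = sum_list (sharp l)..n. Stirling k t * num_std l (one_part (n - t)))) \<and>
    (hs.dim (Z_end k n :: ((nat list \<Rightarrow> 'a) \<Rightarrow> nat list \<Rightarrow> 'a) set)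
       = hs.dim (Z_irr (2 * k) n (one_part n) :: ((nat set list \<Rightarrow> 'a) \<Rightarrow> nat list \<Rightarrow> 'a) set) \<and>
     (of_nat (hs.dim (Z_irr (2 * k) n (one_part n) ::
         ((nat set list \<Rightarrow> 'a) \<Rightarrow> nat list \<Rightarrow> 'a) set)) :: 'a)
       = (1 / fact n) * (\<Sum>\<sigma>\<in>Sym n. of_nat (fixpts n \<sigma>) ^ (2 * k)) \<and>
     (1 / fact n) * (\<Sum>\<sigma>\<in>Sym n. of_nat (fixpts n \<sigma>) ^ (2 * k))
       = (of_nat (\<Sum>t = 0..n. Stirling (2 * k) t) :: 'a) \<and>
     (\<Sum>t = 0..n. Stirling (2 * k) t) = bell_le (2 * k) n \<and>
     (n \<ge> 2 * k \<longrightarrow>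
        hs.dim (Z_end k n :: ((nat list \<Rightarrow> 'a) \<Rightarrow> nat list \<Rightarrow> 'a) set) = bell_le (2 * k) n \<and>
        bell_le (2 * k) n = bell (2 * k))) \<and>
    (\<forall>mu \<in> Lam_half TYPE('a) k n.
       hs.dim (Z_half_irr k n mu :: ((nat set list \<Rightarrow> 'a) \<Rightarrow> nat list \<Rightarrow> 'a) set)
         = (\<Sum>t = sum_list (sharp mu)..n - 1.
              Stirling (k + 1) (t + 1) * num_std mu (one_part (n - 1 - t))) \<and>
       (of_nat (\<Sum>t = sum_list (sharp mu)..n - 1.
              Stirling (k + 1) (t + 1) * num_std mu (one_part (n - 1 - t))) :: 'a)
         = (1 / fact (n - 1)) *
           (\<Sum>\<tau>\<in>Sym (n - 1). (of_nat (fixpts (n - 1) \<tau>) + 1) ^ k * specht_char mu \<tau>)) \<and>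
    (hs.dim (Z_end_half k n :: ((nat list \<Rightarrow> 'a) \<Rightarrow> nat list \<Rightarrow> 'a) set)
       = hs.dim (Z_half_irr (2 * k) n (one_part (n - 1)) ::
           ((nat set list \<Rightarrow> 'a) \<Rightarrow> nat list \<Rightarrow> 'a) set) \<and>
     hs.dim (Z_half_irr (2 * k) n (one_part (n - 1)) ::
         ((nat set list \<Rightarrow> 'a) \<Rightarrow> nat list \<Rightarrow> 'a) set)
       = (\<Sum>t = 1..n. Stirling (2 * k + 1) t) \<and>
     (\<Sum>t = 1..n. Stirling (2 * k + 1) t) = bell_le (2 * k + 1) n \<and>
     (n \<ge> 2 * k + 1 \<longrightarrow>
        hs.dim (Z_end_half k n :: ((nat list \<Rightarrow> 'a) \<Rightarrow> nat list \<Rightarrow> 'a) set) = bell_le (2 * k + 1) n \<and>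
        bell_le (2 * k + 1) n = bell (2 * k + 1)))"
proof -
  let ?Z = "\<lambda>k l. Z_irr k n l :: ((nat set list \<Rightarrow> 'a) \<Rightarrow> nat list \<Rightarrow> 'a) set"
  let ?H = "\<lambda>k l. Z_half_irr k n l :: ((nat set list \<Rightarrow> 'a) \<Rightarrow> nat list \<Rightarrow> 'a) set"
  have a: "(1 / fact n) * (\<Sum>\<sigma>\<in>Sym n. of_nat (fixpts n \<sigma>) ^ k * specht_char l \<sigma>) = (of_nat (hs.dim (?Z k l)) :: 'a) \<and>
      hs.dim (?Z k l) = tensor_mult TYPE('a) k n l \<and>
      tensor_mult TYPE('a) k n l = (\<Sum>t = sum_list (sharp l)..n. Stirling k t * num_std l (one_part (n - t)))"
    if "l \<in> Lam TYPE('a) k n" for l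
  proof -
    have l: "is_partition l n" using that by (simp add: Lam_def)
    show ?thesis
      using dim_Z_irr[OF l, where ?'a = 'a, of k] tensor_mult_eq_dim[OF l, where ?'a = 'a, of k]
        sum_skew_count_eq[OF l, of "Stirling k"] by simp
  qed
  have c: "hs.dim (?H k mu) = (\<Sum>t = sum_list (sharp mu)..n - 1. Stirling (k + 1) (t + 1) * num_std mu (one_part (n - 1 - t))) \<and>
      (of_nat (\<Sum>t = sum_list (sharp mu)..n - 1. Stirling (k + 1) (t + 1) * num_std mu (one_part (n - 1 - t))) :: 'a)
        = (1 / fact (n - 1)) * (\<Sum>\<tau>\<in>Sym (n - 1). (of_nat (fixpts (n - 1) \<tau>) + 1) ^ k * specht_char mu \<tau>)"
    if "mu \<in> Lam_half TYPE('a) k n" for mu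
  proof -
    have mu: "is_partition mu (n - 1)" using that by (simp add: Lam_half_def)
    show ?thesis
      using dim_Z_half_irr[OF mu assms, where ?'a = 'a, of k]
      unfolding sum_skew_count_eq[OF mu, of "\<lambda>t. Stirling (k + 1) (t + 1)"] by simp
  qed
  have b1: "hs.dim (Z_end k n :: ((nat list \<Rightarrow> 'a) \<Rightarrow> nat list \<Rightarrow> 'a) set) = hs.dim (?Z (2 * k) (one_part n))"
    unfolding Z_end_def tensor_power_eq Z_irr_eq by (rule dim_End_words) simp
  have b2: "hs.dim (?Z (2 * k) (one_part n)) = (\<Sum>t = 0..n. Stirling (2 * k) t)"
    unfolding dim_Z_irr(1)[OF is_partition_one_part] sum_skew_count_one_part by (simp add: atMost_atLeast0)
  have b3: "(of_nat (hs.dim (?Z (2 * k) (one_part n))) :: 'a) = (1 / fact n) * (\<Sum>\<sigma>\<in>Sym n. of_nat (fixpts n \<sigma>) ^ (2 * k))"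
    unfolding dim_Z_irr(2)[OF is_partition_one_part]
    by (intro arg_cong[of _ _ "\<lambda>x. _ * x"] sum.cong refl) (simp add: specht_char_one_part)
  have b4: "(\<Sum>t = 0..n. Stirling (2 * k) t) = bell_le (2 * k) n"
    by (simp add: bell_le_eq atMost_atLeast0)
  have d1: "hs.dim (Z_end_half k n :: ((nat list \<Rightarrow> 'a) \<Rightarrow> nat list \<Rightarrow> 'a) set) = hs.dim (?H (2 * k) (one_part (n - 1)))"
    unfolding Z_end_half_def tensor_power_eq Z_half_irr_eq by (rule dim_End_words) simp
  have d2: "hs.dim (?H (2 * k) (one_part (n - 1))) = (\<Sum>t = 1..n. Stirling (2 * k + 1) t)"
  proof -
    have "hs.dim (?H (2 * k) (one_part (n - 1))) = (\<Sum>t\<le>n - 1. Stirling (2 * k + 1) (t + 1))"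
      unfolding dim_Z_half_irr(1)[OF is_partition_one_part assms]
      by (rule sum_skew_count_one_part)
    \<comment> \<open>The shift by one takes the range from 0 to \<open>n - 1\<close> to the range
      from 1 to \<open>n\<close>; this relies on \<open>n \<ge> 1\<close>.\<close>
    also have "\<dots> = (\<Sum>t = 1..n. Stirling (2 * k + 1) t)"
      by (rule sum.reindex_bij_witness[of _ "\<lambda>t. t - 1" "\<lambda>t. t + 1"]) (use assms in auto)
    finally show ?thesis .
  qed
  \<comment> \<open>The term at 0, absent on the left, vanishes because \<open>2 * k + 1\<close> is
    positive.\<close>
  have d3: "(\<Sum>t = 1..n. Stirling (2 * k + 1) t) = bell_le (2 * k + 1) n"
    unfolding bell_le_eq by (rule sum.mono_neutral_left) (auto simp: not_le)
  have b5: "(1 / fact n) * (\<Sum>\<sigma>\<in>Sym n. of_nat (fixpts n \<sigma>) ^ (2 * k)) = (of_nat (\<Sum>t = 0..n. Stirling (2 * k) t) :: 'a)"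
    using b3 unfolding b2 by (rule sym)
  note a' = a[THEN conjunct1] a[THEN conjunct2, THEN conjunct1] a[THEN conjunct2, THEN conjunct2]
    and c' = c[THEN conjunct1] c[THEN conjunct2]
    and b' = b1 b3 b5 b4 b1[unfolded b2 b4] and d' = d1 d2 d3 d1[unfolded d2 d3]
  show ?thesis
    by (intro conjI ballI impI) (assumption | rule b' d' bell_le_eq_bell | erule a' c')+
qed

end
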